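(* Let $\lambda\in(0,1]$, $\Lambda>0$, and let $\{g^{ij}(x,s)\}_{i,j=1}^n$ be a real symmetric $n\times n$ matrix on $\mathbb R^{n+1}$ such that for all $\xi\in\mathbb R^n$, $(x,s),(y,\tau)\in\mathbb R^{n+1}$ $$\lambda|\xi|^2\le\sum_{i,j}g^{ij}(x,s)\xi_i\xi_j\le\lambda^{-1}|\xi|^2,\qquad \Big(\sum_{i,j}(g^{ij}(x,s)-g^{ij}(y,\tau))^2\Big)^{1/2}\le\Lambda(|x-y|^2+|s-\tau|)^{1/2},$$ and $g^{ij}(0,0)=\delta^{ij}$. Let $Pu=\partial_i(g^{ij}(x,s)\partial_ju)+\partial_su$. Then there exist constants $C\ge1$, $\eta_0\in(0,1)$, $\delta_1\in(0,1)$ depending only on $\lambda$ and $\Lambda$ (and $n$) such that for every $\alpha\ge2$, every $\delta\in(0,\delta_1]$, every $a$ with $0<a\le\frac{\delta^2}{4\alpha}$, and every $u\in C_0^\infty(\mathbb R^n\times[0,+\infty))$ with $\mathrm{supp}\,u\subset B_{\eta_0}\times[0,\frac{\delta^2}{2\alpha})$, $$\alpha\int_{\mathbb R^{n+1}_+}\sigma_a^{-2\alpha-2}(s)\,\theta(\gamma(s+a))\,u^2e^{-\frac{|x|^2}{4(s+a)}}dX+\int_{\mathbb R^{n+1}_+}(s+a)\sigma_a^{-2\alpha-2}(s)\,\theta(\gamma(s+a))\,|\nabla_gu|_g^2e^{-\frac{|x|^2}{4(s+a)}}dX$$ $$\le C\int_{\mathbb R^{n+1}_+}(s+a)^2\sigma_a^{-2\alpha-2}(s)|Pu|^2e^{-\frac{|x|^2}{4(s+a)}}dX+C^\alpha\alpha^{\alpha}\int_{\mathbb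 R^{n+1}_+}\big(u^2+(s+a)|\nabla_gu|_g^2\big)dX$$ $$+C\alpha\,\sigma^{-2\alpha-1}(a)\int_{\mathbb R^n}u^2(x,0)e^{-\frac{|x|^2}{4a}}dx-\frac{\sigma^{-2\alpha}(a)}{C}\int_{\mathbb R^n}|(\nabla_gu)(x,0)|^2_{g(\cdot,0)}e^{-\frac{|x|^2}{4a}}dx,$$ where $\gamma=\alpha/\delta^2$.
   Context: Summation over repeated indices. $\mathbb R^{n+1}_+=\mathbb R^n\times(0,+\infty)$, $dX=dx\,ds$, $B_r$ is the open ball of radius $r$ centered at $0$ in $\mathbb R^n$. $g(x,s)=\{g_{ij}\}$ is the inverse matrix of $g^{-1}(x,s)=\{g^{ij}\}$; $\nabla_gu=g^{-1}\nabla_xu$ and $|\xi|_g^2=g_{ij}\xi_i\xi_j$, so $|\nabla_gu|_g^2=g^{ij}\partial_iu\,\partial_ju$. $\theta(s)=s^{1/2}\left(\log\frac1s\right)^{3/2}$ for $s\in(0,1]$. For $\gamma=\alpha/\delta^2$, $$\sigma(s)=s\exp\left(-\int_0^{\gamma s}\Big(1-\exp\Big(-\int_0^t\frac{\theta(\eta)}{\eta}d\eta\Big)\Big)\frac{dt}{t}\right),\qquad \sigma_a(s)=\sigma(s+a),$$ for $0\le\gamma s\le1$ (respectively $0\le \gamma(s+a)\le 1$). *)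

theory Defs
  imports "HOL-Analysis.Analysis"
begin

text \<open>Points of \<open>\<real>\<^sup>n\<^sup>+\<^sup>1\<close> are pairs \<open>(x, s)\<close> of type \<^typ>\<open>(real^'n) \<times> real\<close>.
  The matrix field written \<open>G\<close> below is \<open>g\<^sup>-\<^sup>1 = {g\<^sup>i\<^sup>j}\<close> (upper indices); the metric
  \<open>g = {g\<^sub>i\<^sub>j}\<close> is its matrix inverse.\<close>

definition open_half_space :: "((real^'n::finite) \<times> real) set" where
  "open_half_space = UNIV \<times> {0<..}"

definition closed_half_space :: "((real^'n::finite) \<times> real) set" where
  "closed_half_space = UNIV \<times> {0..}"

text \<open>Class \<open>C\<^sup>k\<close> on \<open>S\<close>, with derivatives taken relative to \<open>S\<close>.  This is only sensible where
  the relative derivative is unique, e.g. for convex \<open>S\<close> with nonempty interior; on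
  \<^const>\<open>closed_half_space\<close> it means smoothness up to the boundary.\<close>

primrec Ck_on :: "nat \<Rightarrow> 'a::real_normed_vector set \<Rightarrow> ('a \<Rightarrow> real) \<Rightarrow> bool" where
  "Ck_on 0 S f \<longleftrightarrow> continuous_on S f"
| "Ck_on (Suc k) S f \<longleftrightarrow> f differentiable_on S \<and>
     (\<forall>v. Ck_on k S (\<lambda>x. frechet_derivative f (at x within S) v))"

definition supp_on :: "'a::topological_space set \<Rightarrow> ('a \<Rightarrow> real) \<Rightarrow> 'a set" where
  "supp_on S f = S \<inter> closure {x \<in> S. f x \<noteq> 0}"

text \<open>\<open>C\<^sub>0\<^sup>\<infinity>(S)\<close>.  The support is compact in \<open>S\<close> but may meet the part of the boundary contained
  in \<open>S\<close>, so on \<^const>\<open>closed_half_space\<close> the trace at \<open>s = 0\<close> need not vanish.\<close>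

definition Cinf_compact_on :: "'a::real_normed_vector set \<Rightarrow> ('a \<Rightarrow> real) \<Rightarrow> bool" where
  "Cinf_compact_on S f \<longleftrightarrow> (\<forall>k. Ck_on k S f) \<and> compact (supp_on S f)"

definition partial_x :: "'n::finite \<Rightarrow> ((real^'n) \<times> real \<Rightarrow> real) \<Rightarrow> (real^'n) \<times> real \<Rightarrow> real" where
  "partial_x i f X = deriv (\<lambda>t. f (fst X + t *\<^sub>R axis i 1, snd X)) 0"

definition partial_s :: "((real^'n::finite) \<times> real \<Rightarrow> real) \<Rightarrow> (real^'n) \<times> real \<Rightarrow> real" where
  "partial_s f X = deriv (\<lambda>\<tau>. f (fst X, \<tau>)) (snd X)"

definition grad_x :: "((real^'n::finite) \<times> real \<Rightarrow> real) \<Rightarrow> (real^'n) \<times> real \<Rightarrow> real^'n" where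
  "grad_x u X = (\<chi> j. partial_x j u X)"

definition grad_g ::
  "((real^'n::finite) \<times> real \<Rightarrow> real^'n^'n) \<Rightarrow> ((real^'n) \<times> real \<Rightarrow> real) \<Rightarrow> (real^'n) \<times> real \<Rightarrow> real^'n"
  where "grad_g G u X = G X *v grad_x u X"

definition norm_g_sq ::
  "((real^'n::finite) \<times> real \<Rightarrow> real^'n^'n) \<Rightarrow> (real^'n) \<times> real \<Rightarrow> real^'n \<Rightarrow> real"
  where "norm_g_sq G X \<xi> = (\<Sum>i\<in>UNIV. \<Sum>j\<in>UNIV. matrix_inv (G X) $ i $ j * \<xi> $ i * \<xi> $ j)"

text \<open>The coefficients are merely Lipschitz in \<open>x\<close>, so \<open>g\<^sup>i\<^sup>j \<partial>\<^sub>j u\<close> is differentiable in \<open>x\<close>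
  only almost everywhere (Rademacher); \<open>P u\<close> is the a.e. defined function obtained from
  classical partial derivatives.  On the exceptional null set \<^const>\<open>deriv\<close> returns an
  unspecified value, which does not affect Lebesgue integrals.\<close>

definition parabolic_op ::
  "((real^'n::finite) \<times> real \<Rightarrow> real^'n^'n) \<Rightarrow> ((real^'n) \<times> real \<Rightarrow> real) \<Rightarrow> (real^'n) \<times> real \<Rightarrow> real"
  where "parabolic_op G u X =
    (\<Sum>i\<in>UNIV. partial_x i (\<lambda>Y. \<Sum>j\<in>UNIV. G Y $ i $ j * partial_x j u Y) X) + partial_s u X"

definition admissible_coeff ::
  "real \<Rightarrow> real \<Rightarrow> ((real^'n::finite) \<times> real \<Rightarrow> real^'n^'n) \<Rightarrow> bool" where
  "admissible_coeff lam Lam G \<longleftrightarrow>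
     (\<forall>X. transpose (G X) = G X) \<and>
     (\<forall>X \<xi>. lam * (norm \<xi>)\<^sup>2 \<le> (\<Sum>i\<in>UNIV. \<Sum>j\<in>UNIV. G X $ i $ j * \<xi> $ i * \<xi> $ j) \<and>
            (\<Sum>i\<in>UNIV. \<Sum>j\<in>UNIV. G X $ i $ j * \<xi> $ i * \<xi> $ j) \<le> inverse lam * (norm \<xi>)\<^sup>2) \<and>
     (\<forall>x s y \<tau>. sqrt (\<Sum>i\<in>UNIV. \<Sum>j\<in>UNIV. (G (x, s) $ i $ j - G (y, \<tau>) $ i $ j)\<^sup>2)
                 \<le> Lam * sqrt ((norm (x - y))\<^sup>2 + \<bar>s - \<tau>\<bar>)) \<and>
     G (0, 0) = mat 1"

text \<open>\<open>\<theta>\<close> is meant for arguments in \<open>(0, 1]\<close>, and \<open>\<sigma>\<close> for \<open>0 \<le> \<gamma> s \<le> 1\<close>.\<close>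

definition theta :: "real \<Rightarrow> real" where
  "theta s = s powr (1/2) * (ln (1 / s)) powr (3/2)"

definition weight_sigma :: "real \<Rightarrow> real \<Rightarrow> real" where
  "weight_sigma \<gamma> s = s * exp (- (LINT t:{0<..\<gamma> * s}|lebesgue.
       (1 - exp (- (LINT \<eta>:{0<..t}|lebesgue. theta \<eta> / \<eta>))) / t))"

definition weight_sigma_shift :: "real \<Rightarrow> real \<Rightarrow> real \<Rightarrow> real" where
  "weight_sigma_shift \<gamma> a s = weight_sigma \<gamma> (s + a)"

end

theory Submission
  imports Defs
begin

text \<open>Write \<open>t = s + a\<close>, \<open>b = \<alpha> + 1/2\<close> and freeze the metric at time \<open>0\<close>: \<open>h(x) = g\<^sup>-\<^sup>1(x, 0)\<close>.  The frozen
  metric is Lipschitz in \<open>x\<close>, does not depend on \<open>s\<close>, and differs from \<open>g\<^sup>-\<^sup>1\<close> by at most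
  \<open>\<Lambda> s\<^sup>1\<^sup>/\<^sup>2\<close>, so no time derivative of the merely Hoelder continuous \<open>g\<close> ever appears.  For
  \<open>v = \<sigma>(t)\<^sup>-\<^sup>b exp(-|x|\<^sup>2/8t) u\<close> the equation becomes \<open>S v + w/t = f\<close> up to lower order terms, where
  \<open>S = div(h \<nabla>) + q\<close> is symmetric and \<open>w = t v\<^sub>t + (hx/2)\<cdot>\<nabla>v + (n/4) v\<close>.  A Rellich identity writes
  \<open>2 (S v) w\<close> as divergences plus \<open>(b \<theta>/t) v\<^sup>2\<close>, which comes from the concavity of \<open>log \<sigma>\<close> in
  \<open>log t\<close>, plus errors of size \<open>|x| (|\<nabla>v|\<^sup>2 + (b/t + |x|\<^sup>2/t\<^sup>2) v\<^sup>2)\<close>.  These errors are absorbed by testing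
  \<open>S v\<close> with \<open>m v\<close> for the multiplier \<open>m = |x|\<^sup>2/\<tau> + c \<theta>\<close>, \<open>\<tau> = (b t)\<^sup>1\<^sup>/\<^sup>2\<close>: as \<open>\<tau> = O(\<delta> \<theta>)\<close>, the weight \<open>|x|\<close> is
  a small multiple of \<open>m\<close>.  The second order error \<open>(g\<^sup>-\<^sup>1 - h) D\<^sup>2u\<close> is controlled by
  \<open>\<integral>|D\<^sup>2v|\<^sup>2 = \<integral>(\<Delta>v)\<^sup>2\<close> because \<open>h\<close> is close to the identity near the origin.  Everything is an
  almost everywhere inequality modulo divergences, which is integrated once.\<close>

section \<open>Differentiability almost everywhere along a direction\<close>

text \<open>The choice \<open>\<gamma> = \<alpha> / \<delta>\<^sup>2\<close> is what makes the
  absorption close: \<open>b * t\<close> is at most a constant times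
  \<open>\<delta>\<^sup>2 * (\<gamma> * t)\<close> and \<open>theta r\<close> dominates a multiple
  of \<open>sqrt r\<close>, so \<open>sqrt (b * t)\<close> is at most \<open>10 * \<delta>\<close>
  times theta, uniformly in \<alpha> and a. Integrability of theta(r)/r at 0 keeps t
  \<sigma>'(t)/\<sigma>(t) between exp (-60) and 1 and makes \<sigma> comparable with t; this is
  where the explicit constants come from. Both boundary integrals have one source, the value of t (q
  v^2 - h\<nabla>v.\<nabla>v) at time 0. Two regularity obstacles shape the analytic part. The
  coefficients are only Lipschitz in x, so divergences must be integrated for functions that are
  differentiable merely almost everywhere; since only derivatives along coordinate directions occur,
  Lebesgue's theorem on lines and Fubini can replace Rademacher's theorem. And u is smooth only
  relative to the closed half-space, with a nonzero trace at s = 0, so derivatives in s are taken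
  for 0 < s < T alone and continuity carries the identities to the ends.\<close>

lemma null_oscillating_slopes:
  fixes f :: "real \<Rightarrow> real"
  assumes mono: "mono f" and cont: "continuous_on UNIV f" and pq: "p < q" "0 < p"
    and lower: "\<And>x d. x \<in> E \<Longrightarrow> 0 < d \<Longrightarrow> \<exists>a b. a < x \<and> x < b \<and> b - a < d \<and> f b - f a < p * (b - a)"
    and upper: "\<And>x d. x \<in> E \<Longrightarrow> 0 < d \<Longrightarrow> \<exists>a b. a < x \<and> x < b \<and> b - a < d \<and> f b - f a > q * (b - a)"
    and E: "E \<in> sets borel" "emeasure lborel E < \<infinity>"
  shows "emeasure lborel E = 0"
proof -
  define \<nu> where "\<nu> = interval_measure f"
  have isC: "isCont f x" for x using cont by (simp add: continuous_on_eq_continuous_at)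
  have mn: "x \<le> y \<Longrightarrow> f x \<le> f y" for x y using mono by (auto dest: monoD)
  \<comment> \<open>Vitali's theorem supplies open balls, so the Stieltjes measure of f is computed
    on open intervals; continuity of f rules out atoms at the endpoints.\<close>
  have nuI: "emeasure \<nu> {a<..<b} = ennreal (f b - f a)" if "a < b" for a b
  proof -
    have Ioc: "emeasure \<nu> {a<..b} = ennreal (f b - f a)"
      unfolding \<nu>_def by (rule emeasure_interval_measure_Ioc) (use that mn isC in \<open>auto simp: continuous_at_imp_continuous_at_within\<close>)
    have "emeasure \<nu> {b..b} = ennreal (f b - f b)"
      unfolding \<nu>_def by (rule emeasure_interval_measure_Icc) (use mn cont in auto)
    then have b: "emeasure \<nu> {b} = 0" by simp
    have "emeasure \<nu> ({a<..<b} \<union> {b}) = emeasure \<nu> {a<..<b}"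
      by (rule emeasure_Un_null_set) (use b in \<open>auto simp: \<nu>_def\<close>)
    moreover have "{a<..<b} \<union> {b} = {a<..b}" using that by auto
    ultimately show ?thesis using Ioc by simp
  qed
  have ball_eq: "ball c r = {c - r<..<c + r}" for c r :: real
    by (auto simp: ball_def dist_real_def)
  have snu: "sets \<nu> = sets borel" by (simp add: \<nu>_def)
  have nu_ball: "emeasure \<nu> (ball c r) = ennreal (f (c + r) - f (c - r))" if "r > 0" for c r
    unfolding ball_eq using that by (intro nuI) auto
  have leb_ball: "emeasure lborel (ball c r) = ennreal (2 * r)" if "r > 0" for c r :: real
    unfolding ball_eq using that by simp
  \<comment> \<open>Lebesgue's argument with two Vitali coverings. Up to null sets, E is covered by
    disjoint balls of slope below p inside a set U of measure at most |E| + e, and then again,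
    inside the first family, by disjoint balls of slope above q. Hence q |E| <= \<nu>(U2) <=
    \<nu>(U1) <= p (|E| + e).\<close>
  have key: "ennreal q * emeasure lborel E \<le> ennreal p * (emeasure lborel E + ennreal e)" if e: "e > 0" for e
  proof -
    obtain U where U: "open U" "E \<subseteq> U" "emeasure lborel U \<le> emeasure lborel E + ennreal e"
    proof -
      have "E \<in> sets lebesgue" using E by auto
      then obtain T where T: "open T" "E \<subseteq> T" "(T - E) \<in> lmeasurable" "emeasure lebesgue (T - E) < ennreal e"
        using sets_lebesgue_outer_open[OF _ e] by metis
      have "emeasure lborel T = emeasure lborel (E \<union> (T - E))"
        using T by (intro arg_cong[where f = "emeasure lborel"]) auto
      also have "\<dots> \<le> emeasure lborel E + emeasure lborel (T - E)"
        using T E by (intro emeasure_subadditive) auto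
      also have "\<dots> \<le> emeasure lborel E + ennreal e"
        using T E by (intro add_left_mono) (auto simp: less_imp_le)
      finally show ?thesis using that T by auto
    qed
    \<comment> \<open>The covering theorem asks only that x lie in the ball, not that it be the
      centre. This is why slopes over intervals straddling x are the right notion here.\<close>
    have aux: "\<exists>i. i \<in> {(c, r). r > 0 \<and> ball c r \<subseteq> V \<and> P (c - r) (c + r)} \<and> x \<in> ball (fst i) (snd i) \<and> snd i < d"
      if V: "open V" "x \<in> V" and d0: "0 < d" and P: "\<And>d. d > 0 \<Longrightarrow> \<exists>a b. a < x \<and> x < b \<and> b - a < d \<and> P a b" for V x d and P :: "real \<Rightarrow> real \<Rightarrow> bool"
    proof -
      obtain k where k: "k > 0" "ball x k \<subseteq> V" using V by (meson openE)
      obtain a b where ab: "a < x" "x < b" "b - a < min d k" "P a b" using P[of "min d k"] k d0 by auto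
      have 1: "(a + b) / 2 - (b - a) / 2 = a" "(a + b) / 2 + (b - a) / 2 = b" by (simp_all add: field_simps)
      have "ball ((a + b) / 2) ((b - a) / 2) \<subseteq> ball x k"
        unfolding ball_eq 1 using ab by auto
      then show ?thesis
        using ab k by (intro exI[of _ "((a + b) / 2, (b - a) / 2)"]) (auto simp: 1 ball_eq simp del: greaterThanLessThan_iff, auto simp: field_simps)
    qed
    define K1 where "K1 = {(c, r). r > 0 \<and> ball c r \<subseteq> U \<and> f (c + r) - f (c - r) < p * ((c + r) - (c - r))}"
    obtain C1 where C1: "countable C1" "C1 \<subseteq> K1"
      "pairwise (\<lambda>i j. disjnt (ball (fst i) (snd i)) (ball (fst j) (snd j))) C1"
      "negligible (E - (\<Union>i \<in> C1. ball (fst i) (snd i)))"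
      by (rule Vitali_covering_theorem_balls[of E K1 fst snd])
         (use aux[OF U(1), where P = "\<lambda>a b. f b - f a < p * (b - a)"] lower U(2) in \<open>auto simp: K1_def\<close>)
    define U1 where "U1 = (\<Union>i \<in> C1. ball (fst i) (snd i))"
    have oU1: "open U1" by (auto simp: U1_def)
    define K2 where "K2 = {(c, r). r > 0 \<and> ball c r \<subseteq> U1 \<and> f (c + r) - f (c - r) > q * ((c + r) - (c - r))}"
    obtain C2 where C2: "countable C2" "C2 \<subseteq> K2"
      "pairwise (\<lambda>i j. disjnt (ball (fst i) (snd i)) (ball (fst j) (snd j))) C2"
      "negligible ((E \<inter> U1) - (\<Union>i \<in> C2. ball (fst i) (snd i)))"
      by (rule Vitali_covering_theorem_balls[of "E \<inter> U1" K2 fst snd])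
         (use aux[OF oU1, where P = "\<lambda>a b. f b - f a > q * (b - a)"] upper in \<open>auto simp: K2_def\<close>)
    define U2 where "U2 = (\<Union>i \<in> C2. ball (fst i) (snd i))"
    have oU2: "open U2" by (auto simp: U2_def)
    have dj: "disjoint_family_on (\<lambda>i. ball (fst i) (snd i)) C"
      if "pairwise (\<lambda>i j. disjnt (ball (fst i) (snd i)) (ball (fst j) (snd j))) C" for C :: "(real \<times> real) set"
      using that by (auto simp: disjoint_family_on_def pairwise_def disjnt_def)
    have nn: "E - U2 \<subseteq> (E - U1) \<union> ((E \<inter> U1) - U2)" by auto
    have "negligible (E - U2)"
      by (rule negligible_subset[OF _ nn]) (use C1(4) C2(4) in \<open>auto simp: U1_def U2_def\<close>)
    then have n2: "E - U2 \<in> null_sets lborel"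
      using E oU2 by (auto simp: negligible_iff_null_sets null_sets_completion_iff)
    have "emeasure lborel E \<le> emeasure lborel (U2 \<union> (E - U2))"
      using E oU2 by (intro emeasure_mono) auto
    also have "\<dots> = emeasure lborel U2" using n2 oU2 by (intro emeasure_Un_null_set) auto
    finally have EU2: "emeasure lborel E \<le> emeasure lborel U2" .
    have "ennreal q * emeasure lborel U2 = (\<integral>\<^sup>+i. ennreal q * emeasure lborel (ball (fst i) (snd i)) \<partial>count_space C2)"
      unfolding U2_def using C2 dj by (subst emeasure_UN_countable) (auto simp: nn_integral_cmult)
    also have "\<dots> \<le> (\<integral>\<^sup>+i. emeasure \<nu> (ball (fst i) (snd i)) \<partial>count_space C2)"
    proof (rule nn_integral_mono)
      fix i assume "i \<in> space (count_space C2)"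
      then have i: "snd i > 0" "f (fst i + snd i) - f (fst i - snd i) > q * ((fst i + snd i) - (fst i - snd i))" using C2(2) by (auto simp: K2_def)
      then show "ennreal q * emeasure lborel (ball (fst i) (snd i)) \<le> emeasure \<nu> (ball (fst i) (snd i))"
        using pq by (simp add: nu_ball leb_ball ennreal_mult[symmetric] ennreal_leI)
    qed
    also have "\<dots> = emeasure \<nu> U2"
      unfolding U2_def using C2 dj snu by (subst emeasure_UN_countable) auto
    also have "\<dots> \<le> emeasure \<nu> U1"
    proof (rule emeasure_mono)
      show "U2 \<subseteq> U1" using C2(2) unfolding U2_def K2_def by fastforce
    qed (use oU1 snu in auto)
    also have "\<dots> = (\<integral>\<^sup>+i. emeasure \<nu> (ball (fst i) (snd i)) \<partial>count_space C1)"
      unfolding U1_def using C1 dj snu by (subst emeasure_UN_countable) auto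
    also have "\<dots> \<le> (\<integral>\<^sup>+i. ennreal p * emeasure lborel (ball (fst i) (snd i)) \<partial>count_space C1)"
    proof (rule nn_integral_mono)
      fix i assume "i \<in> space (count_space C1)"
      then have i: "snd i > 0" "f (fst i + snd i) - f (fst i - snd i) < p * ((fst i + snd i) - (fst i - snd i))" using C1(2) by (auto simp: K1_def)
      then show "emeasure \<nu> (ball (fst i) (snd i)) \<le> ennreal p * emeasure lborel (ball (fst i) (snd i))"
        using pq by (simp add: nu_ball leb_ball ennreal_mult[symmetric] ennreal_leI)
    qed
    also have "\<dots> = ennreal p * emeasure lborel U1"
      unfolding U1_def using C1 dj by (subst emeasure_UN_countable) (auto simp: nn_integral_cmult)
    also have "\<dots> \<le> ennreal p * (emeasure lborel E + ennreal e)"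
    proof (intro mult_left_mono order.trans[OF emeasure_mono U(3)])
      show "U1 \<subseteq> U" using C1(2) unfolding U1_def K1_def by fastforce
    qed (use U in auto)
    finally show ?thesis using EU2 by (meson mult_left_mono order_trans zero_le)
  qed
  define m where "m = measure lborel E"
  have m: "emeasure lborel E = ennreal m" "m \<ge> 0"
    using E by (auto simp: m_def emeasure_eq_ennreal_measure)
  have "q * m \<le> p * (m + e)" if "e > 0" for e
    using key[OF that] m that pq by (simp add: ennreal_mult[symmetric] ennreal_plus[symmetric] del: ennreal_plus)
  then have "q * m \<le> p * m + e" if "e > 0" for e
    using that pq by (force dest!: spec[of _ "e / p"] simp: field_simps)
  then have "q * m \<le> p * m" by (rule field_le_epsilon)
  then have "m = 0" using pq m by (simp add: mult_le_cancel_right)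
  then show ?thesis using m by simp
qed

text \<open>The covering argument controls intervals with x in their interior, while a derivative
  needs x as an endpoint. Letting one end tend to x, continuity passes the estimate to the one-sided
  quotients.\<close>

lemma has_derivative_of_straddling_slopes:
  fixes f :: "real \<Rightarrow> real"
  assumes cont: "continuous_on UNIV f"
    and lim: "((\<lambda>(a, b). (f b - f a) / (b - a)) \<longlongrightarrow> D) (at_left x \<times>\<^sub>F at_right x)"
  shows "(f has_real_derivative D) (at x)"
proof -
  have isC: "isCont f y" for y using cont by (simp add: continuous_on_eq_continuous_at)
  have main: "\<exists>d>0. (\<forall>b\<in>{x<..<x+d}. \<bar>(f b - f x) / (b - x) - D\<bar> \<le> e) \<and> (\<forall>a\<in>{x-d<..<x}. \<bar>(f a - f x) / (a - x) - D\<bar> \<le> e)"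
    if "e > 0" for e
  proof -
    have "\<forall>\<^sub>F z in at_left x \<times>\<^sub>F at_right x. \<bar>(case z of (a, b) \<Rightarrow> (f b - f a) / (b - a)) - D\<bar> < e"
      using tendstoD[OF lim that] by (simp add: dist_real_def)
    then obtain P Q where P: "eventually P (at_left x)" and Q: "eventually Q (at_right x)"
      and PQ: "\<And>a b. P a \<Longrightarrow> Q b \<Longrightarrow> \<bar>(f b - f a) / (b - a) - D\<bar> < e"
      by (auto simp: eventually_prod_filter)
    obtain d1 where d1: "d1 < x" "\<And>a. d1 < a \<Longrightarrow> a < x \<Longrightarrow> P a"
      using P eventually_at_left[of "x - 1" x] by auto
    obtain d2 where d2: "x < d2" "\<And>b. x < b \<Longrightarrow> b < d2 \<Longrightarrow> Q b"
      using Q eventually_at_right[of x "x + 1"] by auto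
    have 1: "\<bar>(f b - f x) / (b - x) - D\<bar> \<le> e" if b: "x < b" "b < d2" for b
    proof (rule tendsto_upperbound)
      show "((\<lambda>a. \<bar>(f b - f a) / (b - a) - D\<bar>) \<longlongrightarrow> \<bar>(f b - f x) / (b - x) - D\<bar>) (at_left x)"
        using b isC[of x] by (intro tendsto_intros) (auto simp: isCont_def intro: tendsto_within_subset)
      show "\<forall>\<^sub>F a in at_left x. \<bar>(f b - f a) / (b - a) - D\<bar> \<le> e"
        using P by eventually_elim (use PQ d2(2)[OF b] in \<open>auto intro: less_imp_le\<close>)
    qed auto
    have 2: "\<bar>(f a - f x) / (a - x) - D\<bar> \<le> e" if a: "a < x" "d1 < a" for a
    proof (rule tendsto_upperbound)
      have "((\<lambda>b. \<bar>(f b - f a) / (b - a) - D\<bar>) \<longlongrightarrow> \<bar>(f x - f a) / (x - a) - D\<bar>) (at_right x)"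
        using a isC[of x] by (intro tendsto_intros) (auto simp: isCont_def intro: tendsto_within_subset)
      moreover have "(f x - f a) / (x - a) = (f a - f x) / (a - x)"
        using a by (simp add: field_simps)
      ultimately show "((\<lambda>b. \<bar>(f b - f a) / (b - a) - D\<bar>) \<longlongrightarrow> \<bar>(f a - f x) / (a - x) - D\<bar>) (at_right x)" by simp
      show "\<forall>\<^sub>F b in at_right x. \<bar>(f b - f a) / (b - a) - D\<bar> \<le> e"
        using Q by eventually_elim (use PQ d1(2)[OF a(2,1)] in \<open>auto intro: less_imp_le\<close>)
    qed auto
    show ?thesis using 1 2 d1 d2 by (intro exI[of _ "min (d2 - x) (x - d1)"]) auto
  qed
  show ?thesis unfolding has_field_derivative_iff
  proof (rule LIM_I)
    fix e :: real assume "e > 0"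
    then obtain d where d: "d > 0" "\<forall>b\<in>{x<..<x+d}. \<bar>(f b - f x) / (b - x) - D\<bar> \<le> e/2" "\<forall>a\<in>{x-d<..<x}. \<bar>(f a - f x) / (a - x) - D\<bar> \<le> e/2"
      using main[of "e/2"] by auto
    show "\<exists>s>0. \<forall>y. y \<noteq> x \<and> norm (y - x) < s \<longrightarrow> norm ((f y - f x) / (y - x) - D) < e"
    proof (intro exI[of _ d] conjI allI impI d(1))
      fix y assume y: "y \<noteq> x \<and> norm (y - x) < d"
      then have "\<bar>(f y - f x) / (y - x) - D\<bar> \<le> e / 2"
        by (cases "y < x") (use d(2,3) in auto)
      then show "norm ((f y - f x) / (y - x) - D) < e" using \<open>e > 0\<close> by simp
    qed
  qed
qed

text \<open>If the lower and upper limits of the straddling slopes differed, two rationals would fit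
  strictly between them, against \<open>no\<close>; restricting to rationals keeps the exceptional
  set a countable union. The limits are formed in the extended reals, and monotonicity with
  \<open>lip\<close> makes the common value finite.\<close>

lemma differentiable_of_no_oscillation:
  fixes f :: "real \<Rightarrow> real"
  assumes cont: "continuous_on UNIV f" and mono: "mono f"
    and lip: "\<And>x y. x \<le> y \<Longrightarrow> f y - f x \<le> L * (y - x)"
    and no: "\<And>p q. p \<in> \<rat> \<Longrightarrow> q \<in> \<rat> \<Longrightarrow> 0 < p \<Longrightarrow> p < q \<Longrightarrow> \<exists>d>0.
       (\<forall>a b. a < x \<longrightarrow> x < b \<longrightarrow> b - a < d \<longrightarrow> f b - f a \<ge> p * (b - a)) \<or>
       (\<forall>a b. a < x \<longrightarrow> x < b \<longrightarrow> b - a < d \<longrightarrow> f b - f a \<le> q * (b - a))"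
  shows "\<exists>D. (f has_real_derivative D) (at x)"
proof -
  define F where "F = at_left x \<times>\<^sub>F at_right x"
  define S where "S = (\<lambda>(a, b). ereal ((f b - f a) / (b - a)))"
  have nb: "F \<noteq> bot" by (auto simp: F_def prod_filter_eq_bot)
  have win: "\<forall>\<^sub>F z in F. fst z < x \<and> x < snd z \<and> snd z - fst z < d" if "d > 0" for d
  proof -
    have "\<forall>\<^sub>F a in at_left x. x - d/2 < a \<and> a < x" using that
      by (intro eventually_at_leftI[of "x - d/2"]) auto
    moreover have "\<forall>\<^sub>F b in at_right x. x < b \<and> b < x + d/2" using that
      by (intro eventually_at_rightI[of _ "x + d/2"]) auto
    ultimately show ?thesis unfolding F_def eventually_prod_filter
      by (intro exI conjI) (auto simp: field_simps)
  qed
  have bd: "\<forall>\<^sub>F z in F. 0 \<le> S z \<and> S z \<le> ereal L"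
    using win[of 1, OF zero_less_one]
  proof eventually_elim
    case (elim z)
    then show ?case using lip[of "fst z" "snd z"] monoD[OF mono, of "fst z" "snd z"]
      by (auto simp: S_def case_prod_beta field_simps)
  qed
  have "Limsup F S \<le> Liminf F S"
  proof (rule ccontr)
    assume "\<not> ?thesis"
    then have lt: "Liminf F S < Limsup F S" by simp
    obtain p where p: "p \<in> \<rat>" "Liminf F S < ereal p" "ereal p < Limsup F S"
      using ereal_dense3[OF lt] by (auto simp: Rats_def)
    obtain q where q: "q \<in> \<rat>" "ereal p < ereal q" "ereal q < Limsup F S"
      using ereal_dense3[OF p(3)] by (auto simp: Rats_def)
    have "0 \<le> Liminf F S" using bd by (intro Liminf_bounded) (auto elim: eventually_mono)
    then have p0: "0 < p" using p(2) by (metis ereal_less(2) le_less_trans)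
    from no[OF p(1) q(1) p0] q obtain d where d: "d > 0"
       "(\<forall>a b. a < x \<longrightarrow> x < b \<longrightarrow> b - a < d \<longrightarrow> f b - f a \<ge> p * (b - a)) \<or>
       (\<forall>a b. a < x \<longrightarrow> x < b \<longrightarrow> b - a < d \<longrightarrow> f b - f a \<le> q * (b - a))" by auto
    from d(2) show False
    proof
      assume A: "\<forall>a b. a < x \<longrightarrow> x < b \<longrightarrow> b - a < d \<longrightarrow> f b - f a \<ge> p * (b - a)"
      have "\<forall>\<^sub>F z in F. ereal p \<le> S z" using win[OF d(1)]
        by eventually_elim (use A in \<open>auto simp: S_def case_prod_beta field_simps\<close>)
      then have "ereal p \<le> Liminf F S" by (rule Liminf_bounded)
      then show False using p by simp
    next
      assume A: "\<forall>a b. a < x \<longrightarrow> x < b \<longrightarrow> b - a < d \<longrightarrow> f b - f a \<le> q * (b - a)"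
      have "\<forall>\<^sub>F z in F. S z \<le> ereal q" using win[OF d(1)]
        by eventually_elim (use A in \<open>auto simp: S_def case_prod_beta field_simps\<close>)
      then have "Limsup F S \<le> ereal q" by (rule Limsup_bounded)
      then show False using q by simp
    qed
  qed
  then have eq: "Liminf F S = Limsup F S" using Liminf_le_Limsup[OF nb, of S] by simp
  have lim: "(S \<longlongrightarrow> Limsup F S) F"
    by (rule Liminf_eq_Limsup[OF nb eq refl])
  have "0 \<le> Limsup F S" "Limsup F S \<le> ereal L"
    using bd eq by (auto intro!: Limsup_bounded Liminf_bounded elim: eventually_mono simp flip: eq) (auto simp: eq intro!: Limsup_bounded elim: eventually_mono)
  then obtain D where D: "Limsup F S = ereal D" by (cases "Limsup F S") auto
  have "((\<lambda>z. case z of (a, b) \<Rightarrow> (f b - f a) / (b - a)) \<longlongrightarrow> D) F"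
    using lim[unfolded D] by (simp add: S_def case_prod_unfold)
  then show ?thesis using has_derivative_of_straddling_slopes[OF cont] by (auto simp: F_def)
qed

lemma null_oscillating_slopes':
  fixes f :: "real \<Rightarrow> real"
  assumes mono: "mono f" and cont: "continuous_on UNIV f" and pq: "p < q" "0 < p"
    and lower: "\<And>x d. x \<in> E \<Longrightarrow> 0 < d \<Longrightarrow> \<exists>a b. a < x \<and> x < b \<and> b - a < d \<and> f b - f a < p * (b - a)"
    and upper: "\<And>x d. x \<in> E \<Longrightarrow> 0 < d \<Longrightarrow> \<exists>a b. a < x \<and> x < b \<and> b - a < d \<and> f b - f a > q * (b - a)"
    and E: "E \<in> sets borel"
  shows "E \<in> null_sets lborel"
proof -
  have "E \<inter> {-real n..real n} \<in> null_sets lborel" for n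
  proof -
    have "emeasure lborel (E \<inter> {-real n..real n}) \<le> emeasure lborel {-real n..real n}"
      using E by (intro emeasure_mono) auto
    also have "\<dots> < \<infinity>" by simp
    finally have fin: "emeasure lborel (E \<inter> {-real n..real n}) < \<infinity>" .
    have "emeasure lborel (E \<inter> {-real n..real n}) = 0"
      by (rule null_oscillating_slopes[OF mono cont pq _ _ _ fin]) (use lower upper E in auto)
    then show ?thesis using E by auto
  qed
  then have "(\<Union>n. E \<inter> {-real n..real n}) \<in> null_sets lborel" by (intro null_sets_UN) auto
  also have "(\<Union>n. E \<inter> {-real n..real n}) = E"
    using real_arch_simple by (auto simp: abs_le_iff) (metis abs_le_iff abs_ge_self minus_le_iff real_arch_simple)
  finally show ?thesis .
qed

lemma nn_integral_lborel_translate: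
  fixes g :: "'a::euclidean_space \<Rightarrow> ennreal"
  assumes [measurable]: "g \<in> borel_measurable borel"
  shows "(\<integral>\<^sup>+x. g (x + c) \<partial>lborel) = (\<integral>\<^sup>+x. g x \<partial>lborel)"
proof -
  have "(\<integral>\<^sup>+x. g x \<partial>lborel) = (\<integral>\<^sup>+x. g x \<partial>distr lborel borel ((+) c))" by (simp add: lborel_distr_plus)
  also have "\<dots> = (\<integral>\<^sup>+x. g (c + x) \<partial>lborel)" by (subst nn_integral_distr) auto
  finally show ?thesis by (simp add: add.commute)
qed

text \<open>Fubini for an arbitrary direction without a change of coordinates: the measure of N is
  averaged over the translates by k e with k in [0, 1], and exchanging the integrals leaves the
  lengths of the sections along e.\<close>

lemma null_sets_of_null_lines:
  fixes e :: "'a::euclidean_space"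
  assumes N[measurable]: "N \<in> sets borel"
    and lines: "\<And>X. {k::real. X + k *\<^sub>R e \<in> N} \<in> null_sets lborel"
  shows "N \<in> null_sets lborel"
proof -
  let ?f = "\<lambda>X k. indicator {0..1::real} k * indicator N (X + k *\<^sub>R e) :: ennreal"
  have "emeasure lborel N = (\<integral>\<^sup>+k. indicator {0..1::real} k * emeasure lborel N \<partial>lborel)"
    by (simp add: nn_integral_multc)
  also have "\<dots> = (\<integral>\<^sup>+k. (\<integral>\<^sup>+X. ?f X k \<partial>lborel) \<partial>lborel)"
  proof (rule nn_integral_cong)
    fix k :: real
    have "(\<integral>\<^sup>+X. ?f X k \<partial>lborel) = indicator {0..1} k * (\<integral>\<^sup>+X. indicator N (X + k *\<^sub>R e) \<partial>lborel)"
      by (subst nn_integral_cmult) auto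
    also have "(\<integral>\<^sup>+X. indicator N (X + k *\<^sub>R e) \<partial>lborel) = emeasure lborel N"
      by (subst nn_integral_lborel_translate[of "indicator N"]) auto
    finally show "indicator {0..1} k * emeasure lborel N = (\<integral>\<^sup>+X. ?f X k \<partial>lborel)" by simp
  qed
  also have "\<dots> = (\<integral>\<^sup>+X. (\<integral>\<^sup>+k. ?f X k \<partial>lborel) \<partial>lborel)"
    by (rule lborel_pair.Fubini') (simp add: case_prod_unfold)
  also have "\<dots> = (\<integral>\<^sup>+X. 0 \<partial>(lborel::'a measure))"
  proof (rule nn_integral_cong)
    fix X :: 'a
    have "(\<integral>\<^sup>+k. ?f X k \<partial>lborel) \<le> (\<integral>\<^sup>+k. indicator {k. X + k *\<^sub>R e \<in> N} k \<partial>lborel)"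
      by (intro nn_integral_mono) (auto split: split_indicator)
    also have "\<dots> = 0" using lines[of X] by auto
    finally show "(\<integral>\<^sup>+k. ?f X k \<partial>lborel) = 0" by simp
  qed
  finally show ?thesis by (auto intro: null_setsI)
qed

lemma AE_directional_derivative:
  fixes f :: "'a::euclidean_space \<Rightarrow> real"
  assumes e: "e \<noteq> 0" and cont: "continuous_on UNIV f"
    and lip: "\<And>X k. \<bar>f (X + k *\<^sub>R e) - f X\<bar> \<le> L * \<bar>k\<bar>"
  shows "AE X in lborel. \<exists>D. ((\<lambda>k. f (X + k *\<^sub>R e)) has_real_derivative D) (at 0)"
proof -
  \<comment> \<open>Adding a linear function of slope L along e turns the Lipschitz function into
    one that is monotone on every line, with slopes between 0 and 2 L.\<close>
  define F where "F X = f X + L * (X \<bullet> e) / (e \<bullet> e)" for X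
  have cF: "continuous_on UNIV F" unfolding F_def by (intro continuous_intros cont) (use e in auto)
  have Fk: "F (X + k *\<^sub>R e) = f (X + k *\<^sub>R e) + L * (X \<bullet> e) / (e \<bullet> e) + L * k" for X k
    using e by (simp add: F_def inner_add_left field_simps)
  have cl: "continuous_on UNIV (\<lambda>k. F (X + k *\<^sub>R e))" for X
    by (intro continuous_on_compose2[OF cF] continuous_intros) auto
  have lip': "f (X + b *\<^sub>R e) - f (X + a *\<^sub>R e) \<le> L * (b - a)" "f (X + a *\<^sub>R e) - f (X + b *\<^sub>R e) \<le> L * (b - a)" if "a \<le> b" for X a b
    using lip[of "X + a *\<^sub>R e" "b - a"] that by (auto simp: algebra_simps)
  have mono: "mono (\<lambda>k. F (X + k *\<^sub>R e))" for X
    using lip'(2) by (intro monoI) (auto simp: Fk algebra_simps)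
  have up: "F (X + b *\<^sub>R e) - F (X + a *\<^sub>R e) \<le> 2 * L * (b - a)" if "a \<le> b" for X a b
    using lip'(1)[OF that, of X] by (auto simp: Fk algebra_simps)
  \<comment> \<open>The exceptional set for a pair p, q must be Borel although it involves
    uncountably many windows (a, b). For a fixed window the slope conditions are open in X by
    continuity, so the unions over \<open>W n\<close> are open and only the intersection over n is
    countable.\<close>
  define W where "W n = {(a, b). a < (0::real) \<and> 0 < b \<and> b - a < 1 / real (Suc n)}" for n
  define N where "N p q = (\<Inter>n. (\<Union>(a,b)\<in>W n. {X. F (X + b *\<^sub>R e) - F (X + a *\<^sub>R e) < p * (b - a)}) \<inter>
      (\<Union>(a,b)\<in>W n. {X. q * (b - a) < F (X + b *\<^sub>R e) - F (X + a *\<^sub>R e)}))" for p q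
  have cF': "continuous_on UNIV (\<lambda>X. F (X + b *\<^sub>R e))" for b
    by (intro continuous_on_compose2[OF cF] continuous_intros) auto
  have op: "open {X. F (X + b *\<^sub>R e) - F (X + a *\<^sub>R e) < c}" "open {X. c < F (X + b *\<^sub>R e) - F (X + a *\<^sub>R e)}" for a b c
    by (intro open_Collect_less continuous_intros cF')+
  have Nb: "N p q \<in> sets borel" for p q
    unfolding N_def by (intro sets.countable_INT'' sets.Int borel_open open_UN ballI) (auto simp: op)
  have arch: "\<exists>n. 1 / real (Suc n) < d" if "d > 0" for d
    using reals_Archimedean[OF that] by (simp add: inverse_eq_divide)
  have N0: "N p q \<in> null_sets lborel" if pq: "0 < p" "p < q" for p q
  proof (rule null_sets_of_null_lines[OF Nb, where e = e])
    fix X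
    have [measurable]: "(\<lambda>k. X + k *\<^sub>R e) \<in> borel_measurable borel" by simp
    have "(\<lambda>k. X + k *\<^sub>R e) -` N p q \<inter> space borel \<in> sets borel"
      by (rule measurable_sets[OF _ Nb]) simp
    then have m: "{k. X + k *\<^sub>R e \<in> N p q} \<in> sets borel" by (simp add: vimage_def)
    show "{k. X + k *\<^sub>R e \<in> N p q} \<in> null_sets lborel"
    proof (rule null_oscillating_slopes'[OF mono[of X] cl pq(2,1) _ _ m])
      fix x d :: real assume x: "x \<in> {k. X + k *\<^sub>R e \<in> N p q}" and d: "0 < d"
      obtain n where n: "1 / real (Suc n) < d" using arch[OF d] by auto
      have sh: "X + x *\<^sub>R e + c *\<^sub>R e = X + (x + c) *\<^sub>R e" for c by (simp add: algebra_simps)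
      from x obtain a b where "(a, b) \<in> W n" "F (X + x *\<^sub>R e + b *\<^sub>R e) - F (X + x *\<^sub>R e + a *\<^sub>R e) < p * (b - a)"
        unfolding N_def by blast
      then show "\<exists>a b. a < x \<and> x < b \<and> b - a < d \<and> F (X + b *\<^sub>R e) - F (X + a *\<^sub>R e) < p * (b - a)"
        using n by (intro exI[of _ "x + a"] exI[of _ "x + b"]) (auto simp: W_def sh)
      from x obtain a b where "(a, b) \<in> W n" "F (X + x *\<^sub>R e + b *\<^sub>R e) - F (X + x *\<^sub>R e + a *\<^sub>R e) > q * (b - a)"
        unfolding N_def by blast
      then show "\<exists>a b. a < x \<and> x < b \<and> b - a < d \<and> F (X + b *\<^sub>R e) - F (X + a *\<^sub>R e) > q * (b - a)"
        using n by (intro exI[of _ "x + a"] exI[of _ "x + b"]) (auto simp: W_def sh)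
    qed
  qed
  define NN where "NN = (\<Union>p\<in>\<rat>. \<Union>q\<in>{q\<in>\<rat>. 0 < p \<and> p < q}. N p q)"
  have "NN \<in> null_sets lborel" unfolding NN_def
  proof (intro null_sets_UN')
    show "countable {q \<in> \<rat>. 0 < p \<and> p < q}" for p :: real
      by (rule countable_subset[OF _ countable_rat]) auto
  qed (auto simp: N0 countable_rat)
  moreover have "\<exists>D. ((\<lambda>k. f (X + k *\<^sub>R e)) has_real_derivative D) (at 0)" if X: "X \<notin> NN" for X
  proof -
    have "\<exists>D. ((\<lambda>k. F (X + k *\<^sub>R e)) has_real_derivative D) (at 0)"
    proof (rule differentiable_of_no_oscillation[OF cl mono up])
      fix p q :: real assume pq: "p \<in> \<rat>" "q \<in> \<rat>" "0 < p" "p < q"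
      then have "X \<notin> N p q" using X by (auto simp: NN_def)
      then obtain n where n: "(\<forall>(a,b)\<in>W n. \<not> F (X + b *\<^sub>R e) - F (X + a *\<^sub>R e) < p * (b - a)) \<or>
         (\<forall>(a,b)\<in>W n. \<not> q * (b - a) < F (X + b *\<^sub>R e) - F (X + a *\<^sub>R e))"
        unfolding N_def by auto
      show "\<exists>d>0. (\<forall>a b. a < 0 \<longrightarrow> 0 < b \<longrightarrow> b - a < d \<longrightarrow> p * (b - a) \<le> F (X + b *\<^sub>R e) - F (X + a *\<^sub>R e)) \<or>
             (\<forall>a b. a < 0 \<longrightarrow> 0 < b \<longrightarrow> b - a < d \<longrightarrow> F (X + b *\<^sub>R e) - F (X + a *\<^sub>R e) \<le> q * (b - a))"
        using n by (intro exI[of _ "1 / real (Suc n)"]) (auto simp: W_def not_less)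
    qed
    then obtain D where D: "((\<lambda>k. F (X + k *\<^sub>R e)) has_real_derivative D) (at 0)" by auto
    have "((\<lambda>k. F (X + k *\<^sub>R e) - (L * (X \<bullet> e) / (e \<bullet> e) + L * k)) has_real_derivative D - L) (at 0)"
      by (rule derivative_eq_intros D refl | simp)+
    then show ?thesis by (auto simp: Fk)
  qed
  ultimately show ?thesis by (intro AE_I'[of NN]) auto
qed

section \<open>Integration by parts\<close>

text \<open>Locally Lipschitz along \<open>e\<close>, with derivative \<open>F'\<close> along \<open>e\<close> almost everywhere: a class closed under
  products for which integration by parts holds by translation invariance.\<close>

definition lip_diff :: "'a::euclidean_space \<Rightarrow> ('a \<Rightarrow> real) \<Rightarrow> ('a \<Rightarrow> real) \<Rightarrow> bool" where
  "lip_diff e F F' \<longleftrightarrow> continuous_on UNIV F \<and> F' \<in> borel_measurable borel \<and>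
     (\<forall>R. \<exists>L\<ge>0. \<forall>X k. norm X \<le> R \<longrightarrow> \<bar>k\<bar> \<le> 1 \<longrightarrow> \<bar>F (X + k *\<^sub>R e) - F X\<bar> \<le> L * \<bar>k\<bar>) \<and>
     (AE X in lborel. ((\<lambda>k. F (X + k *\<^sub>R e)) has_real_derivative F' X) (at 0))"

lemma continuous_bounded_on_cball:
  fixes F :: "'a::euclidean_space \<Rightarrow> real"
  assumes "continuous_on UNIV F"
  obtains M where "M \<ge> 0" "\<And>X. norm X \<le> R \<Longrightarrow> \<bar>F X\<bar> \<le> M"
proof -
  have "compact (F ` cball 0 R)"
    by (intro compact_continuous_image continuous_on_subset[OF assms]) auto
  then obtain M where M: "\<forall>y\<in>F ` cball 0 R. norm y \<le> M" using compact_imp_bounded bounded_iff by metis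
  show ?thesis
  proof (rule that[of "max M 0"])
    fix X :: 'a assume "norm X \<le> R"
    then have "norm (F X) \<le> M" using M by auto
    then show "\<bar>F X\<bar> \<le> max M 0" by simp
  qed simp
qed

lemma lip_diff_mult:
  fixes e :: "'a::euclidean_space"
  assumes F: "lip_diff e F F'" and K: "lip_diff e K K'"
  shows "lip_diff e (\<lambda>X. F X * K X) (\<lambda>X. F' X * K X + F X * K' X)"
  unfolding lip_diff_def
proof (intro conjI allI)
  show "continuous_on UNIV (\<lambda>X. F X * K X)" using assms by (auto simp: lip_diff_def intro!: continuous_intros)
  have [measurable]: "F \<in> borel_measurable borel" "K \<in> borel_measurable borel" "F' \<in> borel_measurable borel" "K' \<in> borel_measurable borel"
    using assms by (auto simp: lip_diff_def intro: borel_measurable_continuous_onI)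
  show "(\<lambda>X. F' X * K X + F X * K' X) \<in> borel_measurable borel" by measurable
  have "AE X in lborel. ((\<lambda>k. F (X + k *\<^sub>R e)) has_real_derivative F' X) (at 0)"
    "AE X in lborel. ((\<lambda>k. K (X + k *\<^sub>R e)) has_real_derivative K' X) (at 0)" using assms by (auto simp: lip_diff_def)
  then show "AE X in lborel. ((\<lambda>k. F (X + k *\<^sub>R e) * K (X + k *\<^sub>R e)) has_real_derivative F' X * K X + F X * K' X) (at 0)"
  proof eventually_elim
    case (elim X)
    show ?case using DERIV_mult[OF elim] by (simp add: algebra_simps)
  qed
  fix R
  obtain L1 where L1: "L1 \<ge> 0" "\<And>X k. norm X \<le> R \<Longrightarrow> \<bar>k\<bar> \<le> 1 \<Longrightarrow> \<bar>F (X + k *\<^sub>R e) - F X\<bar> \<le> L1 * \<bar>k\<bar>"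
    using F unfolding lip_diff_def by meson
  obtain L2 where L2: "L2 \<ge> 0" "\<And>X k. norm X \<le> R \<Longrightarrow> \<bar>k\<bar> \<le> 1 \<Longrightarrow> \<bar>K (X + k *\<^sub>R e) - K X\<bar> \<le> L2 * \<bar>k\<bar>"
    using K unfolding lip_diff_def by meson
  obtain M1 where M1: "M1 \<ge> 0" "\<And>X. norm X \<le> R + norm e \<Longrightarrow> \<bar>F X\<bar> \<le> M1"
    using continuous_bounded_on_cball F unfolding lip_diff_def by metis
  obtain M2 where M2: "M2 \<ge> 0" "\<And>X. norm X \<le> R \<Longrightarrow> \<bar>K X\<bar> \<le> M2"
    using continuous_bounded_on_cball K unfolding lip_diff_def by metis
  show "\<exists>L\<ge>0. \<forall>X k. norm X \<le> R \<longrightarrow> \<bar>k\<bar> \<le> 1 \<longrightarrow> \<bar>F (X + k *\<^sub>R e) * K (X + k *\<^sub>R e) - F X * K X\<bar> \<le> L * \<bar>k\<bar>"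
  proof (intro exI[of _ "M1 * L2 + L1 * M2"] conjI allI impI)
    fix X :: 'a and k :: real assume X: "norm X \<le> R" and k: "\<bar>k\<bar> \<le> 1"
    have "norm (X + k *\<^sub>R e) \<le> R + norm e"
      using X k norm_triangle_ineq[of X "k *\<^sub>R e"] mult_right_mono[OF k norm_ge_zero[of e]] by simp
    then have b: "\<bar>F (X + k *\<^sub>R e)\<bar> \<le> M1" using M1 by auto
    have "F (X + k *\<^sub>R e) * K (X + k *\<^sub>R e) - F X * K X = F (X + k *\<^sub>R e) * (K (X + k *\<^sub>R e) - K X) + (F (X + k *\<^sub>R e) - F X) * K X"
      by (simp add: algebra_simps)
    also have "\<bar>\<dots>\<bar> \<le> \<bar>F (X + k *\<^sub>R e)\<bar> * \<bar>K (X + k *\<^sub>R e) - K X\<bar> + \<bar>F (X + k *\<^sub>R e) - F X\<bar> * \<bar>K X\<bar>"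
      by (metis abs_mult abs_triangle_ineq)
    also have "\<dots> \<le> M1 * (L2 * \<bar>k\<bar>) + (L1 * \<bar>k\<bar>) * M2"
      using b L1 L2 M1 M2 X k by (intro add_mono mult_mono) auto
    finally show "\<bar>F (X + k *\<^sub>R e) * K (X + k *\<^sub>R e) - F X * K X\<bar> \<le> (M1 * L2 + L1 * M2) * \<bar>k\<bar>"
      by (simp add: algebra_simps)
  qed (use L1 L2 M1 M2 in auto)
qed

lemma lip_diff_add:
  fixes e :: "'a::euclidean_space"
  assumes F: "lip_diff e F F'" and K: "lip_diff e K K'"
  shows "lip_diff e (\<lambda>X. F X + K X) (\<lambda>X. F' X + K' X)"
  unfolding lip_diff_def
proof (intro conjI allI)
  show "continuous_on UNIV (\<lambda>X. F X + K X)" using assms by (auto simp: lip_diff_def intro!: continuous_intros)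
  have [measurable]: "F' \<in> borel_measurable borel" "K' \<in> borel_measurable borel"
    using assms by (auto simp: lip_diff_def)
  show "(\<lambda>X. F' X + K' X) \<in> borel_measurable borel" by measurable
  have "AE X in lborel. ((\<lambda>k. F (X + k *\<^sub>R e)) has_real_derivative F' X) (at 0)"
    "AE X in lborel. ((\<lambda>k. K (X + k *\<^sub>R e)) has_real_derivative K' X) (at 0)" using assms by (auto simp: lip_diff_def)
  then show "AE X in lborel. ((\<lambda>k. F (X + k *\<^sub>R e) + K (X + k *\<^sub>R e)) has_real_derivative F' X + K' X) (at 0)"
    by eventually_elim (auto intro: DERIV_add)
  fix R
  obtain L1 where L1: "L1 \<ge> 0" "\<And>X k. norm X \<le> R \<Longrightarrow> \<bar>k\<bar> \<le> 1 \<Longrightarrow> \<bar>F (X + k *\<^sub>R e) - F X\<bar> \<le> L1 * \<bar>k\<bar>"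
    using F unfolding lip_diff_def by meson
  obtain L2 where L2: "L2 \<ge> 0" "\<And>X k. norm X \<le> R \<Longrightarrow> \<bar>k\<bar> \<le> 1 \<Longrightarrow> \<bar>K (X + k *\<^sub>R e) - K X\<bar> \<le> L2 * \<bar>k\<bar>"
    using K unfolding lip_diff_def by meson
  show "\<exists>L\<ge>0. \<forall>X k. norm X \<le> R \<longrightarrow> \<bar>k\<bar> \<le> 1 \<longrightarrow> \<bar>F (X + k *\<^sub>R e) + K (X + k *\<^sub>R e) - (F X + K X)\<bar> \<le> L * \<bar>k\<bar>"
  proof (intro exI[of _ "L1 + L2"] conjI allI impI)
    fix X :: 'a and k :: real assume X: "norm X \<le> R" and k: "\<bar>k\<bar> \<le> 1"
    show "\<bar>F (X + k *\<^sub>R e) + K (X + k *\<^sub>R e) - (F X + K X)\<bar> \<le> (L1 + L2) * \<bar>k\<bar>"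
      using L1(2)[OF X k] L2(2)[OF X k] by (simp add: algebra_simps abs_le_iff)
  qed (use L1 L2 in auto)
qed

lemma lip_diff_const: "lip_diff e (\<lambda>X. c) (\<lambda>X. 0)"
  by (auto simp: lip_diff_def)

lemma lip_diff_cmult:
  assumes "lip_diff e F F'"
  shows "lip_diff e (\<lambda>X. c * F X) (\<lambda>X. c * F' X)"
  using lip_diff_mult[OF lip_diff_const[of e c] assms] by simp

lemma lip_diff_diff:
  assumes F: "lip_diff e F F'" and K: "lip_diff e K K'"
  shows "lip_diff e (\<lambda>X. F X - K X) (\<lambda>X. F' X - K' X)"
  using lip_diff_add[OF F lip_diff_cmult[OF K, of "-1"]] by simp

lemma lip_diff_sum:
  assumes "\<And>i. i \<in> I \<Longrightarrow> lip_diff e (F i) (F' i)"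
  shows "lip_diff e (\<lambda>X. \<Sum>i\<in>I. F i X) (\<lambda>X. \<Sum>i\<in>I. F' i X)"
  using assms by (induction I rule: infinite_finite_induct) (auto intro: lip_diff_const lip_diff_add)

lemma line_derivative_shift:
  fixes e :: "'a::euclidean_space"
  assumes "\<And>Y. ((\<lambda>k. F (Y + k *\<^sub>R e)) has_real_derivative F' Y) (at 0)"
  shows "((\<lambda>k. F (X + k *\<^sub>R e)) has_real_derivative F' (X + h *\<^sub>R e)) (at h within S)"
proof -
  have "((\<lambda>k. F ((X + h *\<^sub>R e) + k *\<^sub>R e)) has_real_derivative F' (X + h *\<^sub>R e)) (at 0)" by (rule assms)
  then have "((\<lambda>k. F (X + (h + k) *\<^sub>R e)) has_real_derivative F' (X + h *\<^sub>R e)) (at 0)" by (simp add: algebra_simps)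
  then have "((\<lambda>k. F (X + k *\<^sub>R e)) has_real_derivative F' (X + h *\<^sub>R e)) (at (0 + h))"
    by (subst DERIV_shift) (simp add: add.commute)
  then show ?thesis by (simp add: has_field_derivative_at_within)
qed

lemma lip_diff_C1:
  fixes e :: "'a::euclidean_space"
  assumes c: "continuous_on UNIV F" "continuous_on UNIV F'"
    and d: "\<And>X. ((\<lambda>k. F (X + k *\<^sub>R e)) has_real_derivative F' X) (at 0)"
  shows "lip_diff e F F'"
  unfolding lip_diff_def
proof (intro conjI allI)
  fix R
  obtain M where M: "M \<ge> 0" "\<And>X. norm X \<le> R + norm e \<Longrightarrow> \<bar>F' X\<bar> \<le> M"
    using continuous_bounded_on_cball c(2) by metis
  show "\<exists>L\<ge>0. \<forall>X k. norm X \<le> R \<longrightarrow> \<bar>k\<bar> \<le> 1 \<longrightarrow> \<bar>F (X + k *\<^sub>R e) - F X\<bar> \<le> L * \<bar>k\<bar>"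
  proof (intro exI[of _ M] conjI allI impI M(1))
    fix X :: 'a and k :: real assume X: "norm X \<le> R" and k: "\<bar>k\<bar> \<le> 1"
    have "norm ((\<lambda>k. F (X + k *\<^sub>R e)) k - (\<lambda>k. F (X + k *\<^sub>R e)) 0) \<le> M * norm (k - 0)"
    proof (rule field_differentiable_bound[of "{-1..1}"])
      fix z :: real assume z: "z \<in> {-1..1}"
      show "((\<lambda>k. F (X + k *\<^sub>R e)) has_field_derivative F' (X + z *\<^sub>R e)) (at z within {-1..1})"
        by (rule line_derivative_shift[OF d])
      have z': "\<bar>z\<bar> \<le> 1" using z by auto
      have "norm (X + z *\<^sub>R e) \<le> R + norm e"
        using X z' norm_triangle_ineq[of X "z *\<^sub>R e"] mult_right_mono[OF z' norm_ge_zero[of e]] by simp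
      then show "norm (F' (X + z *\<^sub>R e)) \<le> M" using M(2) by auto
    qed (use k in auto)
    then show "\<bar>F (X + k *\<^sub>R e) - F X\<bar> \<le> M * \<bar>k\<bar>" by simp
  qed
qed (use assms in \<open>auto intro: borel_measurable_continuous_onI\<close>)

text \<open>The limit along the fixed steps 1/(n+1) is Borel measurable as it stands and agrees with
  the derivative wherever that exists.\<close>

definition line_deriv :: "'a::euclidean_space \<Rightarrow> ('a \<Rightarrow> real) \<Rightarrow> 'a \<Rightarrow> real" where
  "line_deriv e F X = lim (\<lambda>n. real (Suc n) * (F (X + (1 / real (Suc n)) *\<^sub>R e) - F X))"

lemma quotient_tendsto:
  fixes e :: "'a::euclidean_space"
  assumes "((\<lambda>k. F (X + k *\<^sub>R e)) has_real_derivative D) (at 0)"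
  shows "(\<lambda>n. real (Suc n) * (F (X + (1 / real (Suc n)) *\<^sub>R e) - F X)) \<longlonglongrightarrow> D"
proof -
  have "((\<lambda>h. (F (X + h *\<^sub>R e) - F X) / h) \<longlongrightarrow> D) (at 0)"
    using assms by (simp add: DERIV_def)
  moreover have "filterlim (\<lambda>n. 1 / real (Suc n)) (at 0) sequentially"
    using LIMSEQ_Suc[OF lim_1_over_n] by (auto simp: filterlim_at)
  ultimately have "((\<lambda>n. (F (X + (1 / real (Suc n)) *\<^sub>R e) - F X) / (1 / real (Suc n))) \<longlongrightarrow> D) sequentially"
    by (rule filterlim_compose)
  then show ?thesis by (simp add: mult.commute)
qed

lemma line_deriv_eq:
  fixes e :: "'a::euclidean_space"
  shows "((\<lambda>k. F (X + k *\<^sub>R e)) has_real_derivative D) (at 0) \<Longrightarrow> line_deriv e F X = D"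
  unfolding line_deriv_def by (rule limI[OF quotient_tendsto])

lemma derivative_le_of_lipschitz:
  fixes e :: "'a::euclidean_space"
  assumes "((\<lambda>k. F (X + k *\<^sub>R e)) has_real_derivative D) (at 0)"
    and lip: "\<And>k. \<bar>F (X + k *\<^sub>R e) - F X\<bar> \<le> L * \<bar>k\<bar>"
  shows "\<bar>D\<bar> \<le> L"
proof (rule tendsto_upperbound)
  show "(\<lambda>n. \<bar>real (Suc n) * (F (X + (1 / real (Suc n)) *\<^sub>R e) - F X)\<bar>) \<longlonglongrightarrow> \<bar>D\<bar>"
    by (intro tendsto_rabs quotient_tendsto assms)
  show "\<forall>\<^sub>F n in sequentially. \<bar>real (Suc n) * (F (X + (1 / real (Suc n)) *\<^sub>R e) - F X)\<bar> \<le> L"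
  proof (intro always_eventually allI)
    fix n
    show "\<bar>real (Suc n) * (F (X + (1 / real (Suc n)) *\<^sub>R e) - F X)\<bar> \<le> L"
      using lip[of "1 / real (Suc n)"] by (simp only: abs_mult abs_of_nat) (simp add: field_simps)
  qed
qed auto

lemma lip_diff_lipschitz:
  assumes c: "continuous_on UNIV F" and e: "e \<noteq> 0" and lip: "\<And>X k. \<bar>F (X + k *\<^sub>R e) - F X\<bar> \<le> L * \<bar>k\<bar>"
  shows "lip_diff e F (line_deriv e F)"
  unfolding lip_diff_def
proof (intro conjI allI)
  have "\<bar>F (0 + 1 *\<^sub>R e) - F 0\<bar> \<le> L" using lip[of 0 1] by simp
  then have "L \<ge> 0" by linarith
  then show "\<exists>L\<ge>0. \<forall>X k. norm X \<le> R \<longrightarrow> \<bar>k\<bar> \<le> 1 \<longrightarrow> \<bar>F (X + k *\<^sub>R e) - F X\<bar> \<le> L * \<bar>k\<bar>" for R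
    using lip by auto
  have [measurable]: "F \<in> borel_measurable borel" using c by (rule borel_measurable_continuous_onI)
  show "line_deriv e F \<in> borel_measurable borel" unfolding line_deriv_def[abs_def]
    by (rule borel_measurable_lim_metric) measurable
  show "AE X in lborel. ((\<lambda>k. F (X + k *\<^sub>R e)) has_real_derivative line_deriv e F X) (at 0)"
    using AE_directional_derivative[OF e c lip] by eventually_elim (auto simp: line_deriv_eq)
qed (rule c)

text \<open>Difference quotients of a compactly supported function integrate to 0 by translation
  invariance, and the local Lipschitz bound dominates them, so the limit integrates to 0 as well.
  Invariance of S under e allows S to be a slab in the remaining variables.\<close>

lemma lip_diff_integral_zero:
  fixes S :: "'a::euclidean_space set"
  assumes F: "lip_diff e F F'" and S[measurable]: "S \<in> sets borel" and inv: "\<And>X k. X + k *\<^sub>R e \<in> S \<longleftrightarrow> X \<in> S"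
    and supp: "\<And>X. X \<in> S \<Longrightarrow> norm X > R \<Longrightarrow> F X = 0"
  shows "set_integrable lborel S F'" and "(LINT X:S|lborel. F' X) = 0"
proof -
  define G where "G X = indicator S X * F X" for X
  have cF: "continuous_on UNIV F" and [measurable]: "F' \<in> borel_measurable borel" using F by (auto simp: lip_diff_def)
  have [measurable]: "F \<in> borel_measurable borel" using cF by (rule borel_measurable_continuous_onI)
  have [measurable]: "G \<in> borel_measurable borel" unfolding G_def by measurable
  define q where "q n X = real (Suc n) * (G (X + (1 / real (Suc n)) *\<^sub>R e) - G X)" for n X
  have [measurable]: "q n \<in> borel_measurable borel" for n unfolding q_def by measurable
  obtain M where M: "M \<ge> 0" "\<And>X. norm X \<le> R \<Longrightarrow> \<bar>F X\<bar> \<le> M"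
    using continuous_bounded_on_cball[OF cF] by metis
  have intG: "integrable lborel G"
  proof (rule Bochner_Integration.integrable_bound[where f = "\<lambda>X. M * indicator (cball 0 R) X"])
    show "integrable lborel (\<lambda>X. M * indicator (cball (0::'a) R) X)"
      by (intro integrable_mult_right integrable_real_indicator) (use emeasure_bounded_finite[OF bounded_cball] in simp_all)
    show "AE X in lborel. norm (G X) \<le> norm (M * indicator (cball 0 R) X)"
    proof (intro AE_I2)
      fix X show "norm (G X) \<le> norm (M * indicator (cball 0 R) X)"
        using M supp[of X] by (cases "norm X \<le> R") (auto simp: G_def split: split_indicator)
    qed
  qed simp
  have tr: "integrable lborel (\<lambda>X. G (X + c))" "(\<integral>X. G (X + c) \<partial>lborel) = (\<integral>X. G X \<partial>lborel)" for c
  proof -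
    have 1: "integrable (distr lborel borel ((+) c)) G" unfolding lborel_distr_plus by (rule intG)
    show "integrable lborel (\<lambda>X. G (X + c))"
      using 1 by (subst (asm) integrable_distr_eq) (auto simp: add.commute)
    have "(\<integral>X. G X \<partial>lborel) = (\<integral>X. G X \<partial>distr lborel borel ((+) c))" by (simp add: lborel_distr_plus)
    also have "\<dots> = (\<integral>X. G (X + c) \<partial>lborel)" by (subst integral_distr) (auto simp: add.commute)
    finally show "(\<integral>X. G (X + c) \<partial>lborel) = (\<integral>X. G X \<partial>lborel)" by simp
  qed
  have q0: "(\<integral>X. q n X \<partial>lborel) = 0" for n
    unfolding q_def using tr intG by simp
  obtain L where L: "L \<ge> 0" "\<And>X k. norm X \<le> R + norm e \<Longrightarrow> \<bar>k\<bar> \<le> 1 \<Longrightarrow> \<bar>F (X + k *\<^sub>R e) - F X\<bar> \<le> L * \<bar>k\<bar>"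
    using F unfolding lip_diff_def by meson
  \<comment> \<open>Beyond radius R + |e| both the point and its translate lie outside the support,
    as the steps have length at most |e|.\<close>
  have qb: "norm (q n X) \<le> L * indicator (cball 0 (R + norm e)) X" for n X
  proof (cases "norm X \<le> R + norm e")
    case True
    have "\<bar>G (X + (1 / real (Suc n)) *\<^sub>R e) - G X\<bar> \<le> L * (1 / real (Suc n))"
      using L(2)[OF True, of "1 / real (Suc n)"] inv[of X "1 / real (Suc n)"] L(1) by (auto simp: G_def split: split_indicator)
    then show ?thesis using True unfolding q_def real_norm_def by (simp only: abs_mult abs_of_nat) (simp add: field_simps)
  next
    case False
    have "norm ((1 / real (Suc n)) *\<^sub>R e) \<le> norm e"
      by (simp add: field_simps mult_le_cancel_left1)
    then have "norm (X + (1 / real (Suc n)) *\<^sub>R e) > R"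
      using False norm_triangle_ineq4[of "X + (1 / real (Suc n)) *\<^sub>R e" "(1 / real (Suc n)) *\<^sub>R e"] by simp
    moreover have "norm X > R" using False norm_ge_zero[of e] by linarith
    ultimately have "G (X + (1 / real (Suc n)) *\<^sub>R e) = 0" "G X = 0"
      using supp by (auto simp: G_def split: split_indicator)
    then show ?thesis using False by (simp add: q_def)
  qed
  have lim: "AE X in lborel. (\<lambda>n. q n X) \<longlonglongrightarrow> indicator S X * F' X"
  proof -
    have "AE X in lborel. ((\<lambda>k. F (X + k *\<^sub>R e)) has_real_derivative F' X) (at 0)" using F by (auto simp: lip_diff_def)
    then show ?thesis
    proof eventually_elim
      case (elim X)
      have "(\<lambda>n. indicator S X * (real (Suc n) * (F (X + (1 / real (Suc n)) *\<^sub>R e) - F X))) \<longlonglongrightarrow> indicator S X * F' X"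
        by (intro tendsto_mult_left quotient_tendsto elim)
      moreover have "q n X = indicator S X * (real (Suc n) * (F (X + (1 / real (Suc n)) *\<^sub>R e) - F X))" for n
        using inv[of X "1 / real (Suc n)"] by (auto simp: q_def G_def split: split_indicator)
      ultimately show ?case by simp
    qed
  qed
  have intb: "integrable lborel (\<lambda>X. L * indicator (cball (0::'a) (R + norm e)) X)"
    by (intro integrable_mult_right integrable_real_indicator) (use emeasure_bounded_finite[OF bounded_cball] in simp_all)
  have I: "integrable lborel (\<lambda>X. indicator S X * F' X)"
    by (rule integrable_dominated_convergence[OF _ _ intb lim]) (use qb in auto)
  have "(\<lambda>n. \<integral>X. q n X \<partial>lborel) \<longlonglongrightarrow> (\<integral>X. indicator S X * F' X \<partial>lborel)"
    by (rule integral_dominated_convergence[OF _ _ intb lim]) (use qb in auto)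
  then have "(\<integral>X. indicator S X * F' X \<partial>lborel) = 0" using q0 by (simp add: LIMSEQ_const_iff)
  then show "(LINT X:S|lborel. F' X) = 0" "set_integrable lborel S F'" using I
    by (auto simp: set_lebesgue_integral_def set_integrable_def)
qed

lemma set_integrable_strip:
  fixes F :: "'a::euclidean_space \<times> real \<Rightarrow> real"
  assumes c: "continuous_on UNIV F" and supp: "\<And>X. norm (fst X) > R \<Longrightarrow> F X = 0"
  shows "set_integrable lborel (UNIV \<times> {0<..<T}) F"
proof -
  have "set_integrable lborel (cball 0 R \<times> {0..T}) F"
    unfolding set_integrable_def
    by (rule borel_integrable_compact) (auto intro!: compact_Times continuous_on_subset[OF c])
  then have "set_integrable lborel (cball 0 R \<times> {0<..<T}) F"
    by (rule set_integrable_subset) (auto intro!: borel_Times)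
  moreover have "(\<lambda>X. indicator (cball 0 R \<times> {0<..<T}) X *\<^sub>R F X) = (\<lambda>X. indicator (UNIV \<times> {0<..<T}) X *\<^sub>R F X)"
  proof
    fix X show "indicator (cball 0 R \<times> {0<..<T}) X *\<^sub>R F X = indicator (UNIV \<times> {0<..<T}) X *\<^sub>R F X"
      using supp[of X] by (cases X) (auto split: split_indicator)
  qed
  ultimately show ?thesis by (simp add: set_integrable_def)
qed

text \<open>The fundamental theorem on each vertical segment, followed by Fubini. The derivative is
  assumed only for 0 < s < T, because clamped functions have kinks at both ends.\<close>

lemma integral_time_derivative:
  fixes E E' :: "'a::euclidean_space \<times> real \<Rightarrow> real"
  assumes c: "continuous_on UNIV E" "continuous_on UNIV E'" and T: "0 < T"
    and d: "\<And>x s. 0 < s \<Longrightarrow> s < T \<Longrightarrow> ((\<lambda>s. E (x, s)) has_real_derivative E' (x, s)) (at s)"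
    and supp: "\<And>x s. norm x > R \<Longrightarrow> E (x, s) = 0" "\<And>x s. norm x > R \<Longrightarrow> E' (x, s) = 0"
  shows "set_integrable lborel (UNIV \<times> {0<..<T}) E'"
    and "(LINT X:UNIV \<times> {0<..<T}|lborel. E' X) = (\<integral>x. E (x, T) - E (x, 0) \<partial>lborel)"
proof -
  show I: "set_integrable lborel (UNIV \<times> {0<..<T}) E'"
    by (rule set_integrable_strip[OF c(2), of R]) (use supp(2) in \<open>metis prod.collapse\<close>)
  have inner: "(\<integral>s. indicator (UNIV \<times> {0<..<T}) (x, s) *\<^sub>R E' (x, s) \<partial>lborel) = E (x, T) - E (x, 0)" for x
  proof -
    have cE: "continuous_on A (\<lambda>s. E (x, s))" "continuous_on A (\<lambda>s. E' (x, s))" for A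
      by (auto intro!: continuous_on_compose2[OF c(1)] continuous_on_compose2[OF c(2)] continuous_intros)
    have "((\<lambda>s. E' (x, s)) has_integral (E (x, T) - E (x, 0))) {0..T}"
      by (rule fundamental_theorem_of_calculus_interior)
         (use T d cE in \<open>auto simp: has_real_derivative_iff_has_vector_derivative\<close>)
    moreover have "set_integrable lborel {0..T} (\<lambda>s. E' (x, s))"
      unfolding set_integrable_def by (rule borel_integrable_compact) (auto intro!: cE)
    ultimately have 1: "(LINT s:{0..T}|lborel. E' (x, s)) = E (x, T) - E (x, 0)"
      by (simp add: set_borel_integral_eq_integral integral_unique)
    have "AE s in lborel. s \<noteq> 0 \<and> s \<noteq> T"
      using AE_lborel_singleton[of 0] AE_lborel_singleton[of T] by eventually_elim auto
    then have "AE s in lborel. indicator (UNIV \<times> {0<..<T}) (x, s) *\<^sub>R E' (x, s) = indicator {0..T} s *\<^sub>R E' (x, s)"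
      by eventually_elim (auto split: split_indicator)
    then have "(\<integral>s. indicator (UNIV \<times> {0<..<T}) (x, s) *\<^sub>R E' (x, s) \<partial>lborel) = (\<integral>s. indicator {0..T} s *\<^sub>R E' (x, s) \<partial>lborel)"
    proof (rule integral_cong_AE[rotated 2])
      have [measurable]: "(\<lambda>s. E' (x, s)) \<in> borel_measurable borel" using cE(2) by (rule borel_measurable_continuous_onI)
      show "(\<lambda>s. indicator {0..T} s *\<^sub>R E' (x, s)) \<in> borel_measurable lborel" by measurable
      have "(\<lambda>s. indicator (UNIV \<times> {0<..<T}) (x, s) *\<^sub>R E' (x, s)) = (\<lambda>s. indicator {0<..<T} s *\<^sub>R E' (x, s))"
        by (auto split: split_indicator)
      then show "(\<lambda>s. indicator (UNIV \<times> {0<..<T}) (x, s) *\<^sub>R E' (x, s)) \<in> borel_measurable lborel" by simp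
    qed
    then show ?thesis using 1 by (simp add: set_lebesgue_integral_def)
  qed
  have "(LINT X:UNIV \<times> {0<..<T}|lborel. E' X) = (\<integral>X. indicator (UNIV \<times> {0<..<T}) X *\<^sub>R E' X \<partial>(lborel \<Otimes>\<^sub>M lborel))"
    by (simp add: set_lebesgue_integral_def lborel_prod)
  also have "\<dots> = (\<integral>x. (\<integral>s. indicator (UNIV \<times> {0<..<T}) (x, s) *\<^sub>R E' (x, s) \<partial>lborel) \<partial>lborel)"
    by (rule lborel_pair.integral_fst'[symmetric]) (use I in \<open>simp add: set_integrable_def lborel_prod\<close>)
  finally show "(LINT X:UNIV \<times> {0<..<T}|lborel. E' X) = (\<integral>x. E (x, T) - E (x, 0) \<partial>lborel)"
    by (simp only: inner)
qed

text \<open>Schwarz's theorem: the second difference over a small parallelogram equals h^2 times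
  either mixed derivative at some nearby point, by the mean value theorem applied twice, so
  continuity of both at X is enough. Directional derivatives are used so that it serves x-x pairs as
  well as x-s pairs.\<close>

lemma mixed_derivatives_eq:
  fixes f :: "'a::euclidean_space \<Rightarrow> real"
  assumes U: "open U" "X \<in> U"
    and da: "\<And>Y. Y \<in> U \<Longrightarrow> ((\<lambda>t. f (Y + t *\<^sub>R a)) has_real_derivative fa Y) (at 0)"
    and db: "\<And>Y. Y \<in> U \<Longrightarrow> ((\<lambda>t. f (Y + t *\<^sub>R b)) has_real_derivative fb Y) (at 0)"
    and dab: "\<And>Y. Y \<in> U \<Longrightarrow> ((\<lambda>t. fa (Y + t *\<^sub>R b)) has_real_derivative fab Y) (at 0)"
    and dba: "\<And>Y. Y \<in> U \<Longrightarrow> ((\<lambda>t. fb (Y + t *\<^sub>R a)) has_real_derivative fba Y) (at 0)"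
    and c: "isCont fab X" "isCont fba X"
  shows "fab X = fba X"
proof -
  have key: "\<exists>Y. dist Y X \<le> h * (norm a + norm b) \<and> g (X + h *\<^sub>R a + h *\<^sub>R b) - g (X + h *\<^sub>R a) - g (X + h *\<^sub>R b) + g X = h * h * gab Y"
    if h: "0 < h" "ball X r \<subseteq> U" "h * (norm a + norm b) < r"
      and ga: "\<And>Y. Y \<in> U \<Longrightarrow> ((\<lambda>t. g (Y + t *\<^sub>R a)) has_real_derivative ga Y) (at 0)"
      and gab: "\<And>Y. Y \<in> U \<Longrightarrow> ((\<lambda>t. ga (Y + t *\<^sub>R b)) has_real_derivative gab Y) (at 0)"
    for g ga gab :: "'a \<Rightarrow> real" and h r and a b :: 'a
  proof -
    have inU: "X + s *\<^sub>R a + t *\<^sub>R b \<in> U" "dist (X + s *\<^sub>R a + t *\<^sub>R b) X \<le> h * (norm a + norm b)" if "0 \<le> s" "s \<le> h" "0 \<le> t" "t \<le> h" for s t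
    proof -
      have "norm (s *\<^sub>R a + t *\<^sub>R b) \<le> h * norm a + h * norm b"
        using that by (intro order.trans[OF norm_triangle_ineq] add_mono) (auto intro: mult_right_mono)
      then show "dist (X + s *\<^sub>R a + t *\<^sub>R b) X \<le> h * (norm a + norm b)"
        by (simp add: dist_norm algebra_simps)
      then have "X + s *\<^sub>R a + t *\<^sub>R b \<in> ball X r" using h by (simp add: dist_commute)
      then show "X + s *\<^sub>R a + t *\<^sub>R b \<in> U" using h by auto
    qed
    have sh: "((\<lambda>s. G (Z + s *\<^sub>R v)) has_real_derivative G' (Z + s0 *\<^sub>R v)) (at s0)"
      if "((\<lambda>t. G ((Z + s0 *\<^sub>R v) + t *\<^sub>R v)) has_real_derivative G' (Z + s0 *\<^sub>R v)) (at 0)" for G G' :: "'a \<Rightarrow> real" and Z v s0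
    proof -
      have "((\<lambda>k. G (Z + (s0 + k) *\<^sub>R v)) has_real_derivative G' (Z + s0 *\<^sub>R v)) (at 0)" using that by (simp add: algebra_simps)
      then have "((\<lambda>k. G (Z + k *\<^sub>R v)) has_real_derivative G' (Z + s0 *\<^sub>R v)) (at (0 + s0))"
        by (subst DERIV_shift) (simp add: add.commute)
      then show ?thesis by simp
    qed
    have "\<exists>s. 0 < s \<and> s < h \<and> (\<lambda>s. g (X + s *\<^sub>R a + h *\<^sub>R b) - g (X + s *\<^sub>R a)) h - (\<lambda>s. g (X + s *\<^sub>R a + h *\<^sub>R b) - g (X + s *\<^sub>R a)) 0
        = (h - 0) * (ga (X + s *\<^sub>R a + h *\<^sub>R b) - ga (X + s *\<^sub>R a))"
    proof (rule MVT2[OF h(1)])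
      fix s assume s: "0 \<le> s" "s \<le> h"
      have "((\<lambda>s. g ((X + h *\<^sub>R b) + s *\<^sub>R a)) has_real_derivative ga ((X + h *\<^sub>R b) + s *\<^sub>R a)) (at s)"
        by (rule sh, rule ga) (use inU(1)[of s h] s h in \<open>simp add: algebra_simps\<close>)
      moreover have "((\<lambda>s. g (X + s *\<^sub>R a)) has_real_derivative ga (X + s *\<^sub>R a)) (at s)"
        by (rule sh, rule ga) (use inU(1)[of s 0] s h in simp)
      ultimately show "((\<lambda>s. g (X + s *\<^sub>R a + h *\<^sub>R b) - g (X + s *\<^sub>R a)) has_real_derivative ga (X + s *\<^sub>R a + h *\<^sub>R b) - ga (X + s *\<^sub>R a)) (at s)"
        by (intro DERIV_diff) (simp_all add: algebra_simps)
    qed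
    then obtain s where s: "0 < s" "s < h" "g (X + h *\<^sub>R a + h *\<^sub>R b) - g (X + h *\<^sub>R a) - g (X + h *\<^sub>R b) + g X = h * (ga (X + s *\<^sub>R a + h *\<^sub>R b) - ga (X + s *\<^sub>R a))"
      by (auto simp: algebra_simps)
    have "\<exists>t. 0 < t \<and> t < h \<and> (\<lambda>t. ga (X + s *\<^sub>R a + t *\<^sub>R b)) h - (\<lambda>t. ga (X + s *\<^sub>R a + t *\<^sub>R b)) 0 = (h - 0) * gab (X + s *\<^sub>R a + t *\<^sub>R b)"
    proof (rule MVT2[OF h(1)])
      fix t assume t: "0 \<le> t" "t \<le> h"
      show "((\<lambda>t. ga (X + s *\<^sub>R a + t *\<^sub>R b)) has_real_derivative gab (X + s *\<^sub>R a + t *\<^sub>R b)) (at t)"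
        by (rule sh, rule gab) (use inU(1)[of s t] s t h in simp)
    qed
    then obtain t where t: "0 < t" "t < h" "ga (X + s *\<^sub>R a + h *\<^sub>R b) - ga (X + s *\<^sub>R a) = h * gab (X + s *\<^sub>R a + t *\<^sub>R b)"
      by auto
    show ?thesis
      by (rule exI[of _ "X + s *\<^sub>R a + t *\<^sub>R b"]) (use inU(2)[of s t] s t in simp)
  qed
  have "\<bar>fab X - fba X\<bar> \<le> e" if e: "e > 0" for e
  proof -
    obtain r0 where r0: "r0 > 0" "ball X r0 \<subseteq> U" using U by (meson openE)
    obtain d1 where d1: "d1 > 0" "\<And>Y. dist Y X < d1 \<Longrightarrow> dist (fab Y) (fab X) < e / 2"
      using c(1)[unfolded continuous_at_eps_delta, rule_format, of "e / 2"] e by auto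
    obtain d2 where d2: "d2 > 0" "\<And>Y. dist Y X < d2 \<Longrightarrow> dist (fba Y) (fba X) < e / 2"
      using c(2)[unfolded continuous_at_eps_delta, rule_format, of "e / 2"] e by auto
    define r where "r = min r0 (min d1 d2)"
    define h where "h = r / 2 / (norm a + norm b + 1)"
    have r: "r > 0" "ball X r \<subseteq> U" using r0 d1 d2 by (auto simp: r_def)
    have h0: "h > 0" using r by (simp add: h_def add_nonneg_pos)
    have "norm a + norm b + 1 \<noteq> 0" using norm_ge_zero[of a] norm_ge_zero[of b] by linarith
    then have "h * (norm a + norm b + 1) = r / 2" unfolding h_def by (rule nonzero_eq_divide_eq[THEN iffD1]) (rule refl)
    then have hr: "h * (norm a + norm b) < r" using h0 r by (simp add: algebra_simps)
    obtain Y1 where Y1: "dist Y1 X \<le> h * (norm a + norm b)" "f (X + h *\<^sub>R a + h *\<^sub>R b) - f (X + h *\<^sub>R a) - f (X + h *\<^sub>R b) + f X = h * h * fab Y1"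
      using key[OF h0 r(2) hr da dab] by blast
    have hr': "h * (norm b + norm a) < r" using hr by (simp add: add.commute)
    obtain Y2 where Y2: "dist Y2 X \<le> h * (norm b + norm a)" "f (X + h *\<^sub>R b + h *\<^sub>R a) - f (X + h *\<^sub>R b) - f (X + h *\<^sub>R a) + f X = h * h * fba Y2"
      using key[OF h0 r(2) hr' db dba] by blast
    have "X + h *\<^sub>R b + h *\<^sub>R a = X + h *\<^sub>R a + h *\<^sub>R b" by (simp add: algebra_simps)
    then have "h * h * fab Y1 = h * h * fba Y2" unfolding Y1(2)[symmetric] Y2(2)[symmetric] by (simp add: add_ac)
    then have "fab Y1 = fba Y2" using h0 by simp
    moreover have "dist (fab Y1) (fab X) < e / 2" by (rule d1) (use Y1 hr in \<open>auto simp: r_def\<close>)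
    moreover have "dist (fba Y2) (fba X) < e / 2" by (rule d2) (use Y2 hr' in \<open>auto simp: r_def\<close>)
    ultimately show ?thesis unfolding dist_real_def by linarith
  qed
  then have "\<bar>fab X - fba X\<bar> \<le> 0" by (rule field_le_epsilon[of _ 0, simplified])
  then show ?thesis by simp
qed

section \<open>The weight\<close>

lemma theta_nonneg: "0 \<le> theta s"
  by (simp add: theta_def)

text \<open>The logarithm is traded for a power: ln(1/r) = 6 ln(r^(-1/6)) <= 6 r^(-1/6), whose power
  3/2 is 6^(3/2) r^(-1/4), and 6^(3/2) < 15. What is left of theta(r)/r is an integrable
  singularity.\<close>

lemma theta_bounds:
  assumes "0 < r" "r \<le> 1"
  shows "theta r / r \<le> 15 * r powr (-3/4)" "theta r \<le> 15"
proof -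
  have l: "ln (1 / r) \<ge> 0" using assms by simp
  have "ln (1 / r) = 6 * ln (r powr (-1/6))" using assms by (simp add: ln_powr ln_div)
  also have "\<dots> \<le> 6 * r powr (-1/6)" using ln_le_minus_one[of "r powr (-1/6)"] assms by simp
  finally have "(ln (1 / r)) powr (3/2) \<le> (6 * r powr (-1/6)) powr (3/2)" using l by (intro powr_mono2) auto
  also have "\<dots> = 6 powr (3/2) * r powr (-1/4)" using assms by (simp add: powr_mult powr_powr)
  also have "6 powr (3/2) = 6 * sqrt (6::real)" using powr_add[of 6 1 "1/2::real"] by (simp add: powr_half_sqrt)
  also have "\<dots> \<le> (15::real)" using real_le_lsqrt[of "5/2" 6] real_sqrt_le_mono[of 6 "(5/2)^2"] by (simp only: real_sqrt_abs) (simp add: power2_eq_square)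
  finally have a: "(ln (1 / r)) powr (3/2) \<le> 15 * r powr (-1/4)" using assms by (simp add: mult_right_mono)
  then have b: "theta r \<le> r powr (1/2) * (15 * r powr (-1/4))" unfolding theta_def by (intro mult_left_mono) auto
  also have "\<dots> = 15 * (r powr (1/2) * r powr (-1/4))" by simp
  also have "\<dots> = 15 * r powr (1/4)" by (subst powr_add[symmetric]) simp
  finally have c: "theta r \<le> 15 * r powr (1/4)" .
  have "r powr (1/4) \<le> 1" using assms by (intro powr_le1) auto
  then show "theta r \<le> 15" using c by simp
  have "theta r / r \<le> 15 * r powr (1/4) / r" using c assms by (intro divide_right_mono) auto
  also have "\<dots> = 15 * (r powr (1/4) / r powr 1)" using assms by simp
  also have "\<dots> = 15 * r powr (-3/4)" by (subst powr_diff[symmetric]) simp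
  finally show "theta r / r \<le> 15 * r powr (-3/4)" .
qed

text \<open>The range up to 3/4 is what occurs: \<gamma>(s + a) is at most 1/2 + 1/4. There ln(1/r)
  >= ln(4/3) >= 1/4, and (1/4)^(3/2) = 1/8.\<close>

lemma theta_ge_sqrt:
  assumes "0 < r" "r \<le> 3/4"
  shows "sqrt r / 8 \<le> theta r"
proof -
  have "(1/4::real) \<le> ln (4/3)" using ln_le_minus_one[of "3/4::real"] by (simp add: ln_div)
  also have "\<dots> \<le> ln (1 / r)" using assms by (simp add: field_simps)
  finally have "(1/4) powr (3/2) \<le> (ln (1 / r)) powr (3/2)" by (intro powr_mono2) auto
  moreover have "(1/4::real) powr (3/2) = 1/8"
    using powr_add[of "1/4::real" 1 "1/2"] by (simp add: powr_half_sqrt real_sqrt_divide)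
  ultimately have "r powr (1/2) * (1/8) \<le> theta r" unfolding theta_def by (intro mult_left_mono) auto
  then show ?thesis using assms by (simp add: powr_half_sqrt)
qed

lemma continuous_on_theta: "continuous_on {0<..<1} theta"
  unfolding theta_def[abs_def]
  by (intro continuous_intros ballI) (auto simp: ln_div)

text \<open>Serves both nested integrals of the weight: each integrand is at most a multiple of
  r^(-3/4), whose primitive is 4 r^(1/4). The weight is written with Lebesgue integrals over
  half-open intervals; the proof moves to gauge integrals over closed ones in order to differentiate
  in the upper limit.\<close>

lemma singular_integral:
  fixes g :: "real \<Rightarrow> real"
  assumes c: "continuous_on {0<..<1} g" and K: "\<And>r. 0 < r \<Longrightarrow> r < 1 \<Longrightarrow> 0 \<le> g r \<and> g r \<le> K * r powr (-3/4)"
    and t: "0 < t" "t < 1"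
  shows "((\<lambda>t. LINT x:{0<..t}|lebesgue. g x) has_real_derivative g t) (at t)"
    and "0 \<le> (LINT x:{0<..t}|lebesgue. g x)" "(LINT x:{0<..t}|lebesgue. g x) \<le> 4 * K * t powr (1/4)"
proof -
  have pw: "((\<lambda>x. K * x powr (-3/4)) has_integral (4 * K * s powr (1/4))) {0..s}" if "0 \<le> s" for s :: real
    using has_integral_mult_right[OF has_integral_powr_from_0[of "-3/4" s], of K] that by (simp add: mult_ac)
  have pwi: "(\<lambda>x. K * x powr (-3/4)) integrable_on {0<..s}" if "0 \<le> s" for s
    by (rule integrable_spike_set[OF has_integral_integrable[OF pw[OF that]]]) (rule negligible_subset[of "{0}"], simp, force)+
  have gi: "g absolutely_integrable_on {0<..s}" if s: "s < 1" for s
  proof (cases "0 < s")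
    case True
    have i: "(\<lambda>x. K * x powr (-3/4)) integrable_on {0<..s}" using pwi[of s] True by simp
    show ?thesis
      by (rule measurable_bounded_by_integrable_imp_absolutely_integrable[OF _ _ i])
         (use s K in \<open>auto intro!: continuous_imp_measurable_on_sets_lebesgue continuous_on_subset[OF c]\<close>)
  qed auto
  have eq: "(LINT x:{0<..s}|lebesgue. g x) = integral {0..s} g" "g integrable_on {0..s}" if "s < 1" for s
  proof -
    have 1: "g integrable_on {0<..s}" using gi[OF that] by (rule set_lebesgue_integral_eq_integral(1))
    have "integral {0<..s} g = integral {0..s} g"
      by (rule integral_spike_set) (rule negligible_subset[of "{0}"], simp, force)+
    then show "(LINT x:{0<..s}|lebesgue. g x) = integral {0..s} g"
      using set_lebesgue_integral_eq_integral(2)[OF gi[OF that]] by simp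
    show "g integrable_on {0..s}"
      by (rule integrable_spike_set[OF 1]) (rule negligible_subset[of "{0}"], simp, force)+
  qed
  define b where "b = (t + 1) / 2"
  have b: "t < b" "b < 1" using t by (auto simp: b_def)
  have "((\<lambda>u. integral {0..u} g) has_vector_derivative g t) (at t within {0..b})"
  proof (rule integral_has_vector_derivative_continuous_at[where S = "{}", simplified Diff_empty finite.emptyI simp_thms])
    show "g integrable_on {0..b}" using eq b by auto
    show "t \<in> {0..b}" using t b by simp
    have "isCont g t" using c t by (simp add: continuous_on_eq_continuous_at)
    then show "continuous (at t within {0..b}) g" by (rule continuous_at_imp_continuous_at_within)
  qed simp
  moreover have "at t within {0..b} = at t" by (rule at_within_interior) (use t b in auto)
  ultimately have "((\<lambda>u. integral {0..u} g) has_real_derivative g t) (at t)"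
    by (simp add: has_real_derivative_iff_has_vector_derivative)
  moreover have "\<forall>\<^sub>F u in nhds t. (LINT x:{0<..u}|lebesgue. g x) = integral {0..u} g"
    by (rule eventually_mono[OF eventually_nhds_in_open[of "{..<1}"]]) (use t eq in auto)
  ultimately show "((\<lambda>t. LINT x:{0<..t}|lebesgue. g x) has_real_derivative g t) (at t)"
    by (subst DERIV_cong_ev[OF refl _ refl])
  show "0 \<le> (LINT x:{0<..t}|lebesgue. g x)"
    unfolding set_lebesgue_integral_def
    by (rule integral_nonneg_AE, rule AE_I2) (use K t in \<open>auto split: split_indicator\<close>)
  have "integral {0..t} g = integral {0<..t} g" using eq set_lebesgue_integral_eq_integral(2)[OF gi[OF t(2)]] t by simp
  also have "\<dots> \<le> integral {0<..t} (\<lambda>x. K * x powr (-3/4))"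
    using K t pwi[of t] gi[OF t(2)] by (intro integral_le) (auto intro: set_lebesgue_integral_eq_integral(1))
  also have "\<dots> = integral {0..t} (\<lambda>x. K * x powr (-3/4))"
  proof (rule integral_spike_set)
    show "negligible {x \<in> {0<..t} - {0..t}. K * x powr (-3/4) \<noteq> 0}" "negligible {x \<in> {0..t} - {0<..t}. K * x powr (-3/4) \<noteq> 0}"
      by (rule negligible_subset[of "{0}"], simp, force)+
  qed
  also have "\<dots> = 4 * K * t powr (1/4)" using integral_unique[OF pw[of t]] t by (simp only: less_imp_le)
  finally show "(LINT x:{0<..t}|lebesgue. g x) \<le> 4 * K * t powr (1/4)" using eq t by simp
qed

definition theta_primitive :: "real \<Rightarrow> real" where
  "theta_primitive t = (LINT \<eta>:{0<..t}|lebesgue. theta \<eta> / \<eta>)"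

lemma theta_primitive:
  assumes "0 < t" "t < 1"
  shows "(theta_primitive has_real_derivative theta t / t) (at t)" "0 \<le> theta_primitive t"
    "theta_primitive t \<le> 60 * t powr (1/4)" "theta_primitive t \<le> 60"
proof -
  have c: "continuous_on {0<..<1} (\<lambda>\<eta>. theta \<eta> / \<eta>)" by (intro continuous_intros continuous_on_theta) auto
  have b: "0 \<le> theta r / r \<and> theta r / r \<le> 15 * r powr (-3/4)" if "0 < r" "r < 1" for r
    using theta_bounds[of r] theta_nonneg[of r] that by auto
  note A = singular_integral[OF c b assms]
  show "(theta_primitive has_real_derivative theta t / t) (at t)" "0 \<le> theta_primitive t" and x: "theta_primitive t \<le> 60 * t powr (1/4)"
    using A unfolding theta_primitive_def[abs_def] by auto
  have "t powr (1/4) \<le> 1" using assms by (intro powr_le1) auto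
  then show "theta_primitive t \<le> 60" using x by simp
qed

text \<open>At the argument \<gamma> t this is t \<sigma>'(t)/\<sigma>(t). Its logarithmic
  derivative is -theta(t)/t, so it decreases: this is the concavity of log \<sigma> in log t, and
  the source of the factor theta in the final inequality.\<close>

definition weight_exponent :: "real \<Rightarrow> real" where
  "weight_exponent t = exp (- theta_primitive t)"

lemma weight_exponent:
  assumes "0 < t" "t < 1"
  shows "(weight_exponent has_real_derivative - weight_exponent t * (theta t / t)) (at t)"
    "exp (- 60) \<le> weight_exponent t" "weight_exponent t \<le> 1"
proof -
  show "(weight_exponent has_real_derivative - weight_exponent t * (theta t / t)) (at t)"
    unfolding weight_exponent_def[abs_def]
    by (rule derivative_eq_intros theta_primitive(1)[OF assms] refl | simp)+
qed (use theta_primitive[OF assms] in \<open>auto simp: weight_exponent_def\<close>)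

text \<open>Since 1 - exp(-x) <= x, the outer integrand is at most 60 r^(-3/4), where 60 = 4 * 15
  bounds the inner primitive. Integrating once more gives an exponent of at most 240 = 4 *
  60.\<close>

lemma weight_sigma_properties:
  assumes g: "0 < \<gamma>" and t: "0 < t" "\<gamma> * t < 1"
  shows "((\<lambda>t. ln (weight_sigma \<gamma> t)) has_real_derivative weight_exponent (\<gamma> * t) / t) (at t)"
    "weight_sigma \<gamma> t \<le> t" "exp (-240) * t \<le> weight_sigma \<gamma> t" "0 < weight_sigma \<gamma> t"
proof -
  define \<Psi> where "\<Psi> t = (LINT t:{0<..t}|lebesgue. (1 - weight_exponent t) / t)" for t
  have ws: "weight_sigma \<gamma> s = s * exp (- \<Psi> (\<gamma> * s))" for s
    unfolding weight_sigma_def \<Psi>_def weight_exponent_def theta_primitive_def ..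
  have ce: "continuous_on {0<..<1} weight_exponent"
    by (intro continuous_at_imp_continuous_on ballI DERIV_isCont[OF weight_exponent(1)]) auto
  have c: "continuous_on {0<..<1} (\<lambda>t. (1 - weight_exponent t) / t)" by (intro continuous_intros ce) auto
  have b: "0 \<le> (1 - weight_exponent r) / r \<and> (1 - weight_exponent r) / r \<le> 60 * r powr (-3/4)" if r: "0 < r" "r < 1" for r
  proof -
    have "1 - weight_exponent r \<le> theta_primitive r"
      using exp_ge_add_one_self[of "- theta_primitive r"] by (simp add: weight_exponent_def)
    also have "\<dots> \<le> 60 * r powr (1/4)" using theta_primitive(3)[OF r] .
    finally have "(1 - weight_exponent r) / r \<le> 60 * r powr (1/4) / r" using r by (intro divide_right_mono) auto
    also have "\<dots> = 60 * (r powr (1/4) / r powr 1)" using r by simp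
    also have "\<dots> = 60 * r powr (-3/4)" by (subst powr_diff[symmetric]) simp
    finally show ?thesis using weight_exponent(3)[OF r] r by simp
  qed
  have gt: "0 < \<gamma> * t" using g t by simp
  have A: "(\<Psi> has_real_derivative (1 - weight_exponent (\<gamma> * t)) / (\<gamma> * t)) (at (\<gamma> * t))"
    "0 \<le> \<Psi> (\<gamma> * t)" "\<Psi> (\<gamma> * t) \<le> 4 * 60 * (\<gamma> * t) powr (1/4)"
    using singular_integral[OF c b gt t(2)] unfolding \<Psi>_def[abs_def] by auto
  have d: "((\<lambda>s. \<Psi> (\<gamma> * s)) has_real_derivative (1 - weight_exponent (\<gamma> * t)) / (\<gamma> * t) * \<gamma>) (at t)"
    by (rule DERIV_chain2[where f = \<Psi> and g = "\<lambda>s. \<gamma> * s", OF A(1)]) (rule derivative_eq_intros refl | simp)+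
  have "((\<lambda>s. ln s - \<Psi> (\<gamma> * s)) has_real_derivative weight_exponent (\<gamma> * t) / t) (at t)"
    by (rule derivative_eq_intros d refl | use t g in \<open>simp add: field_simps\<close>)+
  moreover have "\<forall>\<^sub>F s in nhds t. ln (weight_sigma \<gamma> s) = ln s - \<Psi> (\<gamma> * s)"
    by (rule eventually_mono[OF eventually_nhds_in_open[of "{0<..}"]]) (use t in \<open>auto simp: ws ln_mult\<close>)
  ultimately show "((\<lambda>t. ln (weight_sigma \<gamma> t)) has_real_derivative weight_exponent (\<gamma> * t) / t) (at t)"
    by (subst DERIV_cong_ev[OF refl _ refl])
  show "0 < weight_sigma \<gamma> t" using t by (simp add: ws)
  have "exp (- \<Psi> (\<gamma> * t)) \<le> 1" using A(2) by simp
  then show "weight_sigma \<gamma> t \<le> t" using t by (simp add: ws mult_left_le)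
  have "(\<gamma> * t) powr (1/4) \<le> 1" using gt t by (intro powr_le1) auto
  then have "\<Psi> (\<gamma> * t) \<le> 240" using A(3) by simp
  then have "exp (-240) \<le> exp (- \<Psi> (\<gamma> * t))" by simp
  then have "t * exp (-240) \<le> t * exp (- \<Psi> (\<gamma> * t))" using t by (intro mult_left_mono) auto
  then show "exp (-240) * t \<le> weight_sigma \<gamma> t" by (simp add: ws mult.commute)
qed

section \<open>Smooth functions on the closed half-space\<close>

definition xdir :: "'n::finite \<Rightarrow> (real^'n) \<times> real" where
  "xdir i = (axis i 1, 0)"

lemma xdir_nonzero: "xdir i \<noteq> 0"
  by (auto simp: xdir_def zero_prod_def axis_eq_0_iff)

lemma partial_x_eq_deriv: "partial_x i f X = deriv (\<lambda>t. f (X + t *\<^sub>R xdir i)) 0"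
  by (cases X) (simp add: partial_x_def xdir_def)

lemma partial_x_unique:
  "((\<lambda>t. f (X + t *\<^sub>R xdir i)) has_real_derivative D) (at 0) \<Longrightarrow> partial_x i f X = D"
  by (simp add: partial_x_eq_deriv DERIV_imp_deriv)

lemma partial_x_cong:
  assumes "\<And>t. f (X + t *\<^sub>R xdir i) = g (X + t *\<^sub>R xdir i)"
  shows "partial_x i f X = partial_x i g X"
  using assms by (simp add: partial_x_eq_deriv)

text \<open>Derivatives in x up to order k exist everywhere and are jointly continuous in (x, s),
  with no differentiability in s. Clamped functions and weights, which may have kinks at s = 0 and s
  = T, belong to this class.\<close>

primrec x_smooth :: "nat \<Rightarrow> ((real^'n::finite) \<times> real \<Rightarrow> real) \<Rightarrow> bool" where
  "x_smooth 0 F \<longleftrightarrow> continuous_on UNIV F"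
| "x_smooth (Suc k) F \<longleftrightarrow> continuous_on UNIV F \<and>
     (\<forall>i X. ((\<lambda>t. F (X + t *\<^sub>R xdir i)) has_real_derivative partial_x i F X) (at 0)) \<and>
     (\<forall>i. x_smooth k (partial_x i F))"

declare x_smooth.simps(2)[simp del]

lemma x_smooth_continuous: "x_smooth k F \<Longrightarrow> continuous_on UNIV F"
  by (cases k) (auto simp: x_smooth.simps(2))

lemma x_smooth_derivative:
  "x_smooth (Suc k) F \<Longrightarrow> ((\<lambda>t. F (X + t *\<^sub>R xdir i)) has_real_derivative partial_x i F X) (at 0)"
  unfolding x_smooth.simps(2) by blast

lemma x_smooth_partial: "x_smooth (Suc k) F \<Longrightarrow> x_smooth k (partial_x i F)"
  unfolding x_smooth.simps(2) by blast

lemma x_smooth_SucI: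
  assumes "continuous_on UNIV F"
    and d: "\<And>i X. ((\<lambda>t. F (X + t *\<^sub>R xdir i)) has_real_derivative F' i X) (at 0)"
    and s: "\<And>i. x_smooth k (F' i)"
  shows "x_smooth (Suc k) F" "partial_x i F = F' i"
proof -
  have e: "partial_x i F = F' i" for i using partial_x_unique[OF d] by auto
  then show "partial_x i F = F' i" .
  show "x_smooth (Suc k) F" unfolding x_smooth.simps(2) e using assms by blast
qed

lemma x_smooth_Suc_D: "x_smooth (Suc k) F \<Longrightarrow> x_smooth k F"
  by (induction k arbitrary: F) (auto simp: x_smooth.simps(2))

lemma x_smooth_const: "x_smooth k (\<lambda>X. c)"
proof (induction k arbitrary: c)
  case (Suc k)
  show ?case by (rule x_smooth_SucI(1)[where F' = "\<lambda>i X. 0"]) (use Suc in auto)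
qed simp

lemma x_smooth_add:
  assumes "x_smooth k F" "x_smooth k K" shows "x_smooth k (\<lambda>X. F X + K X)"
  using assms
proof (induction k arbitrary: F K)
  case (Suc k)
  show ?case
    by (rule x_smooth_SucI(1)[where F' = "\<lambda>i X. partial_x i F X + partial_x i K X"])
       (use Suc in \<open>auto intro!: continuous_intros DERIV_add simp: x_smooth_derivative x_smooth_continuous x_smooth_partial\<close>)
qed (auto intro: continuous_intros)

lemma x_smooth_mult:
  assumes "x_smooth k F" "x_smooth k K" shows "x_smooth k (\<lambda>X. F X * K X)"
  using assms
proof (induction k arbitrary: F K)
  case (Suc k)
  show ?case
  proof (rule x_smooth_SucI(1)[where F' = "\<lambda>i X. partial_x i F X * K X + F X * partial_x i K X"])
    fix i show "x_smooth k (\<lambda>X. partial_x i F X * K X + F X * partial_x i K X)"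
      using Suc by (intro x_smooth_add Suc.IH x_smooth_Suc_D[of k F] x_smooth_Suc_D[of k K] x_smooth_partial)
    fix X
    have "((\<lambda>t. F (X + t *\<^sub>R xdir i)) has_real_derivative partial_x i F X) (at 0)"
       "((\<lambda>t. K (X + t *\<^sub>R xdir i)) has_real_derivative partial_x i K X) (at 0)" using Suc.prems by (auto intro: x_smooth_derivative)
    from DERIV_mult[OF this]
    show "((\<lambda>t. F (X + t *\<^sub>R xdir i) * K (X + t *\<^sub>R xdir i)) has_real_derivative partial_x i F X * K X + F X * partial_x i K X) (at 0)"
      by (simp add: algebra_simps)
  qed (use Suc in \<open>auto intro!: continuous_intros simp: x_smooth_continuous\<close>)
qed (auto intro: continuous_intros)

lemma x_smooth_time:
  assumes "continuous_on UNIV g" shows "x_smooth k (\<lambda>X. g (snd X))"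
proof (cases k)
  case 0 then show ?thesis by (auto intro!: continuous_on_compose2[OF assms] continuous_intros)
next
  case (Suc m)
  show ?thesis unfolding Suc
    by (rule x_smooth_SucI(1)[where F' = "\<lambda>i X. 0"])
       (auto simp: xdir_def x_smooth_const intro!: continuous_on_compose2[OF assms] continuous_intros)
qed

lemma x_smooth_coordinate: "x_smooth k (\<lambda>X. fst X $ j)"
proof (cases k)
  case 0 then show ?thesis by (auto intro!: continuous_intros)
next
  case (Suc m)
  have "((\<lambda>t. fst (X + t *\<^sub>R xdir i) $ j) has_real_derivative (if i = j then 1 else 0)) (at 0)" for X and i
    by (auto simp: xdir_def axis_def intro!: derivative_eq_intros)
  then show ?thesis unfolding Suc
    by (intro x_smooth_SucI(1)[where F' = "\<lambda>i X. if i = j then 1 else 0"])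
       (auto intro!: continuous_intros x_smooth_const)
qed

lemma x_smooth_lip_diff:
  assumes "x_smooth (Suc k) F" shows "lip_diff (xdir i) F (partial_x i F)"
  using assms by (intro lip_diff_C1 x_smooth_derivative x_smooth_continuous[OF x_smooth_partial]) (auto simp: x_smooth_continuous)

lemma partial_x_commute:
  assumes "x_smooth (Suc (Suc k)) F"
  shows "partial_x i (partial_x j F) X = partial_x j (partial_x i F) X"
proof (rule sym, rule mixed_derivatives_eq[of UNIV X F "xdir i" "partial_x i F" "xdir j" "partial_x j F"])
  have "continuous_on UNIV (partial_x j (partial_x i F))" "continuous_on UNIV (partial_x i (partial_x j F))"
    using assms by (auto intro!: x_smooth_continuous[of k] x_smooth_partial)
  then show "isCont (partial_x j (partial_x i F)) X" "isCont (partial_x i (partial_x j F)) X"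
    by (auto intro: continuous_on_interior)
qed (use assms in \<open>auto intro: x_smooth_derivative x_smooth_partial\<close>)

section \<open>Relative derivatives on the closed half-space\<close>

definition half_deriv :: "(real^'n::finite) \<times> real \<Rightarrow> ((real^'n) \<times> real \<Rightarrow> real) \<Rightarrow> (real^'n) \<times> real \<Rightarrow> real" where
  "half_deriv v f X = frechet_derivative f (at X within closed_half_space) v"

definition half_smooth :: "((real^'n::finite) \<times> real \<Rightarrow> real) \<Rightarrow> bool" where
  "half_smooth f \<longleftrightarrow> (\<forall>k. Ck_on k closed_half_space f)"

lemma half_smooth_half_deriv: "half_smooth f \<Longrightarrow> half_smooth (half_deriv v f)"
  unfolding half_smooth_def half_deriv_def[abs_def] by (metis Ck_on.simps(2))

lemma half_smooth_continuous: "half_smooth f \<Longrightarrow> continuous_on closed_half_space f"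
  unfolding half_smooth_def by (metis Ck_on.simps(1))

lemma half_smooth_has_derivative:
  assumes "half_smooth f" "X \<in> closed_half_space"
  shows "(f has_derivative (\<lambda>v. half_deriv v f X)) (at X within closed_half_space)"
proof -
  have "f differentiable_on closed_half_space" using assms(1) unfolding half_smooth_def by (metis Ck_on.simps(2))
  then have "f differentiable (at X within closed_half_space)" using assms(2) by (auto simp: differentiable_on_def)
  then show ?thesis unfolding half_deriv_def by (simp add: frechet_derivative_works)
qed

text \<open>A relative derivative becomes an ordinary two-sided one along any line that stays in the
  half-space for parameters near 0: horizontal lines even at boundary points, all lines at interior
  points.\<close>

lemma half_deriv_line:
  assumes f: "half_smooth f" and X: "X \<in> closed_half_space" and line: "\<And>t. t \<in> I \<Longrightarrow> X + t *\<^sub>R v \<in> closed_half_space"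
    and I: "open I" "0 \<in> I"
  shows "((\<lambda>t. f (X + t *\<^sub>R v)) has_real_derivative half_deriv v f X) (at 0)"
proof -
  have d: "(f has_derivative (\<lambda>v. half_deriv v f X)) (at X within closed_half_space)"
    by (rule half_smooth_has_derivative[OF f X])
  have "((\<lambda>t. f (X + t *\<^sub>R v)) has_derivative (\<lambda>t. half_deriv (t *\<^sub>R v) f X)) (at 0 within I)"
  proof (rule has_derivative_in_compose[where f = "\<lambda>t. X + t *\<^sub>R v" and f' = "\<lambda>t. t *\<^sub>R v"])
    show "((\<lambda>t. X + t *\<^sub>R v) has_derivative (\<lambda>t. t *\<^sub>R v)) (at 0 within I)"
      by (auto intro!: derivative_eq_intros)
    show "(f has_derivative (\<lambda>v. half_deriv v f X)) (at (X + 0 *\<^sub>R v) within (\<lambda>t. X + t *\<^sub>R v) ` I)"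
      using has_derivative_subset[OF d, of "(\<lambda>t. X + t *\<^sub>R v) ` I"] line by auto
  qed
  moreover have "half_deriv (t *\<^sub>R v) f X = t * half_deriv v f X" for t
    using linear_scale[OF has_derivative_linear[OF d], of t v] by simp
  ultimately have "((\<lambda>t. f (X + t *\<^sub>R v)) has_derivative (\<lambda>t. t * half_deriv v f X)) (at 0)"
    using I at_within_open[of 0 I] by simp
  then show ?thesis by (simp add: has_field_derivative_def mult_commute_abs)
qed

lemma half_deriv_x_line:
  assumes "half_smooth f" "X \<in> closed_half_space"
  shows "((\<lambda>t. f (X + t *\<^sub>R xdir i)) has_real_derivative half_deriv (xdir i) f X) (at 0)"
  by (rule half_deriv_line[OF assms, of UNIV]) (use assms(2) in \<open>auto simp: closed_half_space_def xdir_def\<close>)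

lemma half_deriv_interior_line:
  assumes f: "half_smooth f" and X: "0 < snd X"
  shows "((\<lambda>t. f (X + t *\<^sub>R v)) has_real_derivative half_deriv v f X) (at 0)"
proof (rule half_deriv_line[OF f, of X "{t. 0 < snd X + t * snd v}"])
  show "open {t. 0 < snd X + t * snd v}" by (intro open_Collect_less continuous_intros)
qed (use X in \<open>auto simp: closed_half_space_def mem_Times_iff\<close>)

lemma half_deriv_vanish:
  fixes f :: "(real^'n::finite) \<times> real \<Rightarrow> real"
  assumes f: "half_smooth f" and K: "closed K" and z: "\<And>Y. Y \<in> closed_half_space - K \<Longrightarrow> f Y = 0"
    and X: "X \<in> closed_half_space - K"
  shows "half_deriv v f X = 0"
proof -
  have "((\<lambda>_. 0) has_derivative (\<lambda>v. 0)) (at X within closed_half_space)" by simp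
  moreover have "\<forall>\<^sub>F Y in at X within closed_half_space. f Y = 0"
  proof -
    have "\<forall>\<^sub>F Y in at X within closed_half_space. Y \<in> - K"
      unfolding eventually_at_topological using K X by (intro exI[of _ "- K"]) auto
    moreover have "\<forall>\<^sub>F Y in at X within closed_half_space. Y \<in> closed_half_space"
      by (auto simp: eventually_at_filter)
    ultimately show ?thesis by eventually_elim (use z in auto)
  qed
  then have "\<forall>\<^sub>F Y in at X within closed_half_space. 0 = f Y" by eventually_elim simp
  ultimately have "(f has_derivative (\<lambda>v. 0)) (at X within closed_half_space)"
    by (rule has_derivative_transform_eventually) (use z X in auto)
  note d0 = this
  have "(f has_derivative (\<lambda>v. half_deriv v f X)) (at X within closed_half_space)"
    by (rule half_smooth_has_derivative[OF f]) (use X in auto)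
  from this d0 have "(\<lambda>v. half_deriv v f X) = (\<lambda>v. 0)"
  proof (rule frechet_derivative_unique_within)
    \<comment> \<open>Uniqueness of the relative derivative at boundary points: a small positive
      step along any basis vector stays in the half-space.\<close>
    fix i :: "(real^'n) \<times> real" and e :: real assume i: "i \<in> Basis" "e > 0"
    have "0 \<le> snd i" using i by (auto simp: Basis_prod_def)
    then show "\<exists>d. 0 < \<bar>d\<bar> \<and> \<bar>d\<bar> < e \<and> X + d *\<^sub>R i \<in> closed_half_space"
      using i X by (intro exI[of _ "e/2"]) (auto simp: closed_half_space_def mem_Times_iff)
  qed
  then show ?thesis by (rule fun_cong)
qed

lemma half_deriv_time_commute:
  fixes f :: "(real^'n::finite) \<times> real \<Rightarrow> real"
  assumes f: "half_smooth f" and X: "0 < snd X"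
  shows "half_deriv v (half_deriv w f) X = half_deriv w (half_deriv v f) X"
proof -
  have c: "isCont (half_deriv v (half_deriv w f)) X" for v w
  proof -
    have "continuous_on {Y. 0 < snd Y} (half_deriv v (half_deriv w f))"
      by (rule continuous_on_subset[OF half_smooth_continuous]) (use f in \<open>auto simp: half_smooth_half_deriv closed_half_space_def mem_Times_iff\<close>)
    moreover have "open {Y::(real^'n) \<times> real. 0 < snd Y}" by (intro open_Collect_less continuous_intros)
    ultimately show ?thesis using X by (intro continuous_on_interior[of "{Y. 0 < snd Y}"]) (simp_all only: interior_open mem_Collect_eq)
  qed
  show ?thesis
  proof (rule mixed_derivatives_eq[of "{Y. 0 < snd Y}" X f w _ v])
    show "open {Y::(real^'n) \<times> real. 0 < snd Y}" by (intro open_Collect_less continuous_intros)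
  qed (rule c half_deriv_interior_line half_smooth_half_deriv f | use X in simp)+
qed

text \<open>Clamping the time to \<open>[0, T]\<close> turns functions on the half-space into functions that are
  continuous everywhere and keeps their derivatives in \<open>x\<close>.\<close>

definition time_clamp :: "real \<Rightarrow> real \<Rightarrow> real" where
  "time_clamp T s = max 0 (min s T)"

lemma continuous_time_clamp: "continuous_on A (time_clamp T)"
  unfolding time_clamp_def[abs_def] by (intro continuous_intros)

lemma time_clamp_eq: "0 \<le> s \<Longrightarrow> s \<le> T \<Longrightarrow> time_clamp T s = s"
  by (simp add: time_clamp_def)

lemma time_clamp_bounds: "0 \<le> T \<Longrightarrow> 0 \<le> time_clamp T s \<and> time_clamp T s \<le> T"
  by (auto simp: time_clamp_def)

definition clamp_ext :: "real \<Rightarrow> ((real^'n::finite) \<times> real \<Rightarrow> real) \<Rightarrow> (real^'n) \<times> real \<Rightarrow> real" where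
  "clamp_ext T f X = f (fst X, time_clamp T (snd X))"

lemma clamp_in: "(x, time_clamp T s) \<in> closed_half_space"
  by (simp add: closed_half_space_def time_clamp_def)

lemma x_smooth_clamp_ext:
  fixes f :: "(real^'n::finite) \<times> real \<Rightarrow> real"
  assumes "half_smooth f"
  shows "x_smooth k (clamp_ext T f)" "partial_x i (clamp_ext T f) = clamp_ext T (half_deriv (xdir i) f)"
proof -
  have d: "((\<lambda>t. clamp_ext T f (X + t *\<^sub>R xdir i)) has_real_derivative clamp_ext T (half_deriv (xdir i) f) X) (at 0)"
    if "half_smooth f" for f :: "(real^'n) \<times> real \<Rightarrow> real" and i X
    using half_deriv_x_line[OF that clamp_in[of "fst X" T "snd X"], of i]
    by (simp add: clamp_ext_def xdir_def)
  have c: "continuous_on UNIV (clamp_ext T f)" if "half_smooth f" for f :: "(real^'n) \<times> real \<Rightarrow> real"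
    unfolding clamp_ext_def[abs_def]
    by (intro continuous_on_compose2[OF half_smooth_continuous[OF that]] continuous_intros continuous_on_compose2[OF continuous_time_clamp])
       (auto simp: clamp_in)
  show "x_smooth k (clamp_ext T f)" using assms
  proof (induction k arbitrary: f)
    case (Suc k)
    show ?case by (rule x_smooth_SucI(1)[OF c d]) (rule Suc.prems Suc.IH half_smooth_half_deriv)+
  qed (simp add: c)
  show "partial_x i (clamp_ext T f) = clamp_ext T (half_deriv (xdir i) f)"
    using partial_x_unique[OF d[OF assms]] by auto
qed

lemma clamp_ext_time_derivative:
  assumes "half_smooth f" "0 < s" "s < T"
  shows "((\<lambda>s. clamp_ext T f (x, s)) has_real_derivative clamp_ext T (half_deriv (0, 1) f) (x, s)) (at s)"
proof -
  have "((\<lambda>t. f ((x, s) + t *\<^sub>R (0, 1))) has_real_derivative half_deriv (0, 1) f (x, s)) (at 0)"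
    by (rule half_deriv_interior_line) (use assms in auto)
  then have "((\<lambda>t. f (x, t + s)) has_real_derivative half_deriv (0, 1) f (x, s)) (at 0)" by (simp add: add.commute)
  then have "((\<lambda>t. f (x, t)) has_real_derivative half_deriv (0, 1) f (x, s)) (at s)"
    using DERIV_shift[of "\<lambda>t. f (x, t)" _ 0 s] by simp
  moreover have "\<forall>\<^sub>F t in nhds s. clamp_ext T f (x, t) = f (x, t)"
    by (rule eventually_mono[OF eventually_nhds_in_open[of "{0<..<T}"]]) (use assms in \<open>auto simp: clamp_ext_def time_clamp_eq\<close>)
  moreover have "clamp_ext T (half_deriv (0, 1) f) (x, s) = half_deriv (0, 1) f (x, s)"
    using assms by (simp add: clamp_ext_def time_clamp_eq)
  ultimately show ?thesis by (subst DERIV_cong_ev[OF refl _ refl]) auto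
qed

text \<open>Supplies the time derivative of the gradient. Interchanging the derivatives in x and s
  is justified in the open half-space, which is enough since 0 < s < T.\<close>

lemma clamp_ext_mixed_derivative:
  assumes "half_smooth f" "0 < s" "s < T"
  shows "((\<lambda>s. partial_x i (clamp_ext T f) (x, s)) has_real_derivative partial_x i (clamp_ext T (half_deriv (0, 1) f)) (x, s)) (at s)"
proof -
  have "clamp_ext T (half_deriv (0, 1) (half_deriv (xdir i) f)) (x, s) = clamp_ext T (half_deriv (xdir i) (half_deriv (0, 1) f)) (x, s)"
    using assms by (simp add: clamp_ext_def time_clamp_eq half_deriv_time_commute)
  then show ?thesis
    using clamp_ext_time_derivative[OF half_smooth_half_deriv[OF assms(1)] assms(2,3), of "xdir i" x]
    by (simp add: x_smooth_clamp_ext(2) assms(1) half_smooth_half_deriv)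
qed

lemma partial_x_half:
  assumes "half_smooth f" "X \<in> closed_half_space"
  shows "partial_x i f X = half_deriv (xdir i) f X"
  by (rule partial_x_unique half_deriv_x_line assms)+

lemma partial_s_half:
  assumes "half_smooth f" "0 < snd X"
  shows "partial_s f X = half_deriv (0, 1) f X"
proof -
  have "((\<lambda>t. f (X + t *\<^sub>R (0, 1))) has_real_derivative half_deriv (0, 1) f X) (at 0)"
    by (rule half_deriv_interior_line[OF assms])
  then have "((\<lambda>t. f (fst X, t + snd X)) has_real_derivative half_deriv (0, 1) f X) (at 0)"
    by (cases X) (simp add: add.commute)
  then have "((\<lambda>t. f (fst X, t)) has_real_derivative half_deriv (0, 1) f X) (at (snd X))"
    using DERIV_shift[of "\<lambda>t. f (fst X, t)" _ 0 "snd X"] by simp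
  then show ?thesis unfolding partial_s_def by (rule DERIV_imp_deriv)
qed

lemma supp_on_vanish:
  assumes f: "Cinf_compact_on closed_half_space f" and X: "X \<in> closed_half_space" "X \<notin> supp_on closed_half_space f"
  shows "f X = 0" "half_deriv v f X = 0" "half_deriv v (half_deriv w f) X = 0"
proof -
  let ?K = "supp_on closed_half_space f"
  have K: "closed ?K" using f by (simp add: Cinf_compact_on_def compact_imp_closed)
  have s: "half_smooth f" using f by (simp add: Cinf_compact_on_def half_smooth_def)
  have z: "f Y = 0" if "Y \<in> closed_half_space - ?K" for Y
    using that closure_subset[of "{x \<in> closed_half_space. f x \<noteq> 0}"] by (auto simp: supp_on_def)
  have z': "half_deriv v f Y = 0" if "Y \<in> closed_half_space - ?K" for Y v
    by (rule half_deriv_vanish[OF s K z that])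
  show "f X = 0" "half_deriv v f X = 0" using z z' X by auto
  show "half_deriv v (half_deriv w f) X = 0"
    by (rule half_deriv_vanish[OF half_smooth_half_deriv[OF s] K z']) (use X in auto)
qed

section \<open>Pointwise estimates\<close>

lemma young:
  fixes a b k :: real assumes "0 < k" shows "a * b \<le> k * a\<^sup>2 + b\<^sup>2 / (4 * k)"
proof -
  have "0 \<le> (2 * k * a - b)\<^sup>2 / (4 * k)" using assms by simp
  also have "\<dots> = k * a\<^sup>2 - a * b + b\<^sup>2 / (4 * k)" using assms by (simp add: power2_eq_square field_simps)
  finally show ?thesis by simp
qed

text \<open>Scaled variables: \<open>|x| = y \<tau>\<close>, \<open>v\<^sup>2 = V t\<^sup>2\<close>, \<open>b = \<tau>\<^sup>2/t\<close>, \<open>\<gamma> = |\<nabla>v|\<close>.  All error terms are small multiples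
  of the six quantities \<open>P1\<close> to \<open>P6\<close>, the smallness coming from \<open>\<tau> \<le> \<epsilon> \<theta>\<close>.\<close>

lemma carleman_absorption:
  fixes M p0 \<epsilon> \<theta> \<tau> t y V v \<gamma> S :: real
  defines "e0 \<equiv> p0 / 32" and "m \<equiv> y\<^sup>2 * \<tau> + p0 / 32 * \<theta>"
  assumes M: "1 \<le> M" and p0: "0 < p0" "p0 \<le> 1" and \<epsilon>: "0 < \<epsilon>" "\<epsilon> * M\<^sup>2 * 10^7 \<le> p0"
    and \<tau>: "0 < \<tau>" "\<tau> \<le> \<epsilon> * \<theta>" and \<theta>: "0 < \<theta>" "\<theta> \<le> 15" and t: "0 < t" "t \<le> \<tau>\<^sup>2"
    and y: "0 \<le> y" and \<gamma>: "0 \<le> \<gamma>" and V: "v\<^sup>2 = V * t\<^sup>2" "0 \<le> V"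
    and p: "p0 \<le> p"
    and I: "2 * S * w = D1 - dtE + R1 + R2 * v\<^sup>2" and F: "F = S + w / t"
    and R1: "\<bar>R1\<bar> \<le> M * (y * \<tau>) * \<gamma>\<^sup>2"
    and R2: "R2 * v\<^sup>2 \<ge> p * (\<tau>\<^sup>2 * \<theta> * V) - M * (y * \<tau>) * (\<tau>\<^sup>2 + (y * \<tau>)\<^sup>2) * V"
    and II: "m * S1 = D2 - m * v * S + m * q * v\<^sup>2 - v * Z" and S1: "\<gamma>\<^sup>2 / 2 \<le> S1"
    and Z: "\<bar>Z\<bar> \<le> M * y * \<gamma>"
    and q: "q * v\<^sup>2 \<le> (\<tau>\<^sup>2 - (y * \<tau>)\<^sup>2 / 32) * V" "q\<^sup>2 * v\<^sup>2 * t\<^sup>2 \<le> 2 * (\<tau>^4 + (y * \<tau>)^4) * V"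
    and FF: "F = f - R * v - er" and R: "t * (R * v)\<^sup>2 \<le> M\<^sup>2 * (y * \<tau>)\<^sup>2 * V * t"
    and er: "t * er\<^sup>2 \<le> M * (t\<^sup>2 * H + (y * \<tau>)\<^sup>2 * \<gamma>\<^sup>2 + V * t\<^sup>2 + (y * \<tau>)^4 * V + t * \<gamma>\<^sup>2 + (y * \<tau>)\<^sup>2 * V * t)"
    and H: "H \<le> M * (S\<^sup>2 + q\<^sup>2 * v\<^sup>2 + \<gamma>\<^sup>2) + 2 * D3"
  shows "p0 / 4096 * (\<tau>\<^sup>2 * \<theta> * V + \<theta> * \<gamma>\<^sup>2 + \<theta> * (y * \<tau>)\<^sup>2 * V) \<le> 3 * t * f\<^sup>2 + dtE - D1 + D2 + 6 * M * t\<^sup>2 * D3"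
proof -
  \<comment> \<open>\<open>P1\<close> is the square of S contained in \<open>t * F\<^sup>2\<close>,
    and \<open>P2\<close> the gain from the concavity of the weight. \<open>P3\<close> and
    \<open>P4\<close> are the two summands of m times |\<nabla>v|^2; \<open>P5\<close> and
    \<open>P6\<close> are the same summands times the |x|^2 part of the potential q, which has a
    favourable sign.\<close>
  define P1 where "P1 = t * S\<^sup>2"
  define P2 where "P2 = \<tau>\<^sup>2 * \<theta> * V"
  define P3 where "P3 = y\<^sup>2 * \<tau> * \<gamma>\<^sup>2"
  define P4 where "P4 = \<theta> * \<gamma>\<^sup>2"
  define P5 where "P5 = y^4 * \<tau>^3 * V"
  define P6 where "P6 = \<theta> * y\<^sup>2 * \<tau>\<^sup>2 * V"
  have P0: "0 \<le> P1" "0 \<le> P2" "0 \<le> P3" "0 \<le> P4" "0 \<le> P5" "0 \<le> P6"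
    using t \<theta> \<tau> V y by (auto simp: P1_def P2_def P3_def P4_def P5_def P6_def)
  have e0: "e0 = p0 / 32" "0 < e0" using p0 by (auto simp: e0_def)
  have m: "m = y\<^sup>2 * \<tau> + e0 * \<theta>" "0 \<le> m" using \<theta> \<tau> p0 by (auto simp: m_def e0_def)
  have \<epsilon>1: "\<epsilon> * M\<^sup>2 \<le> p0 / 10^7" using \<epsilon>(2) by simp
  have M2: "1 \<le> M\<^sup>2" using M by simp
  have "\<epsilon> * 1 \<le> \<epsilon> * M\<^sup>2" using M2 \<epsilon> by (intro mult_left_mono) auto
  then have \<epsilon>2: "\<epsilon> \<le> p0 / 10^7" using \<epsilon>1 by simp
  then have \<epsilon>3: "\<epsilon> \<le> 1" using p0 by simp
  have MM: "M \<le> M\<^sup>2" using M by (simp add: power2_eq_square)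
  have "\<epsilon> * M \<le> \<epsilon> * M\<^sup>2" using MM \<epsilon> by (intro mult_left_mono) auto
  then have \<epsilon>4: "\<epsilon> * M \<le> p0 / 10^7" using \<epsilon>1 by simp
  have "\<epsilon> * \<theta> \<le> \<epsilon> * 15" using \<theta> \<epsilon> by (intro mult_left_mono) auto
  then have \<tau>15: "\<tau> \<le> 15 * \<epsilon>" using \<tau> by linarith
  have \<tau>2: "\<tau>\<^sup>2 \<le> 15 * \<epsilon> * \<theta>" "\<tau>\<^sup>2 \<le> 225 * \<epsilon>"
  proof -
    have "\<tau> * \<tau> \<le> 15 * (\<epsilon> * \<theta>)" using \<tau> \<tau>15 \<epsilon>3 by (intro mult_mono) auto
    then show 1: "\<tau>\<^sup>2 \<le> 15 * \<epsilon> * \<theta>" by (simp add: power2_eq_square)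
    have "15 * \<epsilon> * \<theta> \<le> 15 * \<epsilon> * 15" using \<theta> \<epsilon> by (intro mult_left_mono) auto
    then show "\<tau>\<^sup>2 \<le> 225 * \<epsilon>" using 1 by simp
  qed
  note t2 = order.trans[OF t(2) \<tau>2(1)] order.trans[OF t(2) \<tau>2(2)]
  have t1: "t \<le> 1" using t2(2) \<epsilon>2 p0 by simp
  have tt: "t\<^sup>2 \<le> t" using t t1 by (simp add: power2_eq_square mult_left_le)
  have tau3: "\<tau>^3 * V \<le> \<epsilon> * P2"
  proof -
    have "\<tau>^3 * V = \<tau> * (\<tau>\<^sup>2 * V)" by (simp add: power2_eq_square power3_eq_cube)
    also have "\<dots> \<le> (\<epsilon> * \<theta>) * (\<tau>\<^sup>2 * V)" using \<tau> V by (intro mult_right_mono) auto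
    finally show ?thesis by (simp add: P2_def mult_ac)
  qed
  have y2tau3: "y\<^sup>2 * \<tau>^3 * V \<le> \<epsilon> * P6"
  proof -
    have "y\<^sup>2 * \<tau>^3 * V = \<tau> * (y\<^sup>2 * \<tau>\<^sup>2 * V)" by (simp add: power2_eq_square power3_eq_cube)
    also have "\<dots> \<le> (\<epsilon> * \<theta>) * (y\<^sup>2 * \<tau>\<^sup>2 * V)" using \<tau> V by (intro mult_right_mono) auto
    finally show ?thesis by (simp add: P6_def mult_ac)
  qed
  have tg: "\<tau> * \<gamma>\<^sup>2 \<le> \<epsilon> * P4"
    using mult_right_mono[OF \<tau>(2), of "\<gamma>\<^sup>2"] by (simp add: P4_def mult_ac)
  \<comment> \<open>The Rellich errors carry an odd power of y, that is of |x|. Young's inequality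
    trades one y for a fixed small share of \<open>y\<^sup>2\<close>, paid for by the first summand
    of m, and a multiple of \<open>M\<^sup>2\<close>, which later meets a factor \<tau> <=
    \<epsilon> \<theta>.\<close>
  have ymul: "0 \<le> a \<Longrightarrow> M * y * a \<le> (1/128) * (y\<^sup>2 * a) + 32 * M\<^sup>2 * a" for a
    using mult_right_mono[OF young[of "1/128" y M], of a] by (simp add: algebra_simps)
  have a: "M * (y * \<tau>) * \<gamma>\<^sup>2 \<le> P3 / 128 + 32 * (\<epsilon> * M\<^sup>2) * P4"
  proof -
    have "M * y * (\<tau> * \<gamma>\<^sup>2) \<le> (1/128) * (y\<^sup>2 * (\<tau> * \<gamma>\<^sup>2)) + 32 * M\<^sup>2 * (\<tau> * \<gamma>\<^sup>2)" using \<tau> by (intro ymul) auto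
    also have "32 * M\<^sup>2 * (\<tau> * \<gamma>\<^sup>2) \<le> 32 * M\<^sup>2 * (\<epsilon> * P4)" using tg by (intro mult_left_mono) auto
    finally show ?thesis by (simp add: P3_def algebra_simps)
  qed
  have y24: "y\<^sup>2 \<le> k * y^4 + 1 / (4 * k)" if "0 < k" for k
    using young[OF that, of "y\<^sup>2" 1] by simp
  have b: "M * (y * \<tau>) * \<tau>\<^sup>2 * V \<le> P5 / 128 + 64 * (\<epsilon> * M\<^sup>2) * P2"
  proof -
    have n: "0 \<le> \<tau>^3 * V" using \<tau> V by auto
    have "M * y * (\<tau>^3 * V) \<le> (1/128) * (y\<^sup>2 * (\<tau>^3 * V)) + 32 * M\<^sup>2 * (\<tau>^3 * V)" using n by (rule ymul)
    also have "y\<^sup>2 * (\<tau>^3 * V) \<le> (1 * y^4 + 1 / (4 * 1)) * (\<tau>^3 * V)" using n by (intro mult_right_mono y24) auto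
    finally have "M * y * (\<tau>^3 * V) \<le> (1/128) * (y^4 * (\<tau>^3 * V)) + (1/512 + 32 * M\<^sup>2) * (\<tau>^3 * V)" by (simp add: algebra_simps)
    also have "\<dots> \<le> (1/128) * (y^4 * (\<tau>^3 * V)) + (64 * M\<^sup>2) * (\<tau>^3 * V)" using n M2 by (intro add_left_mono mult_right_mono) auto
    also have "\<dots> \<le> (1/128) * (y^4 * (\<tau>^3 * V)) + (64 * M\<^sup>2) * (\<epsilon> * P2)" using tau3 by (intro add_left_mono mult_left_mono) auto
    finally show ?thesis by (simp add: P5_def power2_eq_square power3_eq_cube mult_ac)
  qed
  have c: "M * (y * \<tau>) * (y * \<tau>)\<^sup>2 * V \<le> P5 / 128 + 32 * (\<epsilon> * M\<^sup>2) * P6"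
  proof -
    have n: "0 \<le> y\<^sup>2 * \<tau>^3 * V" using \<tau> V by auto
    have "M * y * (y\<^sup>2 * \<tau>^3 * V) \<le> (1/128) * (y\<^sup>2 * (y\<^sup>2 * \<tau>^3 * V)) + 32 * M\<^sup>2 * (y\<^sup>2 * \<tau>^3 * V)" using n by (rule ymul)
    also have "32 * M\<^sup>2 * (y\<^sup>2 * \<tau>^3 * V) \<le> 32 * M\<^sup>2 * (\<epsilon> * P6)" using y2tau3 by (intro mult_left_mono) auto
    finally show ?thesis by (simp add: P5_def power2_eq_square power3_eq_cube power4_eq_xxxx mult_ac)
  qed
  have d: "y\<^sup>2 * \<tau> * \<tau>\<^sup>2 * V \<le> P5 / 128 + 32 * \<epsilon> * P2"
  proof -
    have n: "0 \<le> \<tau>^3 * V" using \<tau> V by auto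
    have "y\<^sup>2 * (\<tau>^3 * V) \<le> ((1/128) * y^4 + 1 / (4 * (1/128))) * (\<tau>^3 * V)" using n by (intro mult_right_mono y24) auto
    also have "\<dots> = (1/128) * y^4 * (\<tau>^3 * V) + 32 * (\<tau>^3 * V)" by (simp add: algebra_simps)
    also have "\<dots> \<le> (1/128) * y^4 * (\<tau>^3 * V) + 32 * (\<epsilon> * P2)" using tau3 by (intro add_left_mono mult_left_mono) auto
    finally show ?thesis by (simp add: P5_def power2_eq_square power3_eq_cube mult_ac)
  qed
  \<comment> \<open>The cross term costs a quarter of \<open>P1\<close> and, through the second
    summand of m, \<open>30 * e0\<^sup>2 * P2\<close>, which has no factor \<epsilon>. Together with
    \<open>e0 * P2\<close> from the potential this has to fit into \<open>p0 * P2\<close>, whence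
    the coefficient p0 / 32 in m.\<close>
  have e: "\<bar>m * v * S\<bar> \<le> P1 / 4 + 30 * \<epsilon> * P5 + 30 * e0\<^sup>2 * P2"
  proof -
    have "\<bar>m * v * S\<bar> \<le> t * S\<^sup>2 / 4 + m\<^sup>2 * v\<^sup>2 / t"
      using young[of "t/4" "\<bar>S\<bar>" "\<bar>m * v\<bar>"] t by (simp add: abs_mult power_mult_distrib mult_ac)
    also have "m\<^sup>2 * v\<^sup>2 / t = m\<^sup>2 * V * t" unfolding V(1) using t by (simp add: power2_eq_square)
    also have "\<dots> \<le> m\<^sup>2 * V * \<tau>\<^sup>2" using t V by (intro mult_left_mono) auto
    also have "\<dots> \<le> (2 * (y\<^sup>2 * \<tau>)\<^sup>2 + 2 * (e0 * \<theta>)\<^sup>2) * V * \<tau>\<^sup>2"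
    proof -
      have "m\<^sup>2 \<le> 2 * (y\<^sup>2 * \<tau>)\<^sup>2 + 2 * (e0 * \<theta>)\<^sup>2" unfolding m(1)
        using sum_squares_bound[of "y\<^sup>2 * \<tau>" "e0 * \<theta>"] by (simp add: power2_sum)
      then show ?thesis using V by (intro mult_right_mono) auto
    qed
    also have "\<dots> = 2 * \<tau> * P5 + 2 * e0\<^sup>2 * \<theta> * P2"
      by (simp add: P5_def P2_def power2_eq_square power3_eq_cube power4_eq_xxxx algebra_simps)
    also have "\<dots> \<le> 2 * (15 * \<epsilon>) * P5 + 2 * e0\<^sup>2 * 15 * P2"
      using \<tau>15 \<theta> P0 by (intro add_mono mult_right_mono mult_left_mono) auto
    finally show ?thesis by (simp add: P1_def)
  qed
  have vt3: "v\<^sup>2 / \<tau> \<le> \<tau>^3 * V"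
    proof -
      have "t\<^sup>2 \<le> (\<tau>\<^sup>2)\<^sup>2" using t by (intro power_mono) auto
      then have "V * t\<^sup>2 \<le> V * (\<tau>\<^sup>2)\<^sup>2" using V by (intro mult_left_mono) auto
      then have "V * t\<^sup>2 / \<tau> \<le> V * (\<tau>\<^sup>2)\<^sup>2 / \<tau>" using \<tau> by (intro divide_right_mono) auto
      also have "\<dots> = \<tau>^3 * V" using \<tau> by (simp add: power2_eq_square power3_eq_cube)
      finally show ?thesis by (simp add: V)
    qed
  have f1: "\<bar>v * Z\<bar> \<le> P3 / 16 + 4 * (\<epsilon> * M\<^sup>2) * P2"
  proof -
    have "\<bar>v * Z\<bar> \<le> \<bar>v\<bar> * (M * y * \<gamma>)" unfolding abs_mult using Z by (intro mult_left_mono) auto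
    also have "\<dots> = (y * \<gamma>) * (M * \<bar>v\<bar>)" by simp
    also have "\<dots> \<le> (\<tau> / 16) * (y * \<gamma>)\<^sup>2 + (M * \<bar>v\<bar>)\<^sup>2 / (4 * (\<tau> / 16))" using \<tau> by (intro young) auto
    also have "\<dots> = P3 / 16 + 4 * M\<^sup>2 * (v\<^sup>2 / \<tau>)" using \<tau> by (simp add: P3_def power2_eq_square field_simps)
    also have "\<dots> \<le> P3 / 16 + 4 * M\<^sup>2 * (\<epsilon> * P2)"
      using order.trans[OF vt3 tau3] by (intro add_left_mono mult_left_mono) auto
    finally have "\<bar>v * Z\<bar> \<le> P3 / 16 + 4 * M\<^sup>2 * (\<epsilon> * P2)" .
    then show ?thesis by (simp add: mult_ac)
  qed
  have mq: "m * q * v\<^sup>2 \<le> y\<^sup>2 * \<tau> * \<tau>\<^sup>2 * V - P5 / 32 + e0 * P2 - e0 * P6 / 32"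
  proof -
    have "m * (q * v\<^sup>2) \<le> m * ((\<tau>\<^sup>2 - (y * \<tau>)\<^sup>2 / 32) * V)" using m q by (intro mult_left_mono) auto
    also have "\<dots> = y\<^sup>2 * \<tau> * \<tau>\<^sup>2 * V - P5 / 32 + e0 * P2 - e0 * P6 / 32"
      unfolding m(1) P5_def P2_def P6_def by (simp add: power2_eq_square power3_eq_cube power4_eq_xxxx algebra_simps)
    finally show ?thesis by (simp add: mult.assoc)
  qed
  have mS: "(P3 + e0 * P4) / 2 \<le> m * S1"
  proof -
    have "m * (\<gamma>\<^sup>2 / 2) \<le> m * S1" using m S1 by (intro mult_left_mono) auto
    then show ?thesis by (simp add: m(1) P3_def P4_def algebra_simps)
  qed
  have II': "(P3 + e0 * P4) / 2 + P5 / 32 + e0 * P6 / 32 \<le> D2 + P1 / 4 + 30 * \<epsilon> * P5 + 30 * e0\<^sup>2 * P2 + P5 / 128 + 32 * \<epsilon> * P2 + e0 * P2 + P3 / 16 + 4 * (\<epsilon> * M\<^sup>2) * P2"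
    using II e f1 mq mS d by linarith
  have I': "P1 + p0 * P2 \<le> t * F\<^sup>2 + dtE - D1 + (P3 / 128 + 32 * (\<epsilon> * M\<^sup>2) * P4) + (P5 / 128 + 64 * (\<epsilon> * M\<^sup>2) * P2) + (P5 / 128 + 32 * (\<epsilon> * M\<^sup>2) * P6)"
  proof -
    \<comment> \<open>Squaring F = S + w/t produces the cross term 2 S w of the Rellich identity
      with coefficient exactly 1; the remaining square w^2/t is dropped.\<close>
    have "t * F\<^sup>2 = t * S\<^sup>2 + 2 * S * w + w\<^sup>2 / t" using t by (simp add: F power2_eq_square field_simps)
    then have "t * F\<^sup>2 \<ge> P1 + 2 * S * w" using t by (simp add: P1_def)
    moreover have "p0 * P2 \<le> p * P2" using p P0 by (intro mult_right_mono) auto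
    moreover have "M * (y * \<tau>) * (\<tau>\<^sup>2 + (y * \<tau>)\<^sup>2) * V = M * (y * \<tau>) * \<tau>\<^sup>2 * V + M * (y * \<tau>) * (y * \<tau>)\<^sup>2 * V"
      by (simp add: algebra_simps)
    ultimately show ?thesis using I R1 R2 a b c unfolding P2_def by linarith
  qed
  have tP6: "(y * \<tau>)\<^sup>2 * V * t \<le> 15 * \<epsilon> * P6"
  proof -
    have "(y * \<tau>)\<^sup>2 * V * t \<le> (y * \<tau>)\<^sup>2 * V * (15 * \<epsilon> * \<theta>)" using t2 V by (intro mult_left_mono) auto
    then show ?thesis by (simp add: P6_def power_mult_distrib mult_ac)
  qed
  have R': "t * (R * v)\<^sup>2 \<le> 15 * (\<epsilon> * M\<^sup>2) * P6"
  proof -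
    have "M\<^sup>2 * ((y * \<tau>)\<^sup>2 * V * t) \<le> M\<^sup>2 * (15 * \<epsilon> * P6)" using tP6 by (intro mult_left_mono) auto
    then show ?thesis using R by (simp add: mult_ac)
  qed
  have tg2: "t * \<gamma>\<^sup>2 \<le> 15 * \<epsilon> * P4"
    using mult_right_mono[OF t2(1), of "\<gamma>\<^sup>2"] by (simp add: P4_def mult_ac)
  have ttg: "t\<^sup>2 * \<gamma>\<^sup>2 \<le> 15 * \<epsilon> * P4"
    using mult_right_mono[OF tt, of "\<gamma>\<^sup>2"] tg2 by simp
  have vt: "V * t\<^sup>2 \<le> 15 * \<epsilon> * P2"
  proof -
    have "V * (t * t) \<le> V * ((15 * \<epsilon> * \<theta>) * \<tau>\<^sup>2)" using t t2 V \<epsilon> \<theta> by (intro mult_left_mono mult_mono) auto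
    then show ?thesis by (simp add: P2_def power2_eq_square mult_ac)
  qed
  have y4: "(y * \<tau>)^4 * V \<le> 15 * \<epsilon> * P5"
  proof -
    have "(y * \<tau>)^4 * V = \<tau> * P5" by (simp add: P5_def power4_eq_xxxx power3_eq_cube)
    also have "\<dots> \<le> 15 * \<epsilon> * P5" using \<tau>15 P0 by (intro mult_right_mono) auto
    finally show ?thesis .
  qed
  have y2g: "(y * \<tau>)\<^sup>2 * \<gamma>\<^sup>2 \<le> 15 * \<epsilon> * P3"
  proof -
    have "(y * \<tau>)\<^sup>2 * \<gamma>\<^sup>2 = \<tau> * P3" by (simp add: P3_def power2_eq_square)
    also have "\<dots> \<le> 15 * \<epsilon> * P3" using \<tau>15 P0 by (intro mult_right_mono) auto
    finally show ?thesis .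
  qed
  have q2: "t\<^sup>2 * (q\<^sup>2 * v\<^sup>2) \<le> 30 * \<epsilon> * P2 + 30 * \<epsilon> * P5"
  proof -
    have "t\<^sup>2 * (q\<^sup>2 * v\<^sup>2) \<le> 2 * (\<tau>^4 + (y * \<tau>)^4) * V" using q(2) by (simp add: mult_ac)
    also have "\<dots> = 2 * (\<tau>^4 * V) + 2 * ((y * \<tau>)^4 * V)" by (simp add: algebra_simps)
    also have "\<tau>^4 * V \<le> 15 * \<epsilon> * P2"
    proof -
      have "\<tau>^4 * V = \<tau>\<^sup>2 * (\<tau>\<^sup>2 * V)" by (simp add: power4_eq_xxxx power2_eq_square)
      also have "\<dots> \<le> (15 * \<epsilon> * \<theta>) * (\<tau>\<^sup>2 * V)" using \<tau>2 V by (intro mult_right_mono) auto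
      finally show ?thesis by (simp add: P2_def mult_ac)
    qed
    also note y4
    finally show ?thesis by simp
  qed
  \<comment> \<open>The second derivatives are controlled only by a multiple of S, so their
    contribution competes with \<open>P1\<close> itself. It is harmless because g^-1 - h is O(sqrt
    t): this leaves one more factor t, at most 225 \<epsilon>.\<close>
  have s2: "t\<^sup>2 * S\<^sup>2 \<le> 225 * \<epsilon> * P1"
  proof -
    have "t\<^sup>2 * S\<^sup>2 = t * P1" by (simp add: P1_def power2_eq_square)
    also have "\<dots> \<le> 225 * \<epsilon> * P1" using t2 P0 by (intro mult_right_mono) auto
    finally show ?thesis .
  qed
  have H': "t\<^sup>2 * H \<le> M * (225 * \<epsilon> * P1 + 30 * \<epsilon> * P2 + 30 * \<epsilon> * P5 + 15 * \<epsilon> * P4) + 2 * t\<^sup>2 * D3"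
  proof -
    have "t\<^sup>2 * H \<le> t\<^sup>2 * (M * (S\<^sup>2 + q\<^sup>2 * v\<^sup>2 + \<gamma>\<^sup>2) + 2 * D3)" using H by (intro mult_left_mono) auto
    also have "\<dots> = M * (t\<^sup>2 * S\<^sup>2 + t\<^sup>2 * (q\<^sup>2 * v\<^sup>2) + t\<^sup>2 * \<gamma>\<^sup>2) + 2 * t\<^sup>2 * D3" by (simp add: algebra_simps)
    also have "\<dots> \<le> M * (225 * \<epsilon> * P1 + (30 * \<epsilon> * P2 + 30 * \<epsilon> * P5) + 15 * \<epsilon> * P4) + 2 * t\<^sup>2 * D3"
      using M s2 q2 ttg by (intro add_right_mono mult_left_mono add_mono) auto
    finally show ?thesis by (simp only: add.assoc)
  qed
  define W where "W = P1 + P2 + P3 + P4 + P5 + P6"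
  have W0: "0 \<le> W" using P0 by (simp add: W_def)
  have er': "t * er\<^sup>2 \<le> 300 * (\<epsilon> * M\<^sup>2) * W + 2 * M * t\<^sup>2 * D3"
  proof -
    have "t\<^sup>2 * H \<le> M * (225 * \<epsilon> * W) + 2 * t\<^sup>2 * D3"
    proof -
      have "225 * \<epsilon> * P1 + 30 * \<epsilon> * P2 + 30 * \<epsilon> * P5 + 15 * \<epsilon> * P4 \<le> 225 * \<epsilon> * W"
        using P0 \<epsilon> unfolding W_def by (simp add: distrib_left mult_nonneg_nonneg add_increasing add_mono)
      then have "M * (225 * \<epsilon> * P1 + 30 * \<epsilon> * P2 + 30 * \<epsilon> * P5 + 15 * \<epsilon> * P4) \<le> M * (225 * \<epsilon> * W)" using M by (intro mult_left_mono) auto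
      then show ?thesis using H' by linarith
    qed
    moreover have "(y * \<tau>)\<^sup>2 * \<gamma>\<^sup>2 + V * t\<^sup>2 + (y * \<tau>)^4 * V + t * \<gamma>\<^sup>2 + (y * \<tau>)\<^sup>2 * V * t \<le> 15 * \<epsilon> * W"
    proof -
      have "15 * \<epsilon> * W = 15 * \<epsilon> * P1 + 15 * \<epsilon> * P2 + 15 * \<epsilon> * P3 + 15 * \<epsilon> * P4 + 15 * \<epsilon> * P5 + 15 * \<epsilon> * P6"
        by (simp add: W_def algebra_simps)
      moreover have "0 \<le> 15 * \<epsilon> * P1" using \<epsilon> P0 by auto
      ultimately show ?thesis using y2g vt y4 tg2 tP6 by linarith
    qed
    ultimately have "t\<^sup>2 * H + (y * \<tau>)\<^sup>2 * \<gamma>\<^sup>2 + V * t\<^sup>2 + (y * \<tau>)^4 * V + t * \<gamma>\<^sup>2 + (y * \<tau>)\<^sup>2 * V * t \<le> M * (225 * \<epsilon> * W) + 2 * t\<^sup>2 * D3 + 15 * \<epsilon> * W"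
      by linarith
    also have "15 * \<epsilon> * W \<le> M * (75 * \<epsilon> * W)"
    proof -
      have "1 * (15 * \<epsilon> * W) \<le> M * (75 * \<epsilon> * W)" using M \<epsilon> W0 by (intro mult_mono) auto
      then show ?thesis by simp
    qed
    finally have "M * (t\<^sup>2 * H + (y * \<tau>)\<^sup>2 * \<gamma>\<^sup>2 + V * t\<^sup>2 + (y * \<tau>)^4 * V + t * \<gamma>\<^sup>2 + (y * \<tau>)\<^sup>2 * V * t) \<le> M * (M * (225 * \<epsilon> * W) + 2 * t\<^sup>2 * D3 + M * (75 * \<epsilon> * W))"
      using M by (intro mult_left_mono) auto
    then show ?thesis using er by (simp add: algebra_simps power2_eq_square)
  qed
  have tF: "t * F\<^sup>2 \<le> 3 * t * f\<^sup>2 + 945 * (\<epsilon> * M\<^sup>2) * W + 6 * M * t\<^sup>2 * D3"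
  proof -
    have "F\<^sup>2 \<le> 3 * f\<^sup>2 + 3 * (R * v)\<^sup>2 + 3 * er\<^sup>2" unfolding FF
      using sum_squares_bound[of f "-(R * v)"] sum_squares_bound[of f "-er"] sum_squares_bound[of "R * v" er]
      by (simp add: power2_eq_square algebra_simps)
    then have "t * F\<^sup>2 \<le> t * (3 * f\<^sup>2 + 3 * (R * v)\<^sup>2 + 3 * er\<^sup>2)" using t by (intro mult_left_mono) auto
    also have "\<dots> = 3 * t * f\<^sup>2 + 3 * (t * (R * v)\<^sup>2) + 3 * (t * er\<^sup>2)" by (simp add: algebra_simps)
    also have "t * (R * v)\<^sup>2 \<le> 15 * (\<epsilon> * M\<^sup>2) * W"
    proof -
      have "15 * (\<epsilon> * M\<^sup>2) * P6 \<le> 15 * (\<epsilon> * M\<^sup>2) * W" using P0 \<epsilon> by (intro mult_left_mono) (auto simp: W_def)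
      then show ?thesis using R' by linarith
    qed
    also note er'
    finally show ?thesis by (simp add: mult_ac)
  qed
  \<comment> \<open>The sum of \<open>I'\<close> and \<open>II'\<close>. \<open>P1\<close> keeps 1 -
    1/4 and \<open>P5\<close> keeps 1/32 - 3/128 = 1/128; terms with a factor \<epsilon> are
    collected in the multiple of W.\<close>
  have big: "P1 / 4 * 3 + (p0 - e0 - 30 * e0\<^sup>2) * P2 + (1/2 - 1/16 - 1/128) * P3 + e0 / 2 * P4 + P5 / 128 + e0 / 32 * P6
     \<le> 3 * t * f\<^sup>2 + dtE - D1 + D2 + 6 * M * t\<^sup>2 * D3 + 2000 * (\<epsilon> * M\<^sup>2) * W"
  proof -
    have i: "\<epsilon> \<le> \<epsilon> * M\<^sup>2" using M2 \<epsilon> by (simp add: mult_le_cancel_left1)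
    have "30 * \<epsilon> * P5 \<le> 30 * (\<epsilon> * M\<^sup>2) * P5" "32 * \<epsilon> * P2 \<le> 32 * (\<epsilon> * M\<^sup>2) * P2"
      using i P0 by (intro mult_right_mono mult_left_mono; simp)+
    moreover have "100 * (\<epsilon> * M\<^sup>2) * W = 100 * ((\<epsilon> * M\<^sup>2) * P1 + (\<epsilon> * M\<^sup>2) * P2 + (\<epsilon> * M\<^sup>2) * P3 + (\<epsilon> * M\<^sup>2) * P4 + (\<epsilon> * M\<^sup>2) * P5 + (\<epsilon> * M\<^sup>2) * P6)"
      by (simp add: W_def algebra_simps)
    moreover have "0 \<le> (\<epsilon> * M\<^sup>2) * P1" "0 \<le> (\<epsilon> * M\<^sup>2) * P2" "0 \<le> (\<epsilon> * M\<^sup>2) * P3" "0 \<le> (\<epsilon> * M\<^sup>2) * P4" "0 \<le> (\<epsilon> * M\<^sup>2) * P5" "0 \<le> (\<epsilon> * M\<^sup>2) * P6"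
      using \<epsilon> P0 by auto
    moreover have "945 * (\<epsilon> * M\<^sup>2) * W + 100 * (\<epsilon> * M\<^sup>2) * W \<le> 2000 * (\<epsilon> * M\<^sup>2) * W" using W0 \<epsilon> by (simp add: mult_nonneg_nonneg)
    moreover have "(p0 - e0 - 30 * e0\<^sup>2) * P2 = p0 * P2 - e0 * P2 - 30 * e0\<^sup>2 * P2" by (simp add: algebra_simps)
    ultimately show ?thesis using tF I' II' by (simp only: distrib_left) argo
  qed
  \<comment> \<open>The power \<open>10^7\<close> in the hypothesis is chosen for this step: 2000 /
    10^7 = 1/5000 is below 1/4096, and each of the six coefficients on the left is at least p0 /
    4096. For \<open>P2\<close>, \<open>P4\<close> and \<open>P6\<close> even p0 / 2048 is
    available, so p0 / 4096 survives.\<close>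
  have small: "2000 * (\<epsilon> * M\<^sup>2) * W \<le> (p0 / 4096) * W"
    using \<epsilon>1 W0 p0 by (intro mult_right_mono) (auto)
  have c2: "p0 / 2048 * P2 \<le> (p0 - e0 - 30 * e0\<^sup>2) * P2"
  proof (rule mult_right_mono)
    have "p0\<^sup>2 \<le> p0" using p0 by (simp add: power2_eq_square mult_left_le)
    then show "p0 / 2048 \<le> p0 - e0 - 30 * e0\<^sup>2" using p0 by (simp add: e0_def power_divide)
  qed (use P0 in auto)
  have c: "p0 / 4096 * P1 \<le> P1 / 4 * 3" "p0 / 4096 * P3 \<le> (1/2 - 1/16 - 1/128) * P3" "p0 / 4096 * P5 \<le> P5 / 128"
    using mult_right_mono[of "p0 / 4096" "3/4" P1] mult_right_mono[of "p0 / 4096" "1/2 - 1/16 - 1/128" P3] mult_right_mono[of "p0 / 4096" "1/128" P5] p0 P0 by auto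
  have c4: "p0 / 2048 * P4 \<le> e0 / 2 * P4" using p0 P0 by (intro mult_right_mono) (auto simp: e0_def)
  have c6: "p0 / 2048 * P6 \<le> e0 / 32 * P6" using p0 P0 by (intro mult_right_mono) (auto simp: e0_def)
  have "p0 / 4096 * W = p0 / 4096 * P1 + p0 / 4096 * P2 + p0 / 4096 * P3 + p0 / 4096 * P4 + p0 / 4096 * P5 + p0 / 4096 * P6"
    by (simp add: W_def algebra_simps)
  then have "p0 / 4096 * P2 + p0 / 4096 * P4 + p0 / 4096 * P6 \<le> 3 * t * f\<^sup>2 + dtE - D1 + D2 + 6 * M * t\<^sup>2 * D3"
    using big small c2 c c4 c6 by linarith
  then show ?thesis by (simp add: P2_def P4_def P6_def power_mult_distrib algebra_simps)
qed

section \<open>Algebra of the Rellich identity and of the conjugation\<close>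

lemma sum_form_swap:
  fixes h :: "'n::finite \<Rightarrow> 'n \<Rightarrow> real"
  assumes "\<And>i j. h i j = h j i"
  shows "(\<Sum>i\<in>UNIV. (\<Sum>j\<in>UNIV. h i j * a j) * c i) = (\<Sum>i\<in>UNIV. (\<Sum>j\<in>UNIV. h i j * c j) * a i)"
proof -
  have "(\<Sum>i\<in>UNIV. (\<Sum>j\<in>UNIV. h i j * a j) * c i) = (\<Sum>i\<in>UNIV. \<Sum>j\<in>UNIV. h i j * a j * c i)"
    by (simp add: sum_distrib_right)
  also have "\<dots> = (\<Sum>j\<in>UNIV. \<Sum>i\<in>UNIV. h i j * a j * c i)" by (rule sum.swap)
  also have "\<dots> = (\<Sum>j\<in>UNIV. \<Sum>i\<in>UNIV. h j i * c i * a j)" by (intro sum.cong refl) (simp add: assms mult_ac)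
  finally show ?thesis by (simp add: sum_distrib_right)
qed

text \<open>The identity behind the commutator of \<open>S\<close> and \<open>w\<close> at one point: \<open>dN k i\<close>, \<open>dB k i\<close>, \<open>dQ k\<close>, \<open>dw k\<close> are the values of
  \<open>\<partial>\<^sub>k\<close> of \<open>N i\<close>, \<open>B i\<close>, \<open>Q\<close>, \<open>w\<close>; \<open>D1\<close> is a divergence and \<open>dtE\<close> the time derivative of \<open>t Q\<close>.\<close>

lemma rellich_algebra:
  fixes h A dB :: "'n::finite \<Rightarrow> 'n \<Rightarrow> real" and g gt B N dw dq dQ :: "'n \<Rightarrow> real"
  assumes h_sym: "\<And>i j. h i j = h j i" and A_sym: "\<And>i j. A i j = A j i"
    and N: "\<And>i. N i = (\<Sum>j\<in>UNIV. h i j * g j)"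
    and dN: "\<And>k i. dN k i = (\<Sum>j\<in>UNIV. dh k i j * g j + h i j * A j k)"
    and w: "w = t * vt + (\<Sum>k\<in>UNIV. B k * g k) + c * v"
    and dw: "\<And>i. dw i = t * gt i + (\<Sum>k\<in>UNIV. dB i k * g k + B k * A k i) + c * g i"
    and Q: "Q = (\<Sum>i\<in>UNIV. N i * g i) - q * v\<^sup>2"
    and dQ: "\<And>k. dQ k = (\<Sum>i\<in>UNIV. dN k i * g i + N i * A i k) - (dq k * v\<^sup>2 + q * (2 * v * g k))"
    and dtE: "dtE = Q + t * ((\<Sum>i\<in>UNIV. (\<Sum>j\<in>UNIV. h i j * gt j) * g i + N i * gt i) - (qt * v\<^sup>2 + q * (2 * v * vt)))"
    and D1: "D1 = (\<Sum>i\<in>UNIV. 2 * (dN i i * w + N i * dw i) - (dB i i * Q + B i * dQ i))"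
    and R1: "R1 = (\<Sum>i\<in>UNIV. N i * g i) - 2 * (\<Sum>i\<in>UNIV. N i * (\<Sum>k\<in>UNIV. dB i k * g k))
      + (\<Sum>k\<in>UNIV. B k * (\<Sum>i\<in>UNIV. (\<Sum>j\<in>UNIV. dh k i j * g j) * g i)) + ((\<Sum>i\<in>UNIV. dB i i) - 2 * c) * (\<Sum>i\<in>UNIV. N i * g i)"
    and R2: "R2 = - (q + t * qt) - (\<Sum>k\<in>UNIV. B k * dq k) - ((\<Sum>i\<in>UNIV. dB i i) - 2 * c) * q"
  shows "2 * ((\<Sum>i\<in>UNIV. dN i i) + q * v) * w = D1 - dtE + R1 + R2 * v\<^sup>2"
proof -
  define L where "L = (\<Sum>i\<in>UNIV. dN i i)"
  define S1 where "S1 = (\<Sum>i\<in>UNIV. N i * g i)"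
  define Sg where "Sg = (\<Sum>i\<in>UNIV. N i * gt i)"
  define Bg where "Bg = (\<Sum>k\<in>UNIV. B k * g k)"
  define NB where "NB = (\<Sum>i\<in>UNIV. N i * (\<Sum>k\<in>UNIV. dB i k * g k))"
  define NA where "NA = (\<Sum>i\<in>UNIV. N i * (\<Sum>k\<in>UNIV. B k * A k i))"
  define BC where "BC = (\<Sum>k\<in>UNIV. B k * (\<Sum>i\<in>UNIV. (\<Sum>j\<in>UNIV. dh k i j * g j) * g i))"
  define Bq where "Bq = (\<Sum>k\<in>UNIV. B k * dq k)"
  define DB where "DB = (\<Sum>i\<in>UNIV. dB i i)"
  have dNg: "(\<Sum>i\<in>UNIV. dN k i * g i) = (\<Sum>i\<in>UNIV. (\<Sum>j\<in>UNIV. dh k i j * g j) * g i) + (\<Sum>i\<in>UNIV. N i * A i k)" for k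
  proof -
    have "(\<Sum>i\<in>UNIV. dN k i * g i) = (\<Sum>i\<in>UNIV. (\<Sum>j\<in>UNIV. dh k i j * g j) * g i) + (\<Sum>i\<in>UNIV. (\<Sum>j\<in>UNIV. h i j * A j k) * g i)"
      by (simp add: dN sum.distrib distrib_right)
    also have "(\<Sum>i\<in>UNIV. (\<Sum>j\<in>UNIV. h i j * A j k) * g i) = (\<Sum>i\<in>UNIV. N i * A i k)"
      unfolding N by (rule sum_form_swap[OF h_sym])
    finally show ?thesis .
  qed
  have gt: "(\<Sum>i\<in>UNIV. (\<Sum>j\<in>UNIV. h i j * gt j) * g i) = Sg"
    unfolding Sg_def N by (rule sum_form_swap[OF h_sym])
  have Ndw: "(\<Sum>i\<in>UNIV. N i * dw i) = t * Sg + NB + NA + c * S1"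
    unfolding dw Sg_def NB_def NA_def S1_def by (simp add: distrib_left sum.distrib sum_distrib_left mult_ac)
  have BNA: "(\<Sum>k\<in>UNIV. B k * (\<Sum>i\<in>UNIV. N i * A i k)) = NA"
  proof -
    have "(\<Sum>k\<in>UNIV. B k * (\<Sum>i\<in>UNIV. N i * A i k)) = (\<Sum>k\<in>UNIV. \<Sum>i\<in>UNIV. B k * (N i * A i k))"
      by (simp add: sum_distrib_left)
    also have "\<dots> = (\<Sum>i\<in>UNIV. \<Sum>k\<in>UNIV. B k * (N i * A i k))" by (rule sum.swap)
    also have "\<dots> = NA" unfolding NA_def
      by (simp add: sum_distrib_left) (intro sum.cong refl, simp add: A_sym mult_ac)
    finally show ?thesis .
  qed
  have BdQ: "(\<Sum>k\<in>UNIV. B k * dQ k) = BC + 2 * NA - v\<^sup>2 * Bq - 2 * q * v * Bg"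
  proof -
    have "dQ k = (\<Sum>i\<in>UNIV. (\<Sum>j\<in>UNIV. dh k i j * g j) * g i) + 2 * (\<Sum>i\<in>UNIV. N i * A i k) - v\<^sup>2 * dq k - 2 * q * v * g k" for k
      unfolding dQ sum.distrib dNg by (simp add: algebra_simps)
    then have "(\<Sum>k\<in>UNIV. B k * dQ k) = (\<Sum>k\<in>UNIV. B k * (\<Sum>i\<in>UNIV. (\<Sum>j\<in>UNIV. dh k i j * g j) * g i)
       + 2 * (B k * (\<Sum>i\<in>UNIV. N i * A i k)) - v\<^sup>2 * (B k * dq k) - 2 * q * v * (B k * g k))"
      by (intro sum.cong refl) (simp only: right_diff_distrib distrib_left, simp)
    also have "\<dots> = BC + 2 * (\<Sum>k\<in>UNIV. B k * (\<Sum>i\<in>UNIV. N i * A i k)) - v\<^sup>2 * Bq - 2 * q * v * Bg"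
      unfolding sum.distrib sum_subtractf BC_def Bq_def Bg_def by (simp only: sum_distrib_left[symmetric])
    finally show ?thesis unfolding BNA .
  qed
  \<comment> \<open>The second derivatives of v outside L enter once through dw and once through dQ,
    each time as 2 \<open>NA\<close>, with opposite signs. Likewise the 2 t \<open>Sg\<close> here
    cancels against \<open>dtE\<close>, so only terms quadratic in v and \<nabla>v survive.\<close>
  have D1': "D1 = 2 * L * w + 2 * (t * Sg + NB + NA + c * S1) - DB * Q - (BC + 2 * NA - v\<^sup>2 * Bq - 2 * q * v * Bg)"
  proof -
    have "D1 = 2 * (\<Sum>i\<in>UNIV. dN i i) * w + 2 * (\<Sum>i\<in>UNIV. N i * dw i) - (\<Sum>i\<in>UNIV. dB i i) * Q - (\<Sum>k\<in>UNIV. B k * dQ k)"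
      unfolding D1 sum_subtractf sum.distrib by (simp add: sum_distrib_left sum_distrib_right sum.distrib algebra_simps)
    then show ?thesis unfolding Ndw BdQ L_def DB_def .
  qed
  have dtE': "dtE = Q + t * (2 * Sg - (qt * v\<^sup>2 + q * (2 * v * vt)))"
    unfolding dtE sum.distrib gt Sg_def[symmetric] by simp
  have R1': "R1 = S1 - 2 * NB + BC + (DB - 2 * c) * S1" unfolding R1 S1_def NB_def BC_def DB_def ..
  have R2': "R2 = - (q + t * qt) - Bq - (DB - 2 * c) * q" unfolding R2 Bq_def DB_def ..
  have Q': "Q = S1 - q * v\<^sup>2" unfolding Q S1_def ..
  have w': "w = t * vt + Bg + c * v" unfolding w Bg_def ..
  show ?thesis unfolding L_def[symmetric] D1' dtE' R1' R2' Q'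
    by (simp add: w' algebra_simps power2_eq_square)
qed

text \<open>With v = weight * u, the quantities \<open>U\<close>, \<open>U2\<close> and
  \<open>Ut\<close> are the weight times derivatives of u, so the left side is the weighted frozen
  operator. The squared gradient of the Gaussian phase and the time derivative of the weight form q;
  the first order cross terms and vt form w/t. The remainder R is half of (div B - 2c)/t and
  vanishes for the identity metric with c = n/4.\<close>

lemma conjugation_algebra:
  fixes h A dB :: "'n::finite \<Rightarrow> 'n \<Rightarrow> real" and x g B :: "'n \<Rightarrow> real"
  assumes h_sym: "\<And>i j. h i j = h j i" and t: "t \<noteq> 0"
    and dN: "\<And>k i. dN k i = (\<Sum>j\<in>UNIV. dh k i j * g j + h i j * A j k)" and A_sym: "\<And>i j. A i j = A j i"
    and B: "\<And>i. B i = (\<Sum>j\<in>UNIV. h i j * x j) / 2"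
    and dB: "\<And>k i. dB k i = (\<Sum>j\<in>UNIV. dh k i j * x j) / 2 + h i k / 2"
    and w: "w = t * vt + (\<Sum>k\<in>UNIV. B k * g k) + c * v"
    and q: "q = b * p / t + ((\<Sum>i\<in>UNIV. (\<Sum>j\<in>UNIV. h i j * x j) * x i) - 2 * (\<Sum>i\<in>UNIV. (x i)\<^sup>2)) / 16 / t\<^sup>2"
    and U: "\<And>j. U j = g j + x j / (4 * t) * v"
    and U2: "\<And>i j. U2 i j = A i j + (x i * g j + x j * g i) / (4 * t) + ((if i = j then 1 else 0) / (4 * t) + x i * x j / (16 * t\<^sup>2)) * v"
    and Ut: "Ut = vt + (b * p / t - (\<Sum>i\<in>UNIV. (x i)\<^sup>2) / (8 * t\<^sup>2)) * v"
    and R: "R = ((\<Sum>i\<in>UNIV. dB i i) - 2 * c) / (2 * t)"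
  shows "(\<Sum>i\<in>UNIV. \<Sum>j\<in>UNIV. dh i i j * U j + h i j * U2 i j) + Ut = ((\<Sum>i\<in>UNIV. dN i i) + q * v) + w / t + R * v"
proof -
  define X1 where "X1 = (\<Sum>i\<in>UNIV. \<Sum>j\<in>UNIV. dh i i j * g j)"
  define X2 where "X2 = (\<Sum>i\<in>UNIV. \<Sum>j\<in>UNIV. dh i i j * x j)"
  define X3 where "X3 = (\<Sum>i\<in>UNIV. \<Sum>j\<in>UNIV. h i j * A i j)"
  define X4 where "X4 = (\<Sum>i\<in>UNIV. (\<Sum>j\<in>UNIV. h i j * x j) * g i)"
  define X5 where "X5 = (\<Sum>i\<in>UNIV. h i i)"
  define X6 where "X6 = (\<Sum>i\<in>UNIV. (\<Sum>j\<in>UNIV. h i j * x j) * x i)"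
  define X7 where "X7 = (\<Sum>i\<in>UNIV. (x i)\<^sup>2)"
  have X4': "(\<Sum>i\<in>UNIV. \<Sum>j\<in>UNIV. h i j * (x j * g i)) = X4"
    unfolding X4_def by (simp add: sum_distrib_left sum_distrib_right mult_ac)
  have X4'': "(\<Sum>i\<in>UNIV. \<Sum>j\<in>UNIV. h i j * (x i * g j)) = X4"
    unfolding X4_def sum_form_swap[where h = h and a = x and c = g, OF h_sym] by (simp add: sum_distrib_left sum_distrib_right mult_ac)
  have X5': "(\<Sum>i\<in>UNIV. \<Sum>j\<in>UNIV. h i j * (if i = j then 1 else 0)) = X5"
    unfolding X5_def by (intro sum.cong refl) (simp add: if_distrib[of "\<lambda>z. _ * z"] cong: if_cong)
  have X6': "(\<Sum>i\<in>UNIV. \<Sum>j\<in>UNIV. h i j * (x i * x j)) = X6"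
    unfolding X6_def by (simp add: sum_distrib_left sum_distrib_right mult_ac)
  have "(\<Sum>i\<in>UNIV. \<Sum>j\<in>UNIV. dh i i j * U j + h i j * U2 i j)
     = (\<Sum>i\<in>UNIV. \<Sum>j\<in>UNIV. dh i i j * g j + (v / (4 * t)) * (dh i i j * x j) + h i j * A i j + (1 / (4 * t)) * (h i j * (x i * g j)) + (1 / (4 * t)) * (h i j * (x j * g i))
        + (v / (4 * t)) * (h i j * (if i = j then 1 else 0)) + (v / (16 * t\<^sup>2)) * (h i j * (x i * x j)))"
    using t by (intro sum.cong refl) (simp add: U U2 field_simps)
  also have "\<dots> = X1 + (v / (4 * t)) * X2 + X3 + (1 / (4 * t)) * X4 + (1 / (4 * t)) * X4 + (v / (4 * t)) * X5 + (v / (16 * t\<^sup>2)) * X6"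
    unfolding sum.distrib sum_distrib_left[symmetric] X4' X4'' X5' X6' unfolding X1_def X2_def X3_def ..
  finally have lhs: "(\<Sum>i\<in>UNIV. \<Sum>j\<in>UNIV. dh i i j * U j + h i j * U2 i j) = X1 + (v / (4 * t)) * X2 + X3 + (1 / (4 * t)) * X4 + (1 / (4 * t)) * X4 + (v / (4 * t)) * X5 + (v / (16 * t\<^sup>2)) * X6" .
  have L: "(\<Sum>i\<in>UNIV. dN i i) = X1 + X3"
    unfolding dN X1_def X3_def sum.distrib by (simp add: A_sym)
  have DB: "(\<Sum>i\<in>UNIV. dB i i) = X2 / 2 + X5 / 2"
    unfolding dB X2_def X5_def sum.distrib by (simp add: sum_divide_distrib)
  have w': "w = t * vt + X4 / 2 + c * v"
  proof -
    have "X4 / 2 = (\<Sum>i\<in>UNIV. (\<Sum>j\<in>UNIV. h i j * x j) * g i / 2)"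
      unfolding X4_def by (rule sum_divide_distrib)
    also have "\<dots> = (\<Sum>k\<in>UNIV. B k * g k)" by (intro sum.cong refl) (simp add: B)
    finally show ?thesis by (simp add: w)
  qed
  have q': "q = b * p / t + (X6 - 2 * X7) / 16 / t\<^sup>2" unfolding q X6_def X7_def ..
  have Ut': "Ut = vt + (b * p / t - X7 / (8 * t\<^sup>2)) * v" unfolding Ut X7_def ..
  show ?thesis unfolding lhs L q' w' R DB Ut' using t by (simp add: field_simps power2_eq_square)
qed

section \<open>The metric as a perturbation of the identity\<close>

lemma abs_sum_le_card:
  fixes f :: "'n::finite \<Rightarrow> real"
  assumes "\<And>i. \<bar>f i\<bar> \<le> c"
  shows "\<bar>\<Sum>i\<in>UNIV. f i\<bar> \<le> real CARD('n) * c"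
  by (rule order.trans[OF sum_abs]) (use sum_bounded_above[of UNIV "\<lambda>i. \<bar>f i\<bar>" c] assms in auto)

lemma sum_delta_form:
  fixes g :: "'n::finite \<Rightarrow> real"
  shows "(\<Sum>j\<in>UNIV. (if i = j then 1 else 0) * g j) = g i"
  by (simp add: if_distrib[of "\<lambda>z. z * _"] cong: if_cong)

text \<open>Each estimate perturbs the case where h is the identity, dh = 0 and B = x/2. There div B
  = n/2 = 2c, the four gradient terms cancel, and the quadratic form behind q is -|x|^2/16, for
  which Euler's relation with the field x/2 makes the fifth difference vanish. Each deviation has a
  factor a Y, and \<open>small\<close> keeps the relative error within 1/4.\<close>

lemma metric_bounds:
  fixes h dB :: "'n::finite \<Rightarrow> 'n \<Rightarrow> real" and x g B N :: "'n \<Rightarrow> real" and a Y \<gamma> c :: real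
  defines "n \<equiv> real CARD('n)"
  assumes x: "\<And>i. \<bar>x i\<bar> \<le> Y" "(\<Sum>i\<in>UNIV. (x i)\<^sup>2) = Y\<^sup>2" and g: "\<And>i. \<bar>g i\<bar> \<le> \<gamma>" "(\<Sum>i\<in>UNIV. (g i)\<^sup>2) = \<gamma>\<^sup>2"
    and a: "0 \<le> a" and h: "\<And>i j. \<bar>h i j - (if i = j then 1 else 0)\<bar> \<le> a * Y" and dh: "\<And>k i j. \<bar>dh k i j\<bar> \<le> a"
    and small: "n\<^sup>2 * (a * Y) \<le> 1 / 4"
    and N: "\<And>i. N i = (\<Sum>j\<in>UNIV. h i j * g j)"
    and B: "\<And>i. B i = (\<Sum>j\<in>UNIV. h i j * x j) / 2"
    and dB: "\<And>k i. dB k i = (\<Sum>j\<in>UNIV. dh k i j * x j) / 2 + h i k / 2"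
    and c: "c = n / 4"
  shows "\<gamma>\<^sup>2 / 2 \<le> (\<Sum>i\<in>UNIV. N i * g i)"
    and "\<bar>(\<Sum>i\<in>UNIV. dB i i) - 2 * c\<bar> \<le> n\<^sup>2 * a * Y"
    and "\<bar>(\<Sum>i\<in>UNIV. N i * g i) - 2 * (\<Sum>i\<in>UNIV. N i * (\<Sum>k\<in>UNIV. dB i k * g k))
      + (\<Sum>k\<in>UNIV. B k * (\<Sum>i\<in>UNIV. (\<Sum>j\<in>UNIV. dh k i j * g j) * g i)) + ((\<Sum>i\<in>UNIV. dB i i) - 2 * c) * (\<Sum>i\<in>UNIV. N i * g i)\<bar>
      \<le> 7 * n^3 * a * Y * \<gamma>\<^sup>2"
    and "\<bar>\<Sum>i\<in>UNIV. x i * N i\<bar> \<le> 2 * n * Y * \<gamma>"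
    and "\<bar>((\<Sum>i\<in>UNIV. (\<Sum>j\<in>UNIV. h i j * x j) * x i) - 2 * (\<Sum>i\<in>UNIV. (x i)\<^sup>2)) / 16
       - (\<Sum>k\<in>UNIV. B k * (((\<Sum>i\<in>UNIV. (\<Sum>j\<in>UNIV. dh k i j * x j) * x i) + 4 * B k - 4 * x k) / 16))\<bar> \<le> n^3 * a * Y^3 / 4"
    and "((\<Sum>i\<in>UNIV. (\<Sum>j\<in>UNIV. h i j * x j) * x i) - 2 * (\<Sum>i\<in>UNIV. (x i)\<^sup>2)) / 16 \<le> - Y\<^sup>2 / 32"
    and "- Y\<^sup>2 / 8 \<le> ((\<Sum>i\<in>UNIV. (\<Sum>j\<in>UNIV. h i j * x j) * x i) - 2 * (\<Sum>i\<in>UNIV. (x i)\<^sup>2)) / 16"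
proof -
  define e where "e = a * Y"
  have n1: "1 \<le> n" by (simp add: n_def Suc_leI)
  have Y0: "0 \<le> Y" and \<gamma>0: "0 \<le> \<gamma>" using x(1)[of undefined] g(1)[of undefined] by linarith+
  have e0: "0 \<le> e" using a Y0 by (simp add: e_def)
  have n2: "n \<le> n\<^sup>2" using n1 by (simp add: power2_eq_square)
  have n3: "n\<^sup>2 \<le> n^3" using n1 by (simp add: power2_eq_square power3_eq_cube)
  have ne2: "n\<^sup>2 * e \<le> 1/4" using small by (simp add: e_def)
  have "n * e \<le> n\<^sup>2 * e" using n2 e0 by (rule mult_right_mono)
  then have ne: "n * e \<le> 1/4" using ne2 by linarith
  have Ng: "\<bar>N i - g i\<bar> \<le> n * (e * \<gamma>)" for i
  proof -
    have "N i - g i = (\<Sum>j\<in>UNIV. (h i j - (if i = j then 1 else 0)) * g j)"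
      by (simp add: N left_diff_distrib sum_subtractf sum_delta_form)
    also have "\<bar>\<dots>\<bar> \<le> n * (e * \<gamma>)" unfolding n_def
      using h g(1) e0 by (intro abs_sum_le_card) (simp add: abs_mult e_def mult_mono)
    finally show ?thesis .
  qed
  have ne\<gamma>: "n * (e * \<gamma>) \<le> \<gamma> / 4" using mult_right_mono[OF ne \<gamma>0] by simp
  have Nb: "\<bar>N i\<bar> \<le> 2 * \<gamma>" for i using Ng[of i] g(1)[of i] ne\<gamma> \<gamma>0 by linarith
  define S1 where "S1 = (\<Sum>i\<in>UNIV. N i * g i)"
  have S1d: "\<bar>S1 - \<gamma>\<^sup>2\<bar> \<le> \<gamma>\<^sup>2 / 4"
  proof -
    have "S1 - \<gamma>\<^sup>2 = (\<Sum>i\<in>UNIV. (N i - g i) * g i)"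
      unfolding S1_def g(2)[symmetric] by (simp add: left_diff_distrib sum_subtractf power2_eq_square)
    also have "\<bar>\<dots>\<bar> \<le> n * ((n * (e * \<gamma>)) * \<gamma>)" unfolding n_def
      using Ng g(1) e0 \<gamma>0 by (intro abs_sum_le_card) (simp add: abs_mult n_def mult_mono)
    also have "\<dots> = (n\<^sup>2 * e) * \<gamma>\<^sup>2" by (simp add: power2_eq_square mult_ac)
    also have "\<dots> \<le> 1/4 * \<gamma>\<^sup>2" using ne2 by (intro mult_right_mono) auto
    finally show ?thesis by simp
  qed
  show "\<gamma>\<^sup>2 / 2 \<le> (\<Sum>i\<in>UNIV. N i * g i)" using S1d zero_le_power2[of \<gamma>] unfolding S1_def[symmetric] by linarith
  have S1b: "\<bar>S1\<bar> \<le> 2 * \<gamma>\<^sup>2" using S1d zero_le_power2[of \<gamma>] by linarith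
  define \<beta> where "\<beta> i = B i - x i / 2" for i
  have \<beta>: "\<bar>\<beta> i\<bar> \<le> n * (e * Y) / 2" for i
  proof -
    have "\<beta> i = (\<Sum>j\<in>UNIV. (h i j - (if i = j then 1 else 0)) * x j) / 2"
      by (simp add: \<beta>_def B left_diff_distrib sum_subtractf sum_delta_form)
    moreover have "\<bar>\<Sum>j\<in>UNIV. (h i j - (if i = j then 1 else 0)) * x j\<bar> \<le> n * (e * Y)" unfolding n_def
      using h x(1) e0 by (intro abs_sum_le_card) (simp add: abs_mult e_def mult_mono)
    ultimately show ?thesis by (simp add: abs_divide)
  qed
  have neY: "n * (e * Y) \<le> Y / 4" using mult_right_mono[OF ne Y0] by simp
  have Bb: "\<bar>B i\<bar> \<le> Y" for i using \<beta>[of i] x(1)[of i] neY Y0 unfolding \<beta>_def by linarith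
  define E where "E k i = dB k i - (if i = k then 1 else 0) / 2" for k i
  have Eb: "\<bar>E k i\<bar> \<le> n * e" for k i
  proof -
    have "\<bar>\<Sum>j\<in>UNIV. dh k i j * x j\<bar> \<le> n * e" unfolding n_def e_def
      using dh x(1) a by (intro abs_sum_le_card) (simp add: abs_mult mult_mono)
    moreover have "\<bar>h i k - (if i = k then 1 else 0)\<bar> \<le> n * e"
      using h[of i k] n1 e0 mult_right_mono[OF n1 e0] unfolding e_def by linarith
    moreover have "E k i = (\<Sum>j\<in>UNIV. dh k i j * x j) / 2 + (h i k - (if i = k then 1 else 0)) / 2"
      by (simp add: E_def dB diff_divide_distrib)
    moreover have "\<bar>p / 2 + q / 2\<bar> \<le> z" if "\<bar>p\<bar> \<le> z" "\<bar>q\<bar> \<le> z" for p q z :: real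
      using that by linarith
    ultimately show ?thesis by simp
  qed
  define DB where "DB = (\<Sum>i\<in>UNIV. dB i i) - 2 * c"
  have DB: "\<bar>DB\<bar> \<le> n\<^sup>2 * e"
  proof -
    have "DB = (\<Sum>i\<in>UNIV. E i i)" unfolding DB_def E_def by (simp add: c sum_subtractf n_def)
    also have "\<bar>\<dots>\<bar> \<le> n * (n * e)" unfolding n_def by (rule abs_sum_le_card) (use Eb n_def in auto)
    finally show ?thesis by (simp add: power2_eq_square mult_ac)
  qed
  then show "\<bar>(\<Sum>i\<in>UNIV. dB i i) - 2 * c\<bar> \<le> n\<^sup>2 * a * Y" by (simp add: DB_def e_def)
  have t1: "\<bar>S1 - 2 * (\<Sum>i\<in>UNIV. N i * (\<Sum>k\<in>UNIV. dB i k * g k))\<bar> \<le> 4 * n^3 * e * \<gamma>\<^sup>2"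
  proof -
    have d: "g i - 2 * (\<Sum>k\<in>UNIV. dB i k * g k) = - 2 * (\<Sum>k\<in>UNIV. E i k * g k)" for i
    proof -
      have "(\<Sum>k\<in>UNIV. E i k * g k) = (\<Sum>k\<in>UNIV. dB i k * g k) - (\<Sum>k\<in>UNIV. (if k = i then 1 else 0) * g k) / 2"
        unfolding E_def by (simp add: left_diff_distrib sum_subtractf sum_divide_distrib)
      also have "(\<Sum>k\<in>UNIV. (if k = i then 1 else 0) * g k) = g i"
        by (simp add: if_distrib[of "\<lambda>z. z * _"] cong: if_cong)
      finally show ?thesis by simp
    qed
    have "S1 - 2 * (\<Sum>i\<in>UNIV. N i * (\<Sum>k\<in>UNIV. dB i k * g k)) = (\<Sum>i\<in>UNIV. N i * (g i - 2 * (\<Sum>k\<in>UNIV. dB i k * g k)))"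
      by (simp add: S1_def right_diff_distrib sum_subtractf sum_distrib_left mult_ac)
    also have "\<bar>\<dots>\<bar> \<le> n * (2 * \<gamma> * (2 * (n * ((n * e) * \<gamma>))))"
      unfolding n_def
    proof (rule abs_sum_le_card)
      fix i
      have "\<bar>\<Sum>k\<in>UNIV. E i k * g k\<bar> \<le> n * ((n * e) * \<gamma>)" unfolding n_def
        using Eb g(1) n1 e0 by (intro abs_sum_le_card) (simp add: abs_mult n_def mult_mono)
      then show "\<bar>N i * (g i - 2 * (\<Sum>k\<in>UNIV. dB i k * g k))\<bar> \<le> 2 * \<gamma> * (2 * (real CARD('n) * (real CARD('n) * e * \<gamma>)))"
        unfolding d abs_mult n_def using Nb[of i] \<gamma>0 by (intro mult_mono) auto
    qed
    finally show ?thesis by (simp add: power2_eq_square power3_eq_cube mult_ac)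
  qed
  have t2: "\<bar>\<Sum>k\<in>UNIV. B k * (\<Sum>i\<in>UNIV. (\<Sum>j\<in>UNIV. dh k i j * g j) * g i)\<bar> \<le> n^3 * e * \<gamma>\<^sup>2"
  proof -
    have "\<bar>\<Sum>j\<in>UNIV. dh k i j * g j\<bar> \<le> n * (a * \<gamma>)" for k i unfolding n_def
      using dh g(1) a by (intro abs_sum_le_card) (simp add: abs_mult mult_mono)
    then have "\<bar>\<Sum>i\<in>UNIV. (\<Sum>j\<in>UNIV. dh k i j * g j) * g i\<bar> \<le> n * ((n * (a * \<gamma>)) * \<gamma>)" for k unfolding n_def
      using g(1) a \<gamma>0 by (intro abs_sum_le_card) (simp add: abs_mult mult_mono)
    then have "\<bar>\<Sum>k\<in>UNIV. B k * (\<Sum>i\<in>UNIV. (\<Sum>j\<in>UNIV. dh k i j * g j) * g i)\<bar> \<le> n * (Y * (n * ((n * (a * \<gamma>)) * \<gamma>)))" unfolding n_def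
      using Bb Y0 by (intro abs_sum_le_card) (simp add: abs_mult mult_mono)
    then show ?thesis by (simp add: power2_eq_square power3_eq_cube e_def mult_ac)
  qed
  have t3: "\<bar>DB * S1\<bar> \<le> 2 * n^3 * e * \<gamma>\<^sup>2"
  proof -
    have "\<bar>DB * S1\<bar> \<le> (n\<^sup>2 * e) * (2 * \<gamma>\<^sup>2)" unfolding abs_mult using DB S1b e0 by (intro mult_mono) auto
    also have "\<dots> \<le> (n^3 * e) * (2 * \<gamma>\<^sup>2)" using n3 e0 by (intro mult_right_mono) auto
    finally show ?thesis by simp
  qed
  show "\<bar>(\<Sum>i\<in>UNIV. N i * g i) - 2 * (\<Sum>i\<in>UNIV. N i * (\<Sum>k\<in>UNIV. dB i k * g k))
      + (\<Sum>k\<in>UNIV. B k * (\<Sum>i\<in>UNIV. (\<Sum>j\<in>UNIV. dh k i j * g j) * g i)) + ((\<Sum>i\<in>UNIV. dB i i) - 2 * c) * (\<Sum>i\<in>UNIV. N i * g i)\<bar>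
      \<le> 7 * n^3 * a * Y * \<gamma>\<^sup>2"
  proof -
    have "4 * n^3 * e * \<gamma>\<^sup>2 + n^3 * e * \<gamma>\<^sup>2 + 2 * n^3 * e * \<gamma>\<^sup>2 = 7 * n^3 * a * Y * \<gamma>\<^sup>2" by (simp add: e_def)
    then show ?thesis unfolding S1_def[symmetric] DB_def[symmetric] using t1 t2 t3 by linarith
  qed
  have "\<bar>\<Sum>i\<in>UNIV. x i * N i\<bar> \<le> n * (Y * (2 * \<gamma>))" unfolding n_def
    using x(1) Nb Y0 by (intro abs_sum_le_card) (simp add: abs_mult mult_mono)
  then show "\<bar>\<Sum>i\<in>UNIV. x i * N i\<bar> \<le> 2 * n * Y * \<gamma>" by (simp add: mult_ac)
  define bx where "bx = (\<Sum>i\<in>UNIV. \<beta> i * x i)"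
  define bb where "bb = (\<Sum>i\<in>UNIV. (\<beta> i)\<^sup>2)"
  define K where "K = (\<Sum>k\<in>UNIV. B k * (\<Sum>i\<in>UNIV. (\<Sum>j\<in>UNIV. dh k i j * x j) * x i))"
  have bx: "\<bar>bx\<bar> \<le> n\<^sup>2 * e * Y\<^sup>2 / 2"
  proof -
    have "\<bar>bx\<bar> \<le> n * ((n * (e * Y) / 2) * Y)" unfolding n_def bx_def
    proof (rule abs_sum_le_card)
      fix i
      have "\<bar>\<beta> i\<bar> * \<bar>x i\<bar> \<le> (n * (e * Y) / 2) * Y" using \<beta>[of i] x(1)[of i] Y0 e0 n1 by (intro mult_mono) auto
      then show "\<bar>\<beta> i * x i\<bar> \<le> real CARD('n) * (e * Y) / 2 * Y" by (simp add: abs_mult n_def)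
    qed
    then show ?thesis by (simp add: power2_eq_square mult_ac)
  qed
  have bb: "0 \<le> bb" "bb \<le> n\<^sup>2 * e * Y\<^sup>2 / 16"
  proof -
    show "0 \<le> bb" by (auto simp: bb_def intro: sum_nonneg)
    have "\<bar>bb\<bar> \<le> n * ((n * (e * Y) / 2) * (Y / 8))" unfolding n_def bb_def
    proof (rule abs_sum_le_card)
      fix i
      have "\<bar>\<beta> i\<bar> * \<bar>\<beta> i\<bar> \<le> (n * (e * Y) / 2) * (Y / 8)" using \<beta>[of i] neY by (intro mult_mono) auto
      then show "\<bar>(\<beta> i)\<^sup>2\<bar> \<le> real CARD('n) * (e * Y) / 2 * (Y / 8)" by (simp add: power2_eq_square abs_mult n_def)
    qed
    then have "bb \<le> n * ((n * (e * Y) / 2) * (Y / 8))" by linarith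
    then show "bb \<le> n\<^sup>2 * e * Y\<^sup>2 / 16" by (simp add: power2_eq_square mult_ac)
  qed
  have K: "\<bar>K\<bar> \<le> n^3 * e * Y\<^sup>2"
  proof -
    have "\<bar>\<Sum>j\<in>UNIV. dh k i j * x j\<bar> \<le> n * (a * Y)" for k i unfolding n_def
      using dh x(1) a by (intro abs_sum_le_card) (simp add: abs_mult mult_mono)
    then have "\<bar>\<Sum>i\<in>UNIV. (\<Sum>j\<in>UNIV. dh k i j * x j) * x i\<bar> \<le> n * ((n * (a * Y)) * Y)" for k unfolding n_def
      using x(1) a Y0 by (intro abs_sum_le_card) (simp add: abs_mult mult_mono)
    then have "\<bar>K\<bar> \<le> n * (Y * (n * ((n * (a * Y)) * Y)))" unfolding n_def K_def
      using Bb Y0 by (intro abs_sum_le_card) (simp add: abs_mult mult_mono)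
    then show ?thesis by (simp add: power2_eq_square power3_eq_cube e_def mult_ac)
  qed
  have hx: "(\<Sum>j\<in>UNIV. h i j * x j) = x i + 2 * \<beta> i" for i by (simp add: \<beta>_def B)
  have hxx: "(\<Sum>i\<in>UNIV. (\<Sum>j\<in>UNIV. h i j * x j) * x i) = Y\<^sup>2 + 2 * bx"
  proof -
    have "(\<Sum>i\<in>UNIV. (x i + 2 * \<beta> i) * x i) = (\<Sum>i\<in>UNIV. (x i)\<^sup>2 + 2 * (\<beta> i * x i))"
      by (intro sum.cong refl) (simp add: algebra_simps power2_eq_square)
    also have "\<dots> = Y\<^sup>2 + 2 * bx" unfolding sum.distrib bx_def x(2)[symmetric] sum_distrib_left ..
    finally show ?thesis unfolding hx .
  qed
  have bx4: "\<bar>bx\<bar> \<le> Y\<^sup>2 / 8" using bx mult_right_mono[OF ne2, of "Y\<^sup>2"] by simp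
  show "((\<Sum>i\<in>UNIV. (\<Sum>j\<in>UNIV. h i j * x j) * x i) - 2 * (\<Sum>i\<in>UNIV. (x i)\<^sup>2)) / 16 \<le> - Y\<^sup>2 / 32"
    unfolding hxx x(2) using bx4 zero_le_power2[of Y] by argo
  show "- Y\<^sup>2 / 8 \<le> ((\<Sum>i\<in>UNIV. (\<Sum>j\<in>UNIV. h i j * x j) * x i) - 2 * (\<Sum>i\<in>UNIV. (x i)\<^sup>2)) / 16"
    unfolding hxx x(2) using bx4 zero_le_power2[of Y] by argo
  have "(\<Sum>k\<in>UNIV. B k * (((\<Sum>i\<in>UNIV. (\<Sum>j\<in>UNIV. dh k i j * x j) * x i) + 4 * B k - 4 * x k) / 16))
     = (\<Sum>k\<in>UNIV. (1/16) * (B k * (\<Sum>i\<in>UNIV. (\<Sum>j\<in>UNIV. dh k i j * x j) * x i)) + (1/4) * (\<beta> k)\<^sup>2 - (1/16) * (x k)\<^sup>2)"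
    unfolding \<beta>_def by (intro sum.cong refl) (simp add: field_simps power2_eq_square)
  also have "\<dots> = K / 16 + bb / 4 - Y\<^sup>2 / 16"
    unfolding sum.distrib sum_subtractf sum_distrib_left[symmetric] K_def bb_def x(2) by simp
  finally have eq: "(\<Sum>k\<in>UNIV. B k * (((\<Sum>i\<in>UNIV. (\<Sum>j\<in>UNIV. dh k i j * x j) * x i) + 4 * B k - 4 * x k) / 16)) = K / 16 + bb / 4 - Y\<^sup>2 / 16" .
  have "n\<^sup>2 * e * Y\<^sup>2 \<le> n^3 * e * Y\<^sup>2" using n3 e0 by (intro mult_right_mono) auto
  then have "\<bar>(Y\<^sup>2 + 2 * bx - 2 * Y\<^sup>2) / 16 - (K / 16 + bb / 4 - Y\<^sup>2 / 16)\<bar> \<le> n^3 * e * Y\<^sup>2 / 4"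
    using bx bb K by (simp only: abs_le_iff) argo
  then show "\<bar>((\<Sum>i\<in>UNIV. (\<Sum>j\<in>UNIV. h i j * x j) * x i) - 2 * (\<Sum>i\<in>UNIV. (x i)\<^sup>2)) / 16
       - (\<Sum>k\<in>UNIV. B k * (((\<Sum>i\<in>UNIV. (\<Sum>j\<in>UNIV. dh k i j * x j) * x i) + 4 * B k - 4 * x k) / 16))\<bar> \<le> n^3 * a * Y^3 / 4"
    unfolding hxx x(2) eq by (simp add: e_def power2_eq_square power3_eq_cube mult_ac)
qed

text \<open>H minus the squared trace will integrate to 0, so it is kept on the right exactly. The
  trace equals div(h \<nabla>v) up to a gradient term and at most a quarter of the square root of H,
  which is absorbed into the left side.\<close>

lemma laplacian_bound:
  fixes h A :: "'n::finite \<Rightarrow> 'n \<Rightarrow> real" and g :: "'n \<Rightarrow> real" and a e \<gamma> :: real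
  defines "n \<equiv> real CARD('n)"
  assumes g: "\<And>i. \<bar>g i\<bar> \<le> \<gamma>" and a: "0 \<le> a"
    and h: "\<And>i j. \<bar>h i j - (if i = j then 1 else 0)\<bar> \<le> e" and dh: "\<And>k i j. \<bar>dh k i j\<bar> \<le> a"
    and small: "n\<^sup>2 * e \<le> 1 / 4"
    and dN: "\<And>k i. dN k i = (\<Sum>j\<in>UNIV. dh k i j * g j + h i j * A j k)"
    and H: "H = (\<Sum>i\<in>UNIV. \<Sum>j\<in>UNIV. (A i j)\<^sup>2)"
  shows "H \<le> 6 * (\<Sum>i\<in>UNIV. dN i i)\<^sup>2 + 6 * n^4 * a\<^sup>2 * \<gamma>\<^sup>2 + 2 * (H - (\<Sum>i\<in>UNIV. A i i)\<^sup>2)"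
proof -
  define L where "L = (\<Sum>i\<in>UNIV. dN i i)"
  define D where "D = (\<Sum>i\<in>UNIV. A i i)"
  define \<eta> where "\<eta> = sqrt H"
  have H0: "0 \<le> H" unfolding H by (intro sum_nonneg) auto
  have \<eta>: "\<eta>\<^sup>2 = H" "0 \<le> \<eta>" using H0 by (auto simp: \<eta>_def)
  have A: "\<bar>A i j\<bar> \<le> \<eta>" for i j
  proof -
    have "(A i j)\<^sup>2 \<le> (\<Sum>j\<in>UNIV. (A i j)\<^sup>2)" by (intro member_le_sum) auto
    also have "\<dots> \<le> H" unfolding H by (rule member_le_sum) (auto intro: sum_nonneg)
    finally show ?thesis unfolding \<eta>_def by (intro real_le_rsqrt) simp
  qed
  have e0: "0 \<le> e" using h[of undefined undefined] by linarith
  have b1: "\<bar>\<Sum>i\<in>UNIV. \<Sum>j\<in>UNIV. dh i i j * g j\<bar> \<le> n * (n * (a * \<gamma>))" unfolding n_def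
    using dh g a by (intro abs_sum_le_card) (simp add: abs_mult mult_mono)
  have b2: "\<bar>\<Sum>i\<in>UNIV. \<Sum>j\<in>UNIV. (h i j - (if i = j then 1 else 0)) * A j i\<bar> \<le> n * (n * (e * \<eta>))" unfolding n_def
    using h A e0 by (intro abs_sum_le_card) (simp add: abs_mult mult_mono)
  have "L = (\<Sum>i\<in>UNIV. \<Sum>j\<in>UNIV. dh i i j * g j) + (\<Sum>i\<in>UNIV. \<Sum>j\<in>UNIV. (h i j - (if i = j then 1 else 0)) * A j i) + D"
    unfolding L_def dN D_def by (simp add: sum.distrib left_diff_distrib sum_subtractf sum_delta_form)
  moreover have "n * (n * (e * \<eta>)) \<le> \<eta> / 4" using mult_right_mono[OF small \<eta>(2)] by (simp add: power2_eq_square mult_ac)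
  ultimately have "\<bar>D\<bar> \<le> \<bar>L\<bar> + n\<^sup>2 * a * \<gamma> + \<eta> / 4" using b1 b2 by (simp only: power2_eq_square mult.assoc)
  then have "\<bar>D\<bar>\<^sup>2 \<le> (\<bar>L\<bar> + n\<^sup>2 * a * \<gamma> + \<eta> / 4)\<^sup>2" by (intro power_mono) auto
  also have "\<dots> \<le> 3 * \<bar>L\<bar>\<^sup>2 + 3 * (n\<^sup>2 * a * \<gamma>)\<^sup>2 + 3 * (\<eta> / 4)\<^sup>2"
    using sum_squares_bound[of "\<bar>L\<bar>" "n\<^sup>2 * a * \<gamma>"] sum_squares_bound[of "\<bar>L\<bar>" "\<eta> / 4"] sum_squares_bound[of "n\<^sup>2 * a * \<gamma>" "\<eta> / 4"]
    by (simp add: power2_sum algebra_simps)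
  also have "\<dots> = 3 * L\<^sup>2 + 3 * n^4 * a\<^sup>2 * \<gamma>\<^sup>2 + 3 / 16 * H" using \<eta> by (simp add: power_mult_distrib power_divide)
  finally have "D\<^sup>2 \<le> 3 * L\<^sup>2 + 3 * n^4 * a\<^sup>2 * \<gamma>\<^sup>2 + 3 / 16 * H" by simp
  moreover define X where "X = n^4 * a\<^sup>2 * \<gamma>\<^sup>2"
  ultimately have "D\<^sup>2 \<le> 3 * L\<^sup>2 + 3 * X + 3 / 16 * H" by (simp add: mult.assoc)
  then have "H \<le> 6 * L\<^sup>2 + 6 * X + 2 * (H - D\<^sup>2)" using H0 by argo
  then show ?thesis unfolding L_def[symmetric] D_def[symmetric] X_def by (simp add: mult.assoc)
qed

text \<open>The coefficient difference is O(sqrt t), but its x-derivative is merely bounded: second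
  derivatives of u come with a sqrt t, first derivatives with 2 a. Squaring the six resulting
  summands costs a factor 6, and the largest coefficient squared is 4, hence 24.\<close>

lemma perturbation_bound:
  fixes A Gd Gd' U2 :: "'n::finite \<Rightarrow> 'n \<Rightarrow> real" and x g U :: "'n \<Rightarrow> real" and a Y \<gamma> t v :: real
  defines "n \<equiv> real CARD('n)"
  assumes x: "\<And>i. \<bar>x i\<bar> \<le> Y" and g: "\<And>i. \<bar>g i\<bar> \<le> \<gamma>" and a: "0 \<le> a" and t: "0 < t"
    and Gd: "\<And>i j. \<bar>Gd i j\<bar> \<le> a * sqrt t" and Gd': "\<And>i j. \<bar>Gd' i j\<bar> \<le> 2 * a"
    and U: "\<And>j. U j = g j + x j / (4 * t) * v"
    and U2: "\<And>i j. U2 i j = A i j + (x i * g j + x j * g i) / (4 * t) + ((if i = j then 1 else 0) / (4 * t) + x i * x j / (16 * t\<^sup>2)) * v"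
    and er: "er = (\<Sum>i\<in>UNIV. \<Sum>j\<in>UNIV. Gd' i j * U j + Gd i j * U2 i j)"
    and H: "H = (\<Sum>i\<in>UNIV. \<Sum>j\<in>UNIV. (A i j)\<^sup>2)"
  shows "t * er\<^sup>2 \<le> 24 * n^4 * a\<^sup>2 * (t\<^sup>2 * H + Y\<^sup>2 * \<gamma>\<^sup>2 + v\<^sup>2 + Y^4 * v\<^sup>2 / t\<^sup>2 + t * \<gamma>\<^sup>2 + Y\<^sup>2 * v\<^sup>2 / t)"
proof -
  define \<eta> where "\<eta> = sqrt H"
  have H0: "0 \<le> H" unfolding H by (intro sum_nonneg) auto
  have \<eta>: "\<eta>\<^sup>2 = H" "0 \<le> \<eta>" using H0 by (auto simp: \<eta>_def)
  have Y0: "0 \<le> Y" and \<gamma>0: "0 \<le> \<gamma>" using x[of undefined] g[of undefined] by linarith+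
  have A: "\<bar>A i j\<bar> \<le> \<eta>" for i j
  proof -
    have "(A i j)\<^sup>2 \<le> (\<Sum>j\<in>UNIV. (A i j)\<^sup>2)" by (intro member_le_sum) auto
    also have "\<dots> \<le> H" unfolding H by (rule member_le_sum) (auto intro: sum_nonneg)
    finally show ?thesis unfolding \<eta>_def by (intro real_le_rsqrt) simp
  qed
  define r where "r = sqrt t"
  have r: "0 < r" "t = r\<^sup>2" using t by (auto simp: r_def)
  have Ub: "\<bar>U j\<bar> \<le> \<gamma> + Y * \<bar>v\<bar> / t" for j
  proof -
    have "\<bar>x j / (4 * t) * v\<bar> \<le> Y * \<bar>v\<bar> / (4 * t)" using x[of j] t by (simp add: abs_mult divide_right_mono mult_right_mono)
    also have "\<dots> \<le> Y * \<bar>v\<bar> / t" using t Y0 by (intro divide_left_mono) auto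
    finally show ?thesis unfolding U using g[of j] by linarith
  qed
  have U2b: "\<bar>U2 i j\<bar> \<le> \<eta> + Y * \<gamma> / t + \<bar>v\<bar> / t + Y\<^sup>2 * \<bar>v\<bar> / t\<^sup>2" for i j
  proof -
    have "\<bar>x i * g j\<bar> \<le> Y * \<gamma>" "\<bar>x j * g i\<bar> \<le> Y * \<gamma>" unfolding abs_mult using x g Y0 by (auto intro!: mult_mono)
    then have "\<bar>x i * g j + x j * g i\<bar> \<le> 4 * (Y * \<gamma>)" using Y0 \<gamma>0 mult_nonneg_nonneg[OF Y0 \<gamma>0] by linarith
    then have "\<bar>x i * g j + x j * g i\<bar> / (4 * t) \<le> 4 * (Y * \<gamma>) / (4 * t)" using t by (intro divide_right_mono) auto
    then have 1: "\<bar>(x i * g j + x j * g i) / (4 * t)\<bar> \<le> Y * \<gamma> / t" using t by (simp add: abs_mult)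
    have "\<bar>(if i = j then 1 else 0) / (4 * t)\<bar> \<le> 1 / (4 * t)" using t by simp
    also have "\<dots> \<le> 1 / t" using t by (intro divide_left_mono) auto
    finally have 2: "\<bar>(if i = j then 1 else 0) / (4 * t)\<bar> \<le> 1 / t" .
    have "\<bar>x i * x j\<bar> \<le> Y\<^sup>2" unfolding abs_mult power2_eq_square using x Y0 by (intro mult_mono) auto
    then have "\<bar>x i * x j\<bar> / (16 * t\<^sup>2) \<le> Y\<^sup>2 / (16 * t\<^sup>2)" using t by (intro divide_right_mono) auto
    also have "\<dots> \<le> Y\<^sup>2 / t\<^sup>2" using t by (intro divide_left_mono) auto
    finally have 3: "\<bar>x i * x j / (16 * t\<^sup>2)\<bar> \<le> Y\<^sup>2 / t\<^sup>2" by (simp add: abs_mult)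
    have "\<bar>(if i = j then 1 else 0) / (4 * t) + x i * x j / (16 * t\<^sup>2)\<bar> \<le> 1 / t + Y\<^sup>2 / t\<^sup>2" using 2 3 by linarith
    then have "\<bar>((if i = j then 1 else 0) / (4 * t) + x i * x j / (16 * t\<^sup>2)) * v\<bar> \<le> (1 / t + Y\<^sup>2 / t\<^sup>2) * \<bar>v\<bar>"
      unfolding abs_mult by (rule mult_right_mono) auto
    then have "\<bar>((if i = j then 1 else 0) / (4 * t) + x i * x j / (16 * t\<^sup>2)) * v\<bar> \<le> \<bar>v\<bar> / t + Y\<^sup>2 * \<bar>v\<bar> / t\<^sup>2"
      by (simp add: distrib_right)
    then show ?thesis unfolding U2 using A[of i j] 1 by linarith
  qed
  have "\<bar>er\<bar> \<le> n * (n * (2 * a * (\<gamma> + Y * \<bar>v\<bar> / t) + a * r * (\<eta> + Y * \<gamma> / t + \<bar>v\<bar> / t + Y\<^sup>2 * \<bar>v\<bar> / t\<^sup>2)))"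
    unfolding er n_def
  proof (intro abs_sum_le_card)
    fix i j
    have "\<bar>Gd' i j * U j\<bar> \<le> 2 * a * (\<gamma> + Y * \<bar>v\<bar> / t)" unfolding abs_mult using Gd' Ub a by (intro mult_mono) auto
    moreover have "\<bar>Gd i j * U2 i j\<bar> \<le> a * r * (\<eta> + Y * \<gamma> / t + \<bar>v\<bar> / t + Y\<^sup>2 * \<bar>v\<bar> / t\<^sup>2)" unfolding abs_mult using Gd U2b a r(1) by (intro mult_mono) (auto simp: r_def)
    ultimately show "\<bar>Gd' i j * U j + Gd i j * U2 i j\<bar> \<le> 2 * a * (\<gamma> + Y * \<bar>v\<bar> / t) + a * r * (\<eta> + Y * \<gamma> / t + \<bar>v\<bar> / t + Y\<^sup>2 * \<bar>v\<bar> / t\<^sup>2)" by linarith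
  qed
  also have "\<dots> = n\<^sup>2 * a * (2 * \<gamma> + 2 * Y * \<bar>v\<bar> / t + r * \<eta> + r * (Y * \<gamma>) / t + r * \<bar>v\<bar> / t + r * Y\<^sup>2 * \<bar>v\<bar> / t\<^sup>2)"
    by (simp add: algebra_simps power2_eq_square)
  finally have "\<bar>er\<bar>\<^sup>2 \<le> (n\<^sup>2 * a * (2 * \<gamma> + 2 * Y * \<bar>v\<bar> / t + r * \<eta> + r * (Y * \<gamma>) / t + r * \<bar>v\<bar> / t + r * Y\<^sup>2 * \<bar>v\<bar> / t\<^sup>2))\<^sup>2"
    by (intro power_mono) auto
  also have "\<dots> = n^4 * a\<^sup>2 * (2 * \<gamma> + 2 * Y * \<bar>v\<bar> / t + r * \<eta> + r * (Y * \<gamma>) / t + r * \<bar>v\<bar> / t + r * Y\<^sup>2 * \<bar>v\<bar> / t\<^sup>2)\<^sup>2"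
    by (simp add: power_mult_distrib)
  also have "\<dots> \<le> n^4 * a\<^sup>2 * (6 * ((2 * \<gamma>)\<^sup>2 + (2 * Y * \<bar>v\<bar> / t)\<^sup>2 + (r * \<eta>)\<^sup>2 + (r * (Y * \<gamma>) / t)\<^sup>2 + (r * \<bar>v\<bar> / t)\<^sup>2 + (r * Y\<^sup>2 * \<bar>v\<bar> / t\<^sup>2)\<^sup>2))"
  proof (rule mult_left_mono)
    have six: "(c1 + c2 + c3 + c4 + c5 + c6)\<^sup>2 \<le> 6 * (c1\<^sup>2 + c2\<^sup>2 + c3\<^sup>2 + c4\<^sup>2 + c5\<^sup>2 + c6\<^sup>2)" for c1 c2 c3 c4 c5 c6 :: real
    proof -
      have "6 * (c1\<^sup>2 + c2\<^sup>2 + c3\<^sup>2 + c4\<^sup>2 + c5\<^sup>2 + c6\<^sup>2) - (c1 + c2 + c3 + c4 + c5 + c6)\<^sup>2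
        = (c1 - c2)\<^sup>2 + (c1 - c3)\<^sup>2 + (c1 - c4)\<^sup>2 + (c1 - c5)\<^sup>2 + (c1 - c6)\<^sup>2 + (c2 - c3)\<^sup>2 + (c2 - c4)\<^sup>2 + (c2 - c5)\<^sup>2 + (c2 - c6)\<^sup>2
          + (c3 - c4)\<^sup>2 + (c3 - c5)\<^sup>2 + (c3 - c6)\<^sup>2 + (c4 - c5)\<^sup>2 + (c4 - c6)\<^sup>2 + (c5 - c6)\<^sup>2"
        by (simp add: power2_eq_square algebra_simps)
      also have "\<dots> \<ge> 0" by simp
      finally show ?thesis by simp
    qed
    show "(2 * \<gamma> + 2 * Y * \<bar>v\<bar> / t + r * \<eta> + r * (Y * \<gamma>) / t + r * \<bar>v\<bar> / t + r * Y\<^sup>2 * \<bar>v\<bar> / t\<^sup>2)\<^sup>2 \<le> 6 * ((2 * \<gamma>)\<^sup>2 + (2 * Y * \<bar>v\<bar> / t)\<^sup>2 + (r * \<eta>)\<^sup>2 + (r * (Y * \<gamma>) / t)\<^sup>2 + (r * \<bar>v\<bar> / t)\<^sup>2 + (r * Y\<^sup>2 * \<bar>v\<bar> / t\<^sup>2)\<^sup>2)"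
      by (rule six)
  qed simp
  finally have "t * er\<^sup>2 \<le> t * (n^4 * a\<^sup>2 * (6 * ((2 * \<gamma>)\<^sup>2 + (2 * Y * \<bar>v\<bar> / t)\<^sup>2 + (r * \<eta>)\<^sup>2 + (r * (Y * \<gamma>) / t)\<^sup>2 + (r * \<bar>v\<bar> / t)\<^sup>2 + (r * Y\<^sup>2 * \<bar>v\<bar> / t\<^sup>2)\<^sup>2)))"
    using t by (intro mult_left_mono) auto
  also have "\<dots> = n^4 * a\<^sup>2 * (24 * (t * \<gamma>\<^sup>2) + 24 * (Y\<^sup>2 * v\<^sup>2 / t) + 6 * (t\<^sup>2 * H) + 6 * (Y\<^sup>2 * \<gamma>\<^sup>2) + 6 * v\<^sup>2 + 6 * (Y^4 * v\<^sup>2 / t\<^sup>2))"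
  proof -
    have r2: "r\<^sup>2 = t" using r by simp
    have i: "(2 * \<gamma>)\<^sup>2 = 4 * \<gamma>\<^sup>2" "t * (2 * Y * \<bar>v\<bar> / t)\<^sup>2 = 4 * (Y\<^sup>2 * v\<^sup>2 / t)" "(r * \<eta>)\<^sup>2 = t * H"
      by (simp_all add: power_mult_distrib r2 \<eta>) (use t in \<open>simp add: power_divide power_mult_distrib power2_eq_square\<close>)
    have i2: "t * (r * (Y * \<gamma>) / t)\<^sup>2 = Y\<^sup>2 * \<gamma>\<^sup>2" "t * (r * \<bar>v\<bar> / t)\<^sup>2 = v\<^sup>2"
      using t by (simp_all add: power_divide power_mult_distrib r2) (simp_all add: power2_eq_square)
    have i3: "t * (r * Y\<^sup>2 * \<bar>v\<bar> / t\<^sup>2)\<^sup>2 = Y^4 * v\<^sup>2 / t\<^sup>2"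
      using t by (simp add: power_divide power_mult_distrib r2) (simp add: power2_eq_square power4_eq_xxxx)
    have "t * (n^4 * a\<^sup>2 * (6 * ((2 * \<gamma>)\<^sup>2 + (2 * Y * \<bar>v\<bar> / t)\<^sup>2 + (r * \<eta>)\<^sup>2 + (r * (Y * \<gamma>) / t)\<^sup>2 + (r * \<bar>v\<bar> / t)\<^sup>2 + (r * Y\<^sup>2 * \<bar>v\<bar> / t\<^sup>2)\<^sup>2)))
      = n^4 * a\<^sup>2 * (6 * (t * (2 * \<gamma>)\<^sup>2 + t * (2 * Y * \<bar>v\<bar> / t)\<^sup>2 + t * (r * \<eta>)\<^sup>2 + t * (r * (Y * \<gamma>) / t)\<^sup>2 + t * (r * \<bar>v\<bar> / t)\<^sup>2 + t * (r * Y\<^sup>2 * \<bar>v\<bar> / t\<^sup>2)\<^sup>2))"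
      by (simp only: distrib_left mult_ac)
    also have "\<dots> = n^4 * a\<^sup>2 * (24 * (t * \<gamma>\<^sup>2) + 24 * (Y\<^sup>2 * v\<^sup>2 / t) + 6 * (t\<^sup>2 * H) + 6 * (Y\<^sup>2 * \<gamma>\<^sup>2) + 6 * v\<^sup>2 + 6 * (Y^4 * v\<^sup>2 / t\<^sup>2))"
      unfolding i i2 i3 by (simp add: power2_eq_square)
    finally show ?thesis .
  qed
  also have "\<dots> \<le> n^4 * a\<^sup>2 * (24 * (t * \<gamma>\<^sup>2) + 24 * (Y\<^sup>2 * v\<^sup>2 / t) + 24 * (t\<^sup>2 * H) + 24 * (Y\<^sup>2 * \<gamma>\<^sup>2) + 24 * v\<^sup>2 + 24 * (Y^4 * v\<^sup>2 / t\<^sup>2))"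
    using H0 t by (intro mult_left_mono add_mono mult_right_mono) auto
  finally show ?thesis by (simp add: algebra_simps)
qed

text \<open>All derivatives are plain numbers here, so the inequality applies at every point where
  the Lipschitz coefficients have bounded derivatives. The error estimates above are brought into
  the scaled form required by \<open>carleman_absorption\<close>.\<close>

lemma pointwise_carleman:
  fixes h dB A G dG U2 dN :: "'n::finite \<Rightarrow> 'n \<Rightarrow> real" and dh :: "'n \<Rightarrow> 'n \<Rightarrow> 'n \<Rightarrow> real"
    and x g gt B N dw dq dQ U :: "'n \<Rightarrow> real"
    and a Y \<gamma> t b p th \<tau> \<epsilon> p0 v vt M :: real
  defines "n \<equiv> real CARD('n)"
  assumes x: "\<And>i. \<bar>x i\<bar> \<le> Y" "(\<Sum>i\<in>UNIV. (x i)\<^sup>2) = Y\<^sup>2" and g: "\<And>i. \<bar>g i\<bar> \<le> \<gamma>" "(\<Sum>i\<in>UNIV. (g i)\<^sup>2) = \<gamma>\<^sup>2"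
    and a: "0 \<le> a" and h: "\<And>i j. \<bar>h i j - (if i = j then 1 else 0)\<bar> \<le> a * Y" and dh: "\<And>k i j. \<bar>dh k i j\<bar> \<le> a"
    and small: "n\<^sup>2 * (a * Y) \<le> 1 / 4"
    and h_sym: "\<And>i j. h i j = h j i" and A_sym: "\<And>i j. A i j = A j i"
    and Gd: "\<And>i j. \<bar>G i j - h i j\<bar> \<le> a * sqrt t" and dG: "\<And>i j. \<bar>dG i j\<bar> \<le> a"
    and N: "\<And>i. N i = (\<Sum>j\<in>UNIV. h i j * g j)"
    and dN: "\<And>k i. dN k i = (\<Sum>j\<in>UNIV. dh k i j * g j + h i j * A j k)"
    and B: "\<And>i. B i = (\<Sum>j\<in>UNIV. h i j * x j) / 2"
    and dB: "\<And>k i. dB k i = (\<Sum>j\<in>UNIV. dh k i j * x j) / 2 + h i k / 2"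
    and w: "w = t * vt + (\<Sum>k\<in>UNIV. B k * g k) + n / 4 * v"
    and dw: "\<And>i. dw i = t * gt i + (\<Sum>k\<in>UNIV. dB i k * g k + B k * A k i) + n / 4 * g i"
    and Q: "Q = (\<Sum>i\<in>UNIV. N i * g i) - q * v\<^sup>2"
    and dQ: "\<And>k. dQ k = (\<Sum>i\<in>UNIV. dN k i * g i + N i * A i k) - (dq k * v\<^sup>2 + q * (2 * v * g k))"
    and dtE: "dtE = Q + t * ((\<Sum>i\<in>UNIV. (\<Sum>j\<in>UNIV. h i j * gt j) * g i + N i * gt i) - (qt * v\<^sup>2 + q * (2 * v * vt)))"
    and D1: "D1 = (\<Sum>i\<in>UNIV. 2 * (dN i i * w + N i * dw i) - (dB i i * Q + B i * dQ i))"
    and kap: "kap = ((\<Sum>i\<in>UNIV. (\<Sum>j\<in>UNIV. h i j * x j) * x i) - 2 * (\<Sum>i\<in>UNIV. (x i)\<^sup>2)) / 16"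
    and q: "q = b * p / t + kap / t\<^sup>2"
    and qt: "qt = - b * p * th / t\<^sup>2 - b * p / t\<^sup>2 - 2 * kap / t^3"
    and dq: "\<And>k. dq k = ((\<Sum>i\<in>UNIV. (\<Sum>j\<in>UNIV. dh k i j * x j) * x i) + 4 * B k - 4 * x k) / 16 / t\<^sup>2"
    and U: "\<And>j. U j = g j + x j / (4 * t) * v"
    and U2: "\<And>i j. U2 i j = A i j + (x i * g j + x j * g i) / (4 * t) + ((if i = j then 1 else 0) / (4 * t) + x i * x j / (16 * t\<^sup>2)) * v"
    and Ut: "Ut = vt + (b * p / t - (\<Sum>i\<in>UNIV. (x i)\<^sup>2) / (8 * t\<^sup>2)) * v"
    and f: "f = (\<Sum>i\<in>UNIV. \<Sum>j\<in>UNIV. dG i j * U j + G i j * U2 i j) + Ut"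
    and m: "m = (\<Sum>i\<in>UNIV. (x i)\<^sup>2) / \<tau> + p0 / 32 * th"
    and D2: "D2 = (\<Sum>i\<in>UNIV. (2 * x i / \<tau> * v + m * g i) * N i + m * v * dN i i)"
    and D3: "D3 = (\<Sum>i\<in>UNIV. \<Sum>j\<in>UNIV. (A i j)\<^sup>2) - (\<Sum>i\<in>UNIV. A i i)\<^sup>2"
    and t: "0 < t" and b: "1 \<le> b" and \<tau>: "0 < \<tau>" "\<tau>\<^sup>2 = b * t" "\<tau> \<le> \<epsilon> * th" and th: "0 < th" "th \<le> 15"
    and p: "0 < p0" "p0 \<le> p" "p \<le> 1"
    and M: "M = 24 * n^4 * (1 + a)\<^sup>2" and \<epsilon>: "0 < \<epsilon>" "\<epsilon> * M\<^sup>2 * 10^7 \<le> p0"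
  shows "p0 / 4096 * (b * th / t * v\<^sup>2 + th * \<gamma>\<^sup>2 + th * Y\<^sup>2 / t\<^sup>2 * v\<^sup>2) \<le> 3 * t * f\<^sup>2 + dtE - D1 + D2 + 6 * M * t\<^sup>2 * D3"
proof -
  define c where "c = n / 4"
  note wc = w[folded c_def] and dwc = dw[folded c_def]
  have n1: "1 \<le> n" by (simp add: n_def Suc_leI)
  have Y0: "0 \<le> Y" and \<gamma>0: "0 \<le> \<gamma>" using x(1)[of undefined] g(1)[of undefined] by linarith+
  have ap: "1 \<le> (1 + a)\<^sup>2" "a \<le> (1 + a)\<^sup>2" "a\<^sup>2 \<le> (1 + a)\<^sup>2"
    using a by (auto simp: power2_eq_square algebra_simps)
  have npow: "n^k \<le> n^4" if "k \<le> 4" for k using n1 that by (intro power_increasing) auto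
  \<comment> \<open>A single constant for all errors: none exceeds 24 n^4 in the dimension, and (1 +
    a)^2 dominates both a and its square.\<close>
  have Mge: "c1 * n^k * z \<le> M" if "k \<le> 4" "z \<le> (1 + a)\<^sup>2" "0 \<le> z" "c1 \<le> 24" "0 \<le> c1" for c1 z k
    unfolding M using that npow[of k] n1 by (intro mult_mono) auto
  have M24: "24 \<le> M" using Mge[of 0 1 24] ap by simp
  have M1: "1 \<le> M" using M24 by simp
  note mb = metric_bounds[where h = h and x = x and g = g and a = a and Y = Y and \<gamma> = \<gamma> and c = c and dh = dh and N = N and B = B and dB = dB,
      folded n_def, OF x g a h dh small N B dB, folded n_def, OF c_def]
  define L where "L = (\<Sum>i\<in>UNIV. dN i i)"
  define S where "S = L + q * v"
  define S1 where "S1 = (\<Sum>i\<in>UNIV. N i * g i)"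
  define DB where "DB = (\<Sum>i\<in>UNIV. dB i i) - 2 * c"
  define R where "R = DB / (2 * t)"
  define er where "er = (\<Sum>i\<in>UNIV. \<Sum>j\<in>UNIV. (dG i j - dh i i j) * U j + (G i j - h i j) * U2 i j)"
  define Z where "Z = 2 / \<tau> * (\<Sum>i\<in>UNIV. x i * N i)"
  define R1 where "R1 = S1 - 2 * (\<Sum>i\<in>UNIV. N i * (\<Sum>k\<in>UNIV. dB i k * g k))
      + (\<Sum>k\<in>UNIV. B k * (\<Sum>i\<in>UNIV. (\<Sum>j\<in>UNIV. dh k i j * g j) * g i)) + DB * S1"
  define R2 where "R2 = - (q + t * qt) - (\<Sum>k\<in>UNIV. B k * dq k) - DB * q"
  define y where "y = Y / \<tau>"
  define V where "V = v\<^sup>2 / t\<^sup>2"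
  have y: "0 \<le> y" "y * \<tau> = Y" using Y0 \<tau> by (auto simp: y_def)
  have V: "v\<^sup>2 = V * t\<^sup>2" "0 \<le> V" using t by (auto simp: V_def)
  have I: "2 * S * w = D1 - dtE + R1 + R2 * v\<^sup>2"
    unfolding S_def L_def
    by (rule rellich_algebra[OF h_sym A_sym N dN wc dwc Q dQ dtE D1]) (simp_all add: R1_def R2_def S1_def DB_def)
  have DBb: "\<bar>DB\<bar> \<le> n\<^sup>2 * a * Y" using mb(2) unfolding DB_def .
  have R1b: "\<bar>R1\<bar> \<le> M * (y * \<tau>) * \<gamma>\<^sup>2"
  proof -
    have "\<bar>R1\<bar> \<le> 7 * n^3 * a * Y * \<gamma>\<^sup>2" using mb(3) unfolding R1_def S1_def DB_def .
    also have "\<dots> \<le> M * Y * \<gamma>\<^sup>2" using Mge[of 3 a 7] ap a Y0 by (intro mult_right_mono) auto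
    finally show ?thesis unfolding y .
  qed
  have kapb: "kap \<le> - Y\<^sup>2 / 32" "- Y\<^sup>2 / 8 \<le> kap" using mb(6,7) unfolding kap .
  have tne: "t \<noteq> 0" using t by simp
  have qb: "\<bar>q\<bar> \<le> b / t + Y\<^sup>2 / t\<^sup>2" "q \<le> b / t - Y\<^sup>2 / 32 / t\<^sup>2"
  proof -
    have bp: "0 \<le> b * p / t" "b * p / t \<le> b / t" using b p t by (auto intro!: divide_right_mono mult_left_le)
    define W where "W = Y\<^sup>2 / t\<^sup>2"
    have "kap / t\<^sup>2 \<le> (- Y\<^sup>2 / 32) / t\<^sup>2" by (rule divide_right_mono[OF kapb(1)]) simp
    then have k1: "kap / t\<^sup>2 \<le> - (W / 32)" by (simp add: W_def)
    have "(- Y\<^sup>2 / 8) / t\<^sup>2 \<le> kap / t\<^sup>2" by (rule divide_right_mono[OF kapb(2)]) simp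
    then have k2: "- (W / 8) \<le> kap / t\<^sup>2" by (simp add: W_def)
    have W0: "0 \<le> W" by (simp add: W_def)
    have "\<bar>b * p / t + kap / t\<^sup>2\<bar> \<le> b / t + W" "b * p / t + kap / t\<^sup>2 \<le> b / t - W / 32" using bp k1 k2 W0 by linarith+
    then show "\<bar>q\<bar> \<le> b / t + Y\<^sup>2 / t\<^sup>2" "q \<le> b / t - Y\<^sup>2 / 32 / t\<^sup>2" unfolding q W_def by simp_all
  qed
  have R2b: "R2 * v\<^sup>2 \<ge> p * (\<tau>\<^sup>2 * th * V) - M * (y * \<tau>) * (\<tau>\<^sup>2 + (y * \<tau>)\<^sup>2) * V"
  proof -
    define K where "K = (\<Sum>k\<in>UNIV. B k * (((\<Sum>i\<in>UNIV. (\<Sum>j\<in>UNIV. dh k i j * x j) * x i) + 4 * B k - 4 * x k) / 16))"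
    have "(\<Sum>k\<in>UNIV. B k * dq k) = K / t\<^sup>2" unfolding dq K_def sum_divide_distrib by simp
    \<comment> \<open>The scale invariant part of b p / t drops out, and only the derivative of the
      exponent p remains. It gives the positive term b p theta / t in \<open>R2\<close>.\<close>
    moreover have "q + t * qt = - (b * p * th / t) - kap / t\<^sup>2"
      unfolding q qt using t by (simp add: field_simps power2_eq_square power3_eq_cube)
    ultimately have R2': "R2 = b * p * th / t + (kap - K) / t\<^sup>2 - DB * q"
      unfolding R2_def by (simp add: diff_divide_distrib)
    have "\<bar>kap - K\<bar> \<le> n^3 * a * Y^3 / 4" using mb(5) unfolding kap K_def .
    also have "\<dots> \<le> 1/4 * M * Y^3" using Mge[of 3 a 1] ap a Y0 by (simp add: mult_right_mono)
    finally have "\<bar>kap - K\<bar> \<le> 1/4 * M * Y^3" .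
    then have "\<bar>kap - K\<bar> / t\<^sup>2 \<le> 1/4 * M * Y^3 / t\<^sup>2" by (rule divide_right_mono) simp
    then have 1: "\<bar>(kap - K) / t\<^sup>2\<bar> \<le> 1/4 * M * Y^3 / t\<^sup>2" by (simp only: abs_divide abs_power2)
    have "n\<^sup>2 * a * Y \<le> 1/2 * M * Y" using Mge[of 2 a 2] ap a Y0 by (intro mult_right_mono) auto
    then have "\<bar>DB\<bar> \<le> 1/2 * M * Y" using DBb by linarith
    then have "\<bar>DB * q\<bar> \<le> (1/2 * M * Y) * (b / t + Y\<^sup>2 / t\<^sup>2)" unfolding abs_mult using qb M1 Y0 by (intro mult_mono) auto
    also have "\<dots> = 1/2 * M * Y * b / t + 1/2 * M * Y^3 / t\<^sup>2" by (simp add: distrib_left power2_eq_square power3_eq_cube)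
    finally have 2: "\<bar>DB * q\<bar> \<le> 1/2 * M * Y * b / t + 1/2 * M * Y^3 / t\<^sup>2" .
    define P where "P = M * Y * b / t"
    define W where "W = M * Y^3 / t\<^sup>2"
    have PW: "0 \<le> P" "0 \<le> W" using M1 Y0 b t by (auto simp: P_def W_def)
    have "\<bar>(kap - K) / t\<^sup>2\<bar> \<le> W / 4" "\<bar>DB * q\<bar> \<le> P / 2 + W / 2" using 1 2 by (simp_all add: P_def W_def)
    then have "R2 \<ge> b * p * th / t - P - W" unfolding R2' using PW by linarith
    then have "R2 \<ge> b * p * th / t - M * Y * b / t - M * Y^3 / t\<^sup>2" unfolding P_def W_def .
    then have "(b * p * th / t - M * Y * b / t - M * Y^3 / t\<^sup>2) * v\<^sup>2 \<le> R2 * v\<^sup>2" by (intro mult_right_mono) auto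
    also have "(b * p * th / t - M * Y * b / t - M * Y^3 / t\<^sup>2) * v\<^sup>2 = p * ((b * t) * th * V) - M * Y * ((b * t) + Y\<^sup>2) * V"
      unfolding V using t by (simp add: field_simps power2_eq_square power3_eq_cube)
    finally show ?thesis unfolding y \<tau>(2) .
  qed
  have II: "m * S1 = D2 - m * v * S + m * q * v\<^sup>2 - v * Z"
  proof -
    have "D2 = (\<Sum>i\<in>UNIV. (2 * v / \<tau>) * (x i * N i) + m * (N i * g i) + m * v * dN i i)"
      unfolding D2 by (intro sum.cong refl) (simp add: algebra_simps)
    also have "\<dots> = (2 * v / \<tau>) * (\<Sum>i\<in>UNIV. x i * N i) + m * S1 + m * v * L"
      unfolding sum.distrib sum_distrib_left[symmetric] S1_def L_def ..
    finally show ?thesis unfolding S_def Z_def by (simp add: algebra_simps power2_eq_square)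
  qed
  have Zb: "\<bar>Z\<bar> \<le> M * y * \<gamma>"
  proof -
    have "\<bar>Z\<bar> = 2 / \<tau> * \<bar>\<Sum>i\<in>UNIV. x i * N i\<bar>" unfolding Z_def using \<tau> by (simp add: abs_mult)
    also have "\<dots> \<le> 2 / \<tau> * (2 * n * Y * \<gamma>)" using mb(4) \<tau> by (intro mult_left_mono) auto
    also have "\<dots> = 4 * n * y * \<gamma>" by (simp add: y_def)
    also have "\<dots> \<le> M * y * \<gamma>" using Mge[of 1 1 4] ap y \<gamma>0 by (intro mult_right_mono) auto
    finally show ?thesis .
  qed
  have q1: "q * v\<^sup>2 \<le> (\<tau>\<^sup>2 - (y * \<tau>)\<^sup>2 / 32) * V"
  proof -
    have "q * v\<^sup>2 \<le> (b / t - Y\<^sup>2 / 32 / t\<^sup>2) * v\<^sup>2" using qb by (intro mult_right_mono) auto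
    also have "\<dots> = (b * t - Y\<^sup>2 / 32) * V" unfolding V(1) using t by (simp add: field_simps power2_eq_square)
    finally show ?thesis unfolding y \<tau>(2) .
  qed
  have q2: "q\<^sup>2 * v\<^sup>2 * t\<^sup>2 \<le> 2 * (\<tau>^4 + (y * \<tau>)^4) * V"
  proof -
    have "\<bar>q\<bar>\<^sup>2 \<le> (b / t + Y\<^sup>2 / t\<^sup>2)\<^sup>2" using qb by (intro power_mono) auto
    also have "\<dots> \<le> 2 * (b / t)\<^sup>2 + 2 * (Y\<^sup>2 / t\<^sup>2)\<^sup>2" using sum_squares_bound[of "b / t" "Y\<^sup>2 / t\<^sup>2"] by (simp add: power2_sum)
    finally have "q\<^sup>2 * (v\<^sup>2 * t\<^sup>2) \<le> (2 * (b / t)\<^sup>2 + 2 * (Y\<^sup>2 / t\<^sup>2)\<^sup>2) * (v\<^sup>2 * t\<^sup>2)" by (intro mult_right_mono) auto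
    also have "\<dots> = 2 * ((b * t)\<^sup>2 + Y^4) * V" unfolding V(1) using t by (simp add: field_simps power2_eq_square power4_eq_xxxx)
    also have "(b * t)\<^sup>2 = \<tau>^4" unfolding \<tau>(2)[symmetric] by simp
    finally show ?thesis unfolding y by (simp add: mult.assoc)
  qed
  have H: "(\<Sum>i\<in>UNIV. \<Sum>j\<in>UNIV. (A i j)\<^sup>2) \<le> M * (S\<^sup>2 + q\<^sup>2 * v\<^sup>2 + \<gamma>\<^sup>2) + 2 * D3"
  proof -
    have small': "(real CARD('n))\<^sup>2 * (a * Y) \<le> 1/4" using small by (simp add: n_def)
    have "(\<Sum>i\<in>UNIV. \<Sum>j\<in>UNIV. (A i j)\<^sup>2) \<le> 6 * L\<^sup>2 + 6 * n^4 * a\<^sup>2 * \<gamma>\<^sup>2 + 2 * D3"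
      using laplacian_bound[OF g(1) a h dh small' dN refl] unfolding D3 L_def n_def .
    moreover have "6 * n^4 * a\<^sup>2 * \<gamma>\<^sup>2 \<le> M * \<gamma>\<^sup>2" using Mge[of 4 "a\<^sup>2" 6] ap by (intro mult_right_mono) auto
    moreover have "6 * L\<^sup>2 \<le> M * (S\<^sup>2 + q\<^sup>2 * v\<^sup>2)"
    proof -
      have "L\<^sup>2 \<le> 2 * (S\<^sup>2 + q\<^sup>2 * v\<^sup>2)" using sum_squares_bound[of S "- (q * v)"]
        unfolding S_def by (simp add: power2_eq_square algebra_simps)
      moreover have "12 * (S\<^sup>2 + q\<^sup>2 * v\<^sup>2) \<le> M * (S\<^sup>2 + q\<^sup>2 * v\<^sup>2)" using M24 by (intro mult_right_mono) auto
      ultimately show ?thesis by linarith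
    qed
    ultimately show ?thesis by (simp add: distrib_left)
  qed
  have er: "t * er\<^sup>2 \<le> M * (t\<^sup>2 * (\<Sum>i\<in>UNIV. \<Sum>j\<in>UNIV. (A i j)\<^sup>2) + (y * \<tau>)\<^sup>2 * \<gamma>\<^sup>2 + V * t\<^sup>2 + (y * \<tau>)^4 * V + t * \<gamma>\<^sup>2 + (y * \<tau>)\<^sup>2 * V * t)"
  proof -
    have dGd: "\<bar>dG i j - dh i i j\<bar> \<le> 2 * a" for i j using dG[of i j] dh[of i i j] by linarith
    define HH where "HH = (\<Sum>i\<in>UNIV. \<Sum>j\<in>UNIV. (A i j)\<^sup>2)"
    have HH0: "0 \<le> HH" unfolding HH_def by (intro sum_nonneg) auto
    have "t * er\<^sup>2 \<le> 24 * n^4 * a\<^sup>2 * (t\<^sup>2 * HH + Y\<^sup>2 * \<gamma>\<^sup>2 + v\<^sup>2 + Y^4 * v\<^sup>2 / t\<^sup>2 + t * \<gamma>\<^sup>2 + Y\<^sup>2 * v\<^sup>2 / t)"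
      unfolding HH_def n_def
      by (rule perturbation_bound[OF x(1) g(1) a t Gd dGd U U2 _ refl]) (simp add: er_def)
    also have "\<dots> \<le> M * (t\<^sup>2 * HH + Y\<^sup>2 * \<gamma>\<^sup>2 + v\<^sup>2 + Y^4 * v\<^sup>2 / t\<^sup>2 + t * \<gamma>\<^sup>2 + Y\<^sup>2 * v\<^sup>2 / t)"
      using Mge[of 4 "a\<^sup>2" 24] ap HH0 t by (intro mult_right_mono) (auto intro!: add_nonneg_nonneg)
    also have "v\<^sup>2 = V * t\<^sup>2" by (rule V)
    also have "Y^4 * (V * t\<^sup>2) / t\<^sup>2 = Y^4 * V" using t by simp
    also have "Y\<^sup>2 * (V * t\<^sup>2) / t = Y\<^sup>2 * V * t" using t by (simp add: power2_eq_square)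
    finally show ?thesis unfolding y HH_def .
  qed
  have FF: "S + w / t = f - R * v - er"
  proof -
    have "(\<Sum>i\<in>UNIV. \<Sum>j\<in>UNIV. dh i i j * U j + h i j * U2 i j) + Ut = ((\<Sum>i\<in>UNIV. dN i i) + q * v) + w / t + R * v"
      by (rule conjugation_algebra[OF h_sym tne dN A_sym B dB wc _ U U2 Ut]) (simp_all add: R_def DB_def q kap)
    moreover have "f = (\<Sum>i\<in>UNIV. \<Sum>j\<in>UNIV. dh i i j * U j + h i j * U2 i j) + Ut + er"
      unfolding f er_def by (simp add: sum.distrib left_diff_distrib sum_subtractf)
    ultimately show ?thesis unfolding S_def L_def by simp
  qed
  have Rb: "t * (R * v)\<^sup>2 \<le> M\<^sup>2 * (y * \<tau>)\<^sup>2 * V * t"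
  proof -
    have "n\<^sup>2 * a * Y \<le> M * Y" using Mge[of 2 a 1] ap a Y0 by (intro mult_right_mono) auto
    then have "\<bar>DB\<bar> \<le> M * Y" using DBb by linarith
    then have "\<bar>DB\<bar>\<^sup>2 \<le> (M * Y)\<^sup>2" by (intro power_mono) auto
    then have D: "DB\<^sup>2 * (V * t) \<le> (M * Y)\<^sup>2 * (V * t)" using V t by (intro mult_right_mono) auto
    have "t * (R * v)\<^sup>2 = DB\<^sup>2 * (V * t) / 4"
      unfolding R_def power_mult_distrib V(1) using t by (simp add: field_simps power2_eq_square)
    also have "\<dots> \<le> DB\<^sup>2 * (V * t)" using V t by simp
    also note D
    finally show ?thesis unfolding y by (simp add: power_mult_distrib mult_ac)
  qed
  have tau: "t \<le> \<tau>\<^sup>2" unfolding \<tau>(2) using b t by simp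
  have mm: "m = y\<^sup>2 * \<tau> + p0 / 32 * th" unfolding m x(2) y_def using \<tau>(1) by (simp add: power2_eq_square field_simps)
  have "p0 / 4096 * (\<tau>\<^sup>2 * th * V + th * \<gamma>\<^sup>2 + th * (y * \<tau>)\<^sup>2 * V) \<le> 3 * t * f\<^sup>2 + dtE - D1 + D2 + 6 * M * t\<^sup>2 * D3"
    by (rule carleman_absorption[OF M1 p(1) _ \<epsilon> \<tau>(1,3) th t tau y(1) \<gamma>0 V p(2) I refl R1b R2b _ _ Zb q1 q2 FF Rb er H])
       (use p II mb(1) mm in \<open>simp_all add: S1_def\<close>)
  moreover have "\<tau>\<^sup>2 * th * V = b * th / t * v\<^sup>2" unfolding \<tau>(2) V_def using t by (simp add: power2_eq_square)
  moreover have "th * (y * \<tau>)\<^sup>2 * V = th * Y\<^sup>2 / t\<^sup>2 * v\<^sup>2" unfolding y V_def by simp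
  ultimately show ?thesis by simp
qed

section \<open>The inequality for the conjugated function\<close>

lemma lip_diff_cong:
  assumes "lip_diff e F F'" "\<And>X. F X = K X" "\<And>X. F' X = K' X"
  shows "lip_diff e K K'"
proof -
  have "F = K" "F' = K'" using assms by auto
  then show ?thesis using assms(1) by simp
qed

lemma lip_diff_continuous: "lip_diff e F F' \<Longrightarrow> continuous_on UNIV F"
  by (simp add: lip_diff_def)

lemma lip_diff_coordinate: "lip_diff (xdir k) (\<lambda>X. fst X $ j) (\<lambda>X. if j = k then 1 else 0)"
proof (rule lip_diff_C1)
  fix X :: "(real^'a) \<times> real"
  show "((\<lambda>t. fst (X + t *\<^sub>R xdir k) $ j) has_real_derivative (if j = k then 1 else 0)) (at 0)"
    by (auto simp: xdir_def axis_def intro!: derivative_eq_intros)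
qed (auto intro!: continuous_intros)

lemma lip_diff_time:
  assumes "continuous_on UNIV f" shows "lip_diff (xdir k) (\<lambda>X. f (snd X)) (\<lambda>X. 0)"
  by (rule lip_diff_C1) (auto simp: xdir_def intro!: continuous_on_compose2[OF assms] continuous_intros)

lemma norm_sq_sum: "(norm (x :: real^'n))\<^sup>2 = (\<Sum>i\<in>UNIV. (x $ i)\<^sup>2)"
  by (simp add: norm_vec_def L2_set_def sum_nonneg)

lemma partial_x_vanish:
  assumes F: "x_smooth (Suc k) F" and z: "\<And>X. norm (fst X) > \<eta> \<Longrightarrow> F X = 0" and X: "norm (fst X) > \<eta>"
  shows "partial_x i F X = 0"
proof (rule partial_x_unique)
  have "open {t. \<eta> < norm (fst (X + t *\<^sub>R xdir i))}" by (intro open_Collect_less continuous_intros)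
  then have "\<forall>\<^sub>F t in nhds 0. t \<in> {t. \<eta> < norm (fst (X + t *\<^sub>R xdir i))}"
    by (rule eventually_nhds_in_open) (use X in simp)
  then have "\<forall>\<^sub>F t in nhds 0. F (X + t *\<^sub>R xdir i) = 0"
    by eventually_elim (use z in auto)
  then show "((\<lambda>t. F (X + t *\<^sub>R xdir i)) has_real_derivative 0) (at 0)"
    by (subst DERIV_cong_ev[OF refl _ refl, where g = "\<lambda>t. 0"]) auto
qed

lemma set_integral_sum_zero:
  fixes F :: "'i \<Rightarrow> 'a \<Rightarrow> real"
  assumes "finite I" "\<And>i. i \<in> I \<Longrightarrow> set_integrable M S (F i)" "\<And>i. i \<in> I \<Longrightarrow> (LINT X:S|M. F i X) = 0"
  shows "set_integrable M S (\<lambda>X. \<Sum>i\<in>I. F i X) \<and> (LINT X:S|M. (\<Sum>i\<in>I. F i X)) = 0"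
  using assms
proof (induction I rule: finite_induct)
  case empty
  then show ?case by (simp add: set_integrable_def set_lebesgue_integral_def)
next
  case (insert i I)
  have "set_integrable M S (F i)" "set_integrable M S (\<lambda>X. \<Sum>i\<in>I. F i X)" using insert by auto
  from set_integral_add[OF this] show ?case using insert by simp
qed

text \<open>\<open>h\<close> is the frozen metric, \<open>vt\<close> the time derivative of \<open>v\<close>, and \<open>pw = t \<sigma>'(t)/\<sigma>(t)\<close>; as functions of
  \<open>s\<close>, the data \<open>tm\<close>, \<open>pw\<close>, \<open>th\<close> are constant outside \<open>[0, T]\<close>.\<close>

locale conjugated_jet =
  fixes h G :: "'n::finite \<Rightarrow> 'n \<Rightarrow> (real^'n) \<times> real \<Rightarrow> real"
    and v vt :: "(real^'n) \<times> real \<Rightarrow> real"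
    and tm pw th :: "real \<Rightarrow> real" and b a T \<eta> \<epsilon> p0 M :: real
  assumes h_cont: "\<And>i j. continuous_on UNIV (h i j)"
    and h_lip: "\<And>i j k X r. \<bar>h i j (X + r *\<^sub>R xdir k) - h i j X\<bar> \<le> a * \<bar>r\<bar>"
    and G_cont: "\<And>i j. continuous_on UNIV (G i j)"
    and G_lip: "\<And>i j k X r. \<bar>G i j (X + r *\<^sub>R xdir k) - G i j X\<bar> \<le> a * \<bar>r\<bar>"
    and h_time: "\<And>i j x s s'. h i j (x, s) = h i j (x, s')"
    and h_sym: "\<And>i j X. h i j X = h j i X"
    and h_near: "\<And>i j X. \<bar>h i j X - (if i = j then 1 else 0)\<bar> \<le> a * norm (fst X)"
    and G_near: "\<And>i j X. 0 < snd X \<Longrightarrow> snd X < T \<Longrightarrow> \<bar>G i j X - h i j X\<bar> \<le> a * sqrt (tm (snd X))"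
    and a: "0 \<le> a" and small: "(real CARD('n))\<^sup>2 * (a * \<eta>) \<le> 1 / 4"
    and v: "x_smooth (Suc (Suc (Suc 0))) v" and vt: "x_smooth (Suc 0) vt"
    and v_time: "\<And>x s. 0 < s \<Longrightarrow> s < T \<Longrightarrow> ((\<lambda>s. v (x, s)) has_real_derivative vt (x, s)) (at s)"
    and g_time: "\<And>i x s. 0 < s \<Longrightarrow> s < T \<Longrightarrow> ((\<lambda>s. partial_x i v (x, s)) has_real_derivative partial_x i vt (x, s)) (at s)"
    and v_supp: "\<And>X. norm (fst X) > \<eta> \<Longrightarrow> v X = 0" and vt_supp: "\<And>X. norm (fst X) > \<eta> \<Longrightarrow> vt X = 0"
    and v_end: "\<And>x. v (x, T) = 0" and T: "0 < T"
    and tm: "continuous_on UNIV tm" "\<And>s. 0 < tm s" "\<And>s. 0 < s \<Longrightarrow> s < T \<Longrightarrow> (tm has_real_derivative 1) (at s)"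
    and pw: "continuous_on UNIV pw" "\<And>s. p0 \<le> pw s" "\<And>s. pw s \<le> 1"
      "\<And>s. 0 < s \<Longrightarrow> s < T \<Longrightarrow> (pw has_real_derivative - pw s * th s / tm s) (at s)"
    and th: "continuous_on UNIV th" "\<And>s. 0 < th s" "\<And>s. th s \<le> 15"
    and tau: "\<And>s. sqrt (b * tm s) \<le> \<epsilon> * th s"
    and b: "1 \<le> b" and p0: "0 < p0" and M: "M = 24 * real CARD('n)^4 * (1 + a)\<^sup>2" and \<epsilon>: "0 < \<epsilon>" "\<epsilon> * M\<^sup>2 * 10^7 \<le> p0"
begin

definition t :: "(real^'n) \<times> real \<Rightarrow> real" where "t X = tm (snd X)"
definition dh where "dh k i j = line_deriv (xdir k) (h i j)"
definition dG where "dG i j = line_deriv (xdir i) (G i j)"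
definition g where "g i = partial_x i v"
definition gt where "gt i = partial_x i vt"
definition A where "A i j = partial_x j (partial_x i v)"
definition N where "N i X = (\<Sum>j\<in>UNIV. h i j X * g j X)"
definition dN where "dN k i X = (\<Sum>j\<in>UNIV. dh k i j X * g j X + h i j X * A j k X)"
definition B where "B i X = (\<Sum>j\<in>UNIV. h i j X * fst X $ j) / 2"
definition dB where "dB k i X = (\<Sum>j\<in>UNIV. dh k i j X * fst X $ j) / 2 + h i k X / 2"
definition kap where "kap X = ((\<Sum>i\<in>UNIV. (\<Sum>j\<in>UNIV. h i j X * fst X $ j) * fst X $ i) - 2 * (\<Sum>i\<in>UNIV. (fst X $ i)\<^sup>2)) / 16"
definition q where "q X = b * pw (snd X) / t X + kap X / (t X)\<^sup>2"
definition dq where "dq k X = ((\<Sum>i\<in>UNIV. (\<Sum>j\<in>UNIV. dh k i j X * fst X $ j) * fst X $ i) + 4 * B k X - 4 * fst X $ k) / 16 / (t X)\<^sup>2"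
definition qt where "qt X = - b * pw (snd X) * th (snd X) / (t X)\<^sup>2 - b * pw (snd X) / (t X)\<^sup>2 - 2 * kap X / (t X)^3"
definition w where "w X = t X * vt X + (\<Sum>k\<in>UNIV. B k X * g k X) + real CARD('n) / 4 * v X"
definition dw where "dw i X = t X * gt i X + (\<Sum>k\<in>UNIV. dB i k X * g k X + B k X * A k i X) + real CARD('n) / 4 * g i X"
definition Q where "Q X = (\<Sum>i\<in>UNIV. N i X * g i X) - q X * (v X)\<^sup>2"
definition dQ where "dQ k X = (\<Sum>i\<in>UNIV. dN k i X * g i X + N i X * A i k X) - (dq k X * (v X)\<^sup>2 + q X * (2 * v X * g k X))"
definition dtE where "dtE X = Q X + t X * ((\<Sum>i\<in>UNIV. (\<Sum>j\<in>UNIV. h i j X * gt j X) * g i X + N i X * gt i X) - (qt X * (v X)\<^sup>2 + q X * (2 * v X * vt X)))"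
definition D1 where "D1 X = (\<Sum>i\<in>UNIV. 2 * (dN i i X * w X + N i X * dw i X) - (dB i i X * Q X + B i X * dQ i X))"
definition \<tau> where "\<tau> X = sqrt (b * t X)"
definition m where "m X = (\<Sum>i\<in>UNIV. (fst X $ i)\<^sup>2) / \<tau> X + p0 / 32 * th (snd X)"
definition D2 where "D2 X = (\<Sum>i\<in>UNIV. (2 * fst X $ i / \<tau> X * v X + m X * g i X) * N i X + m X * v X * dN i i X)"
definition D3 where "D3 X = (\<Sum>i\<in>UNIV. \<Sum>j\<in>UNIV. (A i j X)\<^sup>2) - (\<Sum>i\<in>UNIV. A i i X)\<^sup>2"
text \<open>\<open>U\<close>, \<open>U2\<close>, \<open>Ut\<close> and \<open>f\<close> are the
  weight times the first and second x-derivatives, the time derivative and P of u, written through v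
  alone so that u does not enter the locale.\<close>

definition U where "U j X = g j X + fst X $ j / (4 * t X) * v X"
definition U2 where "U2 i j X = A i j X + (fst X $ i * g j X + fst X $ j * g i X) / (4 * t X) + ((if i = j then 1 else 0) / (4 * t X) + fst X $ i * fst X $ j / (16 * (t X)\<^sup>2)) * v X"
definition Ut where "Ut X = vt X + (b * pw (snd X) / t X - (\<Sum>i\<in>UNIV. (fst X $ i)\<^sup>2) / (8 * (t X)\<^sup>2)) * v X"
definition f where "f X = (\<Sum>i\<in>UNIV. \<Sum>j\<in>UNIV. dG i j X * U j X + G i j X * U2 i j X) + Ut X"
definition S where "S = (UNIV \<times> {0<..<T} :: ((real^'n) \<times> real) set)"

section \<open>Support and regularity of the jet\<close>

lemma x_smooth_g: "x_smooth (Suc (Suc 0)) (g i)" unfolding g_def by (rule x_smooth_partial[OF v])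
lemma x_smooth_A: "x_smooth (Suc 0) (A i j)" using x_smooth_partial[OF x_smooth_g] unfolding A_def g_def .

lemma jet_supp:
  assumes "norm (fst X) > \<eta>"
  shows "v X = 0" "vt X = 0" "g i X = 0" "gt i X = 0" "A i j X = 0"
proof -
  show "v X = 0" "vt X = 0" using v_supp vt_supp assms by auto
  show "g i X = 0" unfolding g_def by (rule partial_x_vanish[OF v v_supp assms])
  show "gt i X = 0" unfolding gt_def by (rule partial_x_vanish[OF vt vt_supp assms])
  show "A i j X = 0" unfolding A_def
    by (rule partial_x_vanish[OF x_smooth_partial[OF v] partial_x_vanish[OF v v_supp] assms])
qed

lemma A_sym: "A i j X = A j i X"
  unfolding A_def by (rule partial_x_commute[OF v])

lemma lip_diff_h: "lip_diff (xdir k) (h i j) (dh k i j)"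
  unfolding dh_def by (rule lip_diff_lipschitz[OF h_cont xdir_nonzero h_lip])
lemma lip_diff_G: "lip_diff (xdir i) (G i j) (dG i j)"
  unfolding dG_def by (rule lip_diff_lipschitz[OF G_cont xdir_nonzero G_lip])
lemma lip_diff_v: "lip_diff (xdir k) v (g k)" unfolding g_def by (rule x_smooth_lip_diff[OF v])
lemma lip_diff_vt: "lip_diff (xdir k) vt (gt k)" unfolding gt_def by (rule x_smooth_lip_diff[OF vt])
lemma lip_diff_g: "lip_diff (xdir k) (g j) (A j k)" unfolding A_def using x_smooth_lip_diff[OF x_smooth_g] by (simp add: g_def)
lemma lip_diff_A: "lip_diff (xdir k) (A i j) (partial_x k (A i j))" by (rule x_smooth_lip_diff[OF x_smooth_A])
lemma lip_diff_N: "lip_diff (xdir k) (N i) (dN k i)"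
  unfolding N_def[abs_def] dN_def[abs_def] by (intro lip_diff_sum lip_diff_mult lip_diff_h lip_diff_g)
lemma lip_diff_B: "lip_diff (xdir k) (B i) (dB k i)"
proof (rule lip_diff_cong)
  show "lip_diff (xdir k) (\<lambda>X. (1/2) * (\<Sum>j\<in>UNIV. h i j X * fst X $ j)) (\<lambda>X. (1/2) * (\<Sum>j\<in>UNIV. dh k i j X * fst X $ j + h i j X * (if j = k then 1 else 0)))"
    by (intro lip_diff_cmult lip_diff_sum lip_diff_mult lip_diff_h lip_diff_coordinate)
qed (simp_all add: B_def dB_def sum.distrib if_distrib[of "\<lambda>z. _ * z"] cong: if_cong)

lemma tm_cont: "continuous_on UNIV (\<lambda>s. c / tm s ^ k)"
  by (intro continuous_intros tm) (use tm(2) less_imp_neq[OF tm(2)] in \<open>auto dest: not_sym\<close>)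

lemma t_pos: "0 < t X" by (simp add: t_def tm)

text \<open>\<open>dq\<close> has the division by t^2 built in, hence the factor here. Symmetry of h
  merges the two derivatives of the outer coordinates into 4 B k.\<close>

lemma lip_diff_kap: "lip_diff (xdir k) kap (\<lambda>X. dq k X * (t X)\<^sup>2)"
proof (rule lip_diff_cong)
  show "lip_diff (xdir k) (\<lambda>X. (1/16) * ((\<Sum>i\<in>UNIV. (\<Sum>j\<in>UNIV. h i j X * fst X $ j) * fst X $ i) - 2 * (\<Sum>i\<in>UNIV. fst X $ i * fst X $ i)))
    (\<lambda>X. (1/16) * ((\<Sum>i\<in>UNIV. (\<Sum>j\<in>UNIV. dh k i j X * fst X $ j + h i j X * (if j = k then 1 else 0)) * fst X $ i + (\<Sum>j\<in>UNIV. h i j X * fst X $ j) * (if i = k then 1 else 0))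
      - 2 * (\<Sum>i\<in>UNIV. (if i = k then 1 else 0) * fst X $ i + fst X $ i * (if i = k then 1 else 0))))"
    by (intro lip_diff_cmult lip_diff_diff lip_diff_sum lip_diff_mult lip_diff_h lip_diff_coordinate)
  fix X :: "(real^'n) \<times> real"
  show "(1/16) * ((\<Sum>i\<in>UNIV. (\<Sum>j\<in>UNIV. h i j X * fst X $ j) * fst X $ i) - 2 * (\<Sum>i\<in>UNIV. fst X $ i * fst X $ i)) = kap X"
    by (simp add: kap_def power2_eq_square)
  have s1: "(\<Sum>j\<in>UNIV. dh k i j X * fst X $ j + h i j X * (if j = k then 1 else 0)) = (\<Sum>j\<in>UNIV. dh k i j X * fst X $ j) + h i k X" for i
    by (simp add: sum.distrib if_distrib[of "\<lambda>z. _ * z"] cong: if_cong)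
  have s2: "(\<Sum>i\<in>UNIV. h i k X * fst X $ i) = 2 * B k X" unfolding B_def using h_sym[of _ k X] by simp
  have s3: "(\<Sum>i\<in>UNIV. (\<Sum>j\<in>UNIV. h i j X * fst X $ j) * (if i = k then 1 else 0)) = 2 * B k X"
    by (simp add: B_def if_distrib[of "\<lambda>z. _ * z"] cong: if_cong)
  have s4: "(\<Sum>i\<in>UNIV. (if i = k then 1 else 0) * fst X $ i + fst X $ i * (if i = k then 1 else 0)) = 2 * fst X $ k"
    by (simp add: sum.distrib if_distrib[of "\<lambda>z. _ * z"] if_distrib[of "\<lambda>z. z * _"] cong: if_cong)
  show "(1/16) * ((\<Sum>i\<in>UNIV. (\<Sum>j\<in>UNIV. dh k i j X * fst X $ j + h i j X * (if j = k then 1 else 0)) * fst X $ i + (\<Sum>j\<in>UNIV. h i j X * fst X $ j) * (if i = k then 1 else 0))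
      - 2 * (\<Sum>i\<in>UNIV. (if i = k then 1 else 0) * fst X $ i + fst X $ i * (if i = k then 1 else 0))) = dq k X * (t X)\<^sup>2"
  proof -
    have e1: "(\<Sum>i\<in>UNIV. (\<Sum>j\<in>UNIV. dh k i j X * fst X $ j + h i j X * (if j = k then 1 else 0)) * fst X $ i + (\<Sum>j\<in>UNIV. h i j X * fst X $ j) * (if i = k then 1 else 0))
      = (\<Sum>i\<in>UNIV. (\<Sum>j\<in>UNIV. dh k i j X * fst X $ j) * fst X $ i) + 2 * B k X + 2 * B k X"
      unfolding s1 distrib_right sum.distrib[of _ _ UNIV] s2 s3 ..
    show ?thesis unfolding e1 s4 dq_def using t_pos[of X] by simp
  qed
qed

lemma lip_diff_q: "lip_diff (xdir k) q (dq k)"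
proof (rule lip_diff_cong)
  have "continuous_on UNIV (\<lambda>s. b * pw s / tm s)"
    by (intro continuous_intros pw tm) (use tm(2) less_imp_neq[OF tm(2)] in \<open>auto dest: not_sym\<close>)
  then show "lip_diff (xdir k) (\<lambda>X. (\<lambda>s. b * pw s / tm s) (snd X) + kap X * (\<lambda>s. 1 / tm s ^ 2) (snd X))
    (\<lambda>X. 0 + (dq k X * (t X)\<^sup>2 * (\<lambda>s. 1 / tm s ^ 2) (snd X) + kap X * 0))"
    by (intro lip_diff_add lip_diff_mult lip_diff_kap lip_diff_time tm_cont)
  fix X show "0 + (dq k X * (t X)\<^sup>2 * (\<lambda>s. 1 / tm s ^ 2) (snd X) + kap X * 0) = dq k X"
    using t_pos[of X] by (simp add: t_def)
qed (simp add: q_def t_def)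

lemma lip_diff_w: "lip_diff (xdir i) w (dw i)"
proof (rule lip_diff_cong)
  show "lip_diff (xdir i) (\<lambda>X. tm (snd X) * vt X + (\<Sum>k\<in>UNIV. B k X * g k X) + real CARD('n) / 4 * v X)
    (\<lambda>X. (0 * vt X + tm (snd X) * gt i X) + (\<Sum>k\<in>UNIV. dB i k X * g k X + B k X * A k i X) + real CARD('n) / 4 * g i X)"
    by (intro lip_diff_add lip_diff_mult lip_diff_time[of tm] tm lip_diff_vt lip_diff_sum lip_diff_B lip_diff_g lip_diff_cmult lip_diff_v)
qed (simp_all add: w_def dw_def t_def)

lemma lip_diff_Q: "lip_diff (xdir k) Q (dQ k)"
proof (rule lip_diff_cong)
  show "lip_diff (xdir k) (\<lambda>X. (\<Sum>i\<in>UNIV. N i X * g i X) - q X * (v X * v X))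
    (\<lambda>X. (\<Sum>i\<in>UNIV. dN k i X * g i X + N i X * A i k X) - (dq k X * (v X * v X) + q X * (g k X * v X + v X * g k X)))"
    by (intro lip_diff_diff lip_diff_sum lip_diff_mult lip_diff_N lip_diff_g lip_diff_q lip_diff_v)
qed (simp_all add: Q_def dQ_def power2_eq_square)

lemma lip_diff_m: "lip_diff (xdir k) m (\<lambda>X. 2 * fst X $ k / \<tau> X)"
proof (rule lip_diff_cong)
  have c: "continuous_on UNIV (\<lambda>s. 1 / sqrt (b * tm s))"
    by (intro continuous_intros tm) (use tm(2) b less_imp_neq[OF tm(2)] in \<open>auto dest: not_sym\<close>)
  have "continuous_on UNIV (\<lambda>s. p0 / 32 * th s)" by (intro continuous_intros th)
  then show "lip_diff (xdir k) (\<lambda>X. (\<Sum>i\<in>UNIV. fst X $ i * fst X $ i) * (\<lambda>s. 1 / sqrt (b * tm s)) (snd X) + (\<lambda>s. p0 / 32 * th s) (snd X))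
    (\<lambda>X. ((\<Sum>i\<in>UNIV. (if i = k then 1 else 0) * fst X $ i + fst X $ i * (if i = k then 1 else 0)) * (\<lambda>s. 1 / sqrt (b * tm s)) (snd X) + (\<Sum>i\<in>UNIV. fst X $ i * fst X $ i) * 0) + 0)"
    by (intro lip_diff_add lip_diff_mult lip_diff_sum lip_diff_time c lip_diff_coordinate)
  fix X :: "(real^'n) \<times> real"
  show "(\<Sum>i\<in>UNIV. fst X $ i * fst X $ i) * (\<lambda>s. 1 / sqrt (b * tm s)) (snd X) + (\<lambda>s. p0 / 32 * th s) (snd X) = m X"
    by (simp add: m_def \<tau>_def t_def power2_eq_square)
  show "((\<Sum>i\<in>UNIV. (if i = k then 1 else 0) * fst X $ i + fst X $ i * (if i = k then 1 else 0)) * (\<lambda>s. 1 / sqrt (b * tm s)) (snd X) + (\<Sum>i\<in>UNIV. fst X $ i * fst X $ i) * 0) + 0 = 2 * fst X $ k / \<tau> X"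
    by (simp add: \<tau>_def t_def sum.distrib if_distrib[of "\<lambda>z. _ * z"] if_distrib[of "\<lambda>z. z * _"] cong: if_cong)
qed

section \<open>Divergences in x and the time derivative\<close>

lemma S_borel: "S \<in> sets borel" unfolding S_def by (intro borel_Times) auto

text \<open>Coordinate directions in x leave the strip invariant, so no contribution arises from s =
  0 although v does not vanish there; a cylindrical support is enough because s is bounded on the
  strip.\<close>

lemma ibp:
  assumes "lip_diff (xdir k) F F'" "\<And>X. norm (fst X) > \<eta> \<Longrightarrow> F X = 0"
  shows "set_integrable lborel S F'" "(LINT X:S|lborel. F' X) = 0"
proof -
  have sup: "F X = 0" if "X \<in> S" "norm X > \<bar>\<eta>\<bar> + T" for X
  proof -
    have "norm X \<le> norm (fst X) + norm (snd X)" using norm_Pair_le[of "fst X" "snd X"] by simp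
    then have "norm (fst X) > \<eta>" using that by (auto simp: S_def)
    then show ?thesis using assms(2) by auto
  qed
  have inv: "X + r *\<^sub>R xdir k \<in> S \<longleftrightarrow> X \<in> S" for X r by (auto simp: S_def xdir_def mem_Times_iff)
  show "set_integrable lborel S F'" "(LINT X:S|lborel. F' X) = 0"
    using lip_diff_integral_zero[OF assms(1) S_borel inv sup] by auto
qed

lemma ibp_sum:
  assumes "\<And>i. lip_diff (xdir (k i)) (F i) (F' i)" "\<And>i X. norm (fst X) > \<eta> \<Longrightarrow> F i X = 0" "finite I"
  shows "set_integrable lborel S (\<lambda>X. \<Sum>i\<in>I. F' i X)" "(LINT X:S|lborel. (\<Sum>i\<in>I. F' i X)) = 0"
  using set_integral_sum_zero[of I lborel S F'] ibp[OF assms(1,2)] assms(3) by auto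

text \<open>The integrand is the divergence of the Pohozaev-type field 2 w N - Q B. The field B is
  not compactly supported, but N and Q are.\<close>

lemma D1_zero: "set_integrable lborel S D1" "(LINT X:S|lborel. D1 X) = 0"
proof -
  have "lip_diff (xdir i) (\<lambda>X. 2 * (N i X * w X) - B i X * Q X) (\<lambda>X. 2 * (dN i i X * w X + N i X * dw i X) - (dB i i X * Q X + B i X * dQ i X))" for i
    by (intro lip_diff_diff lip_diff_cmult lip_diff_mult lip_diff_N lip_diff_w lip_diff_B lip_diff_Q)
  note L = this
  have z: "2 * (N i X * w X) - B i X * Q X = 0" if "norm (fst X) > \<eta>" for i X
    using that by (simp add: N_def Q_def jet_supp)
  show "set_integrable lborel S D1" "(LINT X:S|lborel. D1 X) = 0"
    unfolding D1_def[abs_def] by (rule ibp_sum[where k = "\<lambda>i. i", OF L z]; simp)+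
qed

lemma D2_zero: "set_integrable lborel S D2" "(LINT X:S|lborel. D2 X) = 0"
proof -
  have "lip_diff (xdir i) (\<lambda>X. m X * v X * N i X) (\<lambda>X. (2 * fst X $ i / \<tau> X * v X + m X * g i X) * N i X + m X * v X * dN i i X)" for i
    by (intro lip_diff_mult lip_diff_N lip_diff_m lip_diff_v)
  note L = this
  have z: "m X * v X * N i X = 0" if "norm (fst X) > \<eta>" for i X
    using that by (simp add: jet_supp)
  show "set_integrable lborel S D2" "(LINT X:S|lborel. D2 X) = 0"
    unfolding D2_def[abs_def] by (rule ibp_sum[where k = "\<lambda>i. i", OF L z]; simp)+
qed

lemma third_sym: "partial_x i (A j i) X = partial_x j (A i i) X"
proof -
  have e: "A j i = A i j" using A_sym by auto
  have "partial_x i (partial_x j (g i)) X = partial_x j (partial_x i (g i)) X"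
    by (rule partial_x_commute[OF x_smooth_g])
  then show ?thesis unfolding e by (simp add: A_def g_def)
qed

text \<open>|D^2 v|^2 - (trace)^2 is the sum over i, j of the i-derivative of g_j A_ji minus the
  j-derivative of g_j A_ii; the third derivatives cancel by symmetry, which is why v has three of
  them. The factor t^2 depends on s alone and passes through the x-derivatives.\<close>

lemma D3_zero: "set_integrable lborel S (\<lambda>X. (t X)\<^sup>2 * D3 X)" "(LINT X:S|lborel. (t X)\<^sup>2 * D3 X) = 0"
proof -
  have c: "continuous_on UNIV (\<lambda>s. (tm s)\<^sup>2)" by (intro continuous_intros tm)
  have a1: "lip_diff (xdir i) (\<lambda>X. (tm (snd X))\<^sup>2 * (g j X * A j i X)) (\<lambda>X. 0 * (g j X * A j i X) + (tm (snd X))\<^sup>2 * (A j i X * A j i X + g j X * partial_x i (A j i) X))" for i j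
    by (intro lip_diff_mult lip_diff_time[OF c] lip_diff_g lip_diff_A)
  have a2: "lip_diff (xdir j) (\<lambda>X. (tm (snd X))\<^sup>2 * (g j X * A i i X)) (\<lambda>X. 0 * (g j X * A i i X) + (tm (snd X))\<^sup>2 * (A j j X * A i i X + g j X * partial_x j (A i i) X))" for i j
    by (intro lip_diff_mult lip_diff_time[OF c] lip_diff_g lip_diff_A)
  have z1: "set_integrable lborel S (\<lambda>X. 0 * (g j X * A j i X) + (tm (snd X))\<^sup>2 * (A j i X * A j i X + g j X * partial_x i (A j i) X))"
    "(LINT X:S|lborel. 0 * (g j X * A j i X) + (tm (snd X))\<^sup>2 * (A j i X * A j i X + g j X * partial_x i (A j i) X)) = 0" for i j
    using ibp[OF a1[of i j]] by (auto simp: jet_supp)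
  have z2: "set_integrable lborel S (\<lambda>X. 0 * (g j X * A i i X) + (tm (snd X))\<^sup>2 * (A j j X * A i i X + g j X * partial_x j (A i i) X))"
    "(LINT X:S|lborel. 0 * (g j X * A i i X) + (tm (snd X))\<^sup>2 * (A j j X * A i i X + g j X * partial_x j (A i i) X)) = 0" for i j
    using ibp[OF a2[of j i]] by (auto simp: jet_supp)
  have eq: "(t X)\<^sup>2 * D3 X = (\<Sum>i\<in>UNIV. \<Sum>j\<in>UNIV. (0 * (g j X * A j i X) + (tm (snd X))\<^sup>2 * (A j i X * A j i X + g j X * partial_x i (A j i) X))
      - (0 * (g j X * A i i X) + (tm (snd X))\<^sup>2 * (A j j X * A i i X + g j X * partial_x j (A i i) X)))" for X
  proof -
    have "(\<Sum>i\<in>UNIV. A i i X)\<^sup>2 = (\<Sum>i\<in>UNIV. \<Sum>j\<in>UNIV. A j j X * A i i X)"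
      by (simp add: power2_eq_square sum_distrib_left sum_distrib_right mult.commute)
    then have "D3 X = (\<Sum>i\<in>UNIV. \<Sum>j\<in>UNIV. (A j i X)\<^sup>2 - A j j X * A i i X)"
      unfolding D3_def sum_subtractf by (simp add: A_sym)
    then have "(t X)\<^sup>2 * D3 X = (\<Sum>i\<in>UNIV. \<Sum>j\<in>UNIV. (tm (snd X))\<^sup>2 * ((A j i X)\<^sup>2 - A j j X * A i i X))"
      by (simp add: sum_distrib_left t_def)
    also have "\<dots> = (\<Sum>i\<in>UNIV. \<Sum>j\<in>UNIV. (0 * (g j X * A j i X) + (tm (snd X))\<^sup>2 * (A j i X * A j i X + g j X * partial_x i (A j i) X))
      - (0 * (g j X * A i i X) + (tm (snd X))\<^sup>2 * (A j j X * A i i X + g j X * partial_x j (A i i) X)))"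
      by (intro sum.cong refl, subst third_sym) (simp add: algebra_simps power2_eq_square)
    finally show ?thesis .
  qed
  have "set_integrable lborel S (\<lambda>X. \<Sum>i\<in>UNIV. \<Sum>j\<in>UNIV. (0 * (g j X * A j i X) + (tm (snd X))\<^sup>2 * (A j i X * A j i X + g j X * partial_x i (A j i) X))
      - (0 * (g j X * A i i X) + (tm (snd X))\<^sup>2 * (A j j X * A i i X + g j X * partial_x j (A i i) X))) \<and>
    (LINT X:S|lborel. (\<Sum>i\<in>UNIV. \<Sum>j\<in>UNIV. (0 * (g j X * A j i X) + (tm (snd X))\<^sup>2 * (A j i X * A j i X + g j X * partial_x i (A j i) X))
      - (0 * (g j X * A i i X) + (tm (snd X))\<^sup>2 * (A j j X * A i i X + g j X * partial_x j (A i i) X)))) = 0"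
    using set_integral_diff[OF z1(1) z2(1)] z1(2) z2(2)
    by (intro set_integral_sum_zero conjI set_integral_sum_zero[THEN conjunct1] set_integral_sum_zero[THEN conjunct2]) auto
  then show "set_integrable lborel S (\<lambda>X. (t X)\<^sup>2 * D3 X)" "(LINT X:S|lborel. (t X)\<^sup>2 * D3 X) = 0"
    unfolding eq by auto
qed

lemma DERIV_E:
  assumes s: "0 < s" "s < T"
  shows "((\<lambda>s. t (x, s) * Q (x, s)) has_real_derivative dtE (x, s)) (at s)"
proof -
  have tn: "tm s \<noteq> 0" using tm(2)[of s] by simp
  have vd: "((\<lambda>s. v (x, s)) has_real_derivative vt (x, s)) (at s)" by (rule v_time[OF s])
  have gd: "((\<lambda>s. g i (x, s)) has_real_derivative gt i (x, s)) (at s)" for i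
    unfolding g_def gt_def by (rule g_time[OF s])
  have hs: "h i j (x, s') = h i j (x, s)" for i j s' by (rule h_time)
  have Nd: "((\<lambda>s. N i (x, s)) has_real_derivative (\<Sum>j\<in>UNIV. h i j (x, s) * gt j (x, s))) (at s)" for i
    unfolding N_def
  proof -
    have "((\<lambda>s'. \<Sum>j\<in>UNIV. h i j (x, s) * g j (x, s')) has_real_derivative (\<Sum>j\<in>UNIV. h i j (x, s) * gt j (x, s))) (at s)"
      by (intro DERIV_sum DERIV_cmult gd)
    moreover have "(\<lambda>s'. \<Sum>j\<in>UNIV. h i j (x, s') * g j (x, s')) = (\<lambda>s'. \<Sum>j\<in>UNIV. h i j (x, s) * g j (x, s'))"
      by (rule ext, intro sum.cong refl) (metis hs)
    ultimately show "((\<lambda>s'. \<Sum>j\<in>UNIV. h i j (x, s') * g j (x, s')) has_real_derivative (\<Sum>j\<in>UNIV. h i j (x, s) * gt j (x, s))) (at s)" by simp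
  qed
  have ks: "kap (x, s') = kap (x, s)" for s' unfolding kap_def by (simp only: hs[where s' = s'] fst_conv)
  have qd: "((\<lambda>s. q (x, s)) has_real_derivative qt (x, s)) (at s)"
  proof -
    have "((\<lambda>s'. b * pw s' / tm s' + kap (x, s) / (tm s')\<^sup>2) has_real_derivative qt (x, s)) (at s)"
      by (rule derivative_eq_intros pw(4)[OF s] tm(3)[OF s] refl | simp add: tn)+
         (use tn in \<open>simp add: qt_def t_def field_simps power2_eq_square power3_eq_cube power4_eq_xxxx\<close>)
    moreover have "(\<lambda>s'. q (x, s')) = (\<lambda>s'. b * pw s' / tm s' + kap (x, s) / (tm s')\<^sup>2)"
    proof
      fix s' show "q (x, s') = b * pw s' / tm s' + kap (x, s) / (tm s')\<^sup>2"
        unfolding q_def t_def ks[of s'] by simp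
    qed
    ultimately show ?thesis by simp
  qed
  have td: "((\<lambda>s. t (x, s)) has_real_derivative 1) (at s)" unfolding t_def using tm(3)[OF s] by simp
  have "((\<lambda>s. \<Sum>i\<in>UNIV. N i (x, s) * g i (x, s)) has_real_derivative
      (\<Sum>i\<in>UNIV. (\<Sum>j\<in>UNIV. h i j (x, s) * gt j (x, s)) * g i (x, s) + gt i (x, s) * N i (x, s))) (at s)"
    by (intro DERIV_sum DERIV_mult Nd gd)
  moreover have "((\<lambda>s. q (x, s) * (v (x, s))\<^sup>2) has_real_derivative qt (x, s) * (v (x, s))\<^sup>2 + (2 * v (x, s) * vt (x, s)) * q (x, s)) (at s)"
    by (rule DERIV_mult[OF qd]) (rule derivative_eq_intros vd refl | simp)+
  ultimately have "((\<lambda>s. Q (x, s)) has_real_derivative (\<Sum>i\<in>UNIV. (\<Sum>j\<in>UNIV. h i j (x, s) * gt j (x, s)) * g i (x, s) + gt i (x, s) * N i (x, s))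
      - (qt (x, s) * (v (x, s))\<^sup>2 + (2 * v (x, s) * vt (x, s)) * q (x, s))) (at s)"
    unfolding Q_def by (rule DERIV_diff)
  from DERIV_mult[OF td this] show ?thesis
    by (rule DERIV_cong) (simp add: dtE_def algebra_simps)
qed

lemma jet_continuous:
  "continuous_on UNIV v" "continuous_on UNIV vt" "continuous_on UNIV (g i)" "continuous_on UNIV (gt i)" "continuous_on UNIV (A i j)"
  "continuous_on UNIV (N i)" "continuous_on UNIV q" "continuous_on UNIV Q" "continuous_on UNIV t" "continuous_on UNIV kap"
  unfolding gt_def t_def[abs_def]
  by (rule lip_diff_continuous[OF lip_diff_v] lip_diff_continuous[OF lip_diff_vt] lip_diff_continuous[OF lip_diff_g] x_smooth_continuous[OF x_smooth_partial[OF vt]]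
    lip_diff_continuous[OF lip_diff_A] lip_diff_continuous[OF lip_diff_N] lip_diff_continuous[OF lip_diff_q] lip_diff_continuous[OF lip_diff_Q] lip_diff_continuous[OF lip_diff_kap]
    lip_diff_continuous[OF lip_diff_time[OF tm(1)]])+

lemma cont_time: "continuous_on UNIV (\<lambda>X. pw (snd X))" "continuous_on UNIV (\<lambda>X. th (snd X))"
  by (auto intro!: continuous_on_compose2[OF pw(1)] continuous_on_compose2[OF th(1)] continuous_intros)

lemma t_nonzero: "t X \<noteq> 0" using t_pos[of X] by simp

text \<open>Since v vanishes on the whole slice s = T, so do its x-derivatives there, and only the
  slice s = 0 contributes.\<close>

lemma dtE_integral:
  "set_integrable lborel S dtE"
  "(LINT X:S|lborel. dtE X) = - (\<integral>x. t (x, 0) * Q (x, 0) \<partial>lborel)"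
proof -
  have c1: "continuous_on UNIV (\<lambda>X. t X * Q X)" by (intro continuous_intros jet_continuous)
  have c2: "continuous_on UNIV dtE"
    unfolding dtE_def[abs_def] qt_def by (intro continuous_intros jet_continuous cont_time h_cont) (auto simp: t_nonzero)
  have z: "t (x, s) * Q (x, s) = 0" "dtE (x, s) = 0" if "norm x > \<eta>" for x s
    using jet_supp[of "(x, s)"] that by (simp_all add: dtE_def Q_def)
  note I = integral_time_derivative[where R = \<eta>, OF c1 c2 T DERIV_E z, folded S_def]
  show "set_integrable lborel S dtE" using I(1) .
  have "g i (x, T) = 0" for i x
  proof -
    have "g i (x, T) = partial_x i (\<lambda>X. 0) (x, T)"
      unfolding g_def by (rule partial_x_cong) (simp add: xdir_def v_end)
    also have "\<dots> = 0" by (rule partial_x_unique) simp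
    finally show ?thesis .
  qed
  then have e: "t (x, T) * Q (x, T) = 0" for x by (simp add: Q_def v_end)
  then show "(LINT X:S|lborel. dtE X) = - (\<integral>x. t (x, 0) * Q (x, 0) \<partial>lborel)"
  proof -
    have "(LINT X:S|lborel. dtE X) = (\<integral>x. t (x, T) * Q (x, T) - t (x, 0) * Q (x, 0) \<partial>lborel)" by (rule I(2))
    also have "\<dots> = (\<integral>x. - (t (x, 0) * Q (x, 0)) \<partial>lborel)" by (simp only: e diff_0)
    also have "\<dots> = - (\<integral>x. t (x, 0) * Q (x, 0) \<partial>lborel)" by (rule integral_minus)
    finally show ?thesis .
  qed
qed

text \<open>The third summand is kept because the weighted gradient of u differs from \<nabla>v by x
  v / (4t), whose square it controls.\<close>

definition lower where
  "lower X = b * th (snd X) / t X * (v X)\<^sup>2 + th (snd X) * (norm (\<chi> i. g i X))\<^sup>2 + th (snd X) * (norm (fst X))\<^sup>2 / (t X)\<^sup>2 * (v X)\<^sup>2"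

lemma norm_sq: "(norm (\<chi> i. g i X))\<^sup>2 = (\<Sum>i\<in>UNIV. (g i X)\<^sup>2)"
  by (simp add: norm_sq_sum)

lemma lower_integrable: "set_integrable lborel S lower"
  unfolding S_def
proof (rule set_integrable_strip[where R = \<eta>])
  show "continuous_on UNIV lower" unfolding lower_def[abs_def] norm_sq
    by (intro continuous_intros jet_continuous cont_time) (auto simp: t_nonzero)
  show "lower X = 0" if "norm (fst X) > \<eta>" for X
    unfolding lower_def norm_sq using that by (simp add: jet_supp)
qed

lemma good_points:
  "AE X in lborel. (\<forall>k i j. \<bar>dh k i j X\<bar> \<le> a) \<and> (\<forall>i j. \<bar>dG i j X\<bar> \<le> a)"
proof -
  have 1: "AE X in lborel. \<bar>dh k i j X\<bar> \<le> a" for k i j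
  proof -
    have "AE X in lborel. ((\<lambda>r. h i j (X + r *\<^sub>R xdir k)) has_real_derivative dh k i j X) (at 0)"
      using lip_diff_h unfolding lip_diff_def by auto
    then show ?thesis by eventually_elim (rule derivative_le_of_lipschitz[OF _ h_lip])
  qed
  have 2: "AE X in lborel. \<bar>dG i j X\<bar> \<le> a" for i j
  proof -
    have "AE X in lborel. ((\<lambda>r. G i j (X + r *\<^sub>R xdir i)) has_real_derivative dG i j X) (at 0)"
      using lip_diff_G unfolding lip_diff_def by auto
    then show ?thesis by eventually_elim (rule derivative_le_of_lipschitz[OF _ G_lip])
  qed
  show ?thesis unfolding AE_conj_iff AE_all_countable using 1 2 by blast
qed

lemma U_continuous: "continuous_on UNIV (U j)" "continuous_on UNIV (U2 i j)" "continuous_on UNIV Ut"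
  unfolding U_def[abs_def] U2_def[abs_def] Ut_def[abs_def]
  by (intro continuous_intros jet_continuous cont_time; simp add: t_nonzero)+

text \<open>f contains the derivatives of the coefficients, which are only measurable and only
  almost everywhere bounded by a; the continuous majorant K replaces them by that bound.\<close>

lemma f_integrable: "set_integrable lborel S (\<lambda>X. t X * (f X)\<^sup>2)"
proof -
  define K where "K X = (\<Sum>i\<in>UNIV. \<Sum>j\<in>UNIV. a * \<bar>U j X\<bar> + \<bar>G i j X\<bar> * \<bar>U2 i j X\<bar>) + \<bar>Ut X\<bar>" for X
  have K: "set_integrable lborel S (\<lambda>X. t X * (K X)\<^sup>2)" unfolding S_def
  proof (rule set_integrable_strip[where R = \<eta>])
    show "continuous_on UNIV (\<lambda>X. t X * (K X)\<^sup>2)" unfolding K_def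
      by (intro continuous_intros jet_continuous U_continuous G_cont)
    show "t X * (K X)\<^sup>2 = 0" if "norm (fst X) > \<eta>" for X
      using that by (simp add: K_def U_def U2_def Ut_def jet_supp)
  qed
  have m: "dG i j \<in> borel_measurable borel" for i j using lip_diff_G unfolding lip_diff_def by auto
  note [measurable] = m U_continuous[THEN borel_measurable_continuous_onI] G_cont[THEN borel_measurable_continuous_onI] jet_continuous(9)[THEN borel_measurable_continuous_onI] S_borel
  show ?thesis
  proof (rule set_integrable_bound[OF K])
    show "set_borel_measurable lborel S (\<lambda>X. t X * (f X)\<^sup>2)"
      unfolding set_borel_measurable_def f_def[abs_def] by measurable
    show "AE X in lborel. X \<in> S \<longrightarrow> norm (t X * (f X)\<^sup>2) \<le> norm (t X * (K X)\<^sup>2)"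
      using good_points
    proof eventually_elim
      case (elim X)
      have "\<bar>f X\<bar> \<le> \<bar>\<Sum>i\<in>UNIV. \<Sum>j\<in>UNIV. dG i j X * U j X + G i j X * U2 i j X\<bar> + \<bar>Ut X\<bar>" unfolding f_def by (rule abs_triangle_ineq)
      also have "\<dots> \<le> (\<Sum>i\<in>UNIV. \<Sum>j\<in>UNIV. \<bar>dG i j X * U j X + G i j X * U2 i j X\<bar>) + \<bar>Ut X\<bar>"
        by (intro add_right_mono order.trans[OF sum_abs] sum_mono) auto
      also have "\<dots> \<le> K X" unfolding K_def
        by (intro add_right_mono sum_mono order.trans[OF abs_triangle_ineq] add_mono) (use elim in \<open>auto simp: abs_mult intro!: mult_right_mono\<close>)
      finally have "(f X)\<^sup>2 \<le> (K X)\<^sup>2" by (metis abs_le_square_iff abs_ge_self order_trans)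
      then show ?case using t_pos[of X] by (simp add: abs_mult mult_left_mono)
    qed
  qed
qed

lemma pointwise:
  assumes X: "X \<in> S" and good: "(\<forall>k i j. \<bar>dh k i j X\<bar> \<le> a) \<and> (\<forall>i j. \<bar>dG i j X\<bar> \<le> a)"
  shows "p0 / 4096 * lower X \<le> 3 * (t X * (f X)\<^sup>2) + dtE X - D1 X + D2 X + 6 * M * ((t X)\<^sup>2 * D3 X)"
proof (cases "norm (fst X) \<le> \<eta>")
  \<comment> \<open>The coefficients are close to the identity only for |x| <= \<eta>; beyond that
    radius the jet vanishes and both sides are 0.\<close>
  case False
  then show ?thesis
    unfolding lower_def norm_sq using jet_supp[of X] by (simp add: f_def U_def U2_def Ut_def dtE_def Q_def D1_def D2_def D3_def dN_def N_def w_def dw_def dQ_def)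
next
  case True
  define Y where "Y = norm (fst X)"
  define \<gamma> where "\<gamma> = norm (\<chi> i. g i X)"
  have x: "\<And>i. \<bar>fst X $ i\<bar> \<le> Y" "(\<Sum>i\<in>UNIV. (fst X $ i)\<^sup>2) = Y\<^sup>2"
    unfolding Y_def using component_le_norm_cart by (auto simp: norm_vec_def L2_set_def sum_nonneg)
  have gg: "\<And>i. \<bar>g i X\<bar> \<le> \<gamma>" "(\<Sum>i\<in>UNIV. (g i X)\<^sup>2) = \<gamma>\<^sup>2"
    unfolding \<gamma>_def norm_sq using component_le_norm_cart[of "\<chi> i. g i X"] by auto
  have hn: "\<bar>h i j X - (if i = j then 1 else 0)\<bar> \<le> a * Y" for i j using h_near unfolding Y_def .
  have sm: "(real CARD('n))\<^sup>2 * (a * Y) \<le> 1 / 4"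
  proof -
    have "(real CARD('n))\<^sup>2 * (a * Y) \<le> (real CARD('n))\<^sup>2 * (a * \<eta>)" using True a unfolding Y_def by (intro mult_left_mono) auto
    then show ?thesis using small by linarith
  qed
  have gn: "\<bar>G i j X - h i j X\<bar> \<le> a * sqrt (t X)" for i j using X G_near unfolding S_def t_def by auto
  have tp: "0 < \<tau> X" "(\<tau> X)\<^sup>2 = b * t X" "\<tau> X \<le> \<epsilon> * th (snd X)"
    using t_pos[of X] b tau[of "snd X"] by (auto simp: \<tau>_def t_def)
  have "p0 / 4096 * (b * th (snd X) / t X * (v X)\<^sup>2 + th (snd X) * \<gamma>\<^sup>2 + th (snd X) * Y\<^sup>2 / (t X)\<^sup>2 * (v X)\<^sup>2)
      \<le> 3 * t X * (f X)\<^sup>2 + dtE X - D1 X + D2 X + 6 * M * (t X)\<^sup>2 * D3 X"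
    by (rule pointwise_carleman[where h = "\<lambda>i j. h i j X" and dh = "\<lambda>k i j. dh k i j X" and x = "\<lambda>i. fst X $ i" and g = "\<lambda>i. g i X"
          and A = "\<lambda>i j. A i j X" and G = "\<lambda>i j. G i j X" and dG = "\<lambda>i j. dG i j X" and N = "\<lambda>i. N i X" and dN = "\<lambda>k i. dN k i X" and B = "\<lambda>i. B i X"
          and dB = "\<lambda>k i. dB k i X" and dw = "\<lambda>i. dw i X" and dQ = "\<lambda>i. dQ i X" and dq = "\<lambda>k. dq k X" and gt = "\<lambda>i. gt i X" and U = "\<lambda>j. U j X" and ?U2.0 = "\<lambda>i j. U2 i j X"
          and kap = "kap X" and qt = "qt X" and w = "w X" and Q = "Q X" and q = "q X" and Ut = "Ut X" and m = "m X" and vt = "vt X" and a = a and p = "pw (snd X)" and \<tau> = "\<tau> X",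
          OF x gg a hn _ sm h_sym A_sym gn])
       (use good tp t_pos b p0 pw th M \<epsilon> in \<open>auto simp: N_def dN_def B_def dB_def w_def dw_def Q_def dQ_def dtE_def D1_def kap_def q_def qt_def dq_def U_def U2_def Ut_def f_def m_def D2_def D3_def\<close>)
  then show ?thesis unfolding lower_def Y_def \<gamma>_def by (simp add: mult.assoc)
qed

lemma carleman_integrated:
  "p0 / 4096 * (LINT X:S|lborel. lower X) \<le> 3 * (LINT X:S|lborel. t X * (f X)\<^sup>2) - (\<integral>x. t (x, 0) * Q (x, 0) \<partial>lborel)"
proof -
  have i1: "set_integrable lborel S (\<lambda>X. p0 / 4096 * lower X)" by (rule set_integrable_mult_right) (use lower_integrable in auto)
  have i2: "set_integrable lborel S (\<lambda>X. 3 * (t X * (f X)\<^sup>2))" by (rule set_integrable_mult_right) (use f_integrable in auto)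
  have i3: "set_integrable lborel S (\<lambda>X. 6 * M * ((t X)\<^sup>2 * D3 X))" by (rule set_integrable_mult_right) (use D3_zero in auto)
  note j1 = set_integral_add[OF i2 dtE_integral(1)]
  note j2 = set_integral_diff[OF j1(1) D1_zero(1)]
  note j3 = set_integral_add[OF j2(1) D2_zero(1)]
  note j4 = set_integral_add[OF j3(1) i3]
  have "(LINT X:S|lborel. p0 / 4096 * lower X) \<le> (LINT X:S|lborel. 3 * (t X * (f X)\<^sup>2) + dtE X - D1 X + D2 X + 6 * M * ((t X)\<^sup>2 * D3 X))"
    by (rule set_integral_mono_AE[OF i1 j4(1)]) (use good_points pointwise in \<open>auto elim!: AE_mp\<close>)
  also have "\<dots> = 3 * (LINT X:S|lborel. t X * (f X)\<^sup>2) - (\<integral>x. t (x, 0) * Q (x, 0) \<partial>lborel)"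
    unfolding j4(2) j3(2) j2(2) j1(2) set_integral_mult_right dtE_integral(2) D1_zero(2) D2_zero(2) D3_zero(2) by simp
  finally show ?thesis by simp
qed

end

section \<open>The Carleman inequality\<close>

text \<open>The integrand P u uses \<open>deriv\<close>, unspecified on a null set, so it is not
  known to be Borel. Completeness of Lebesgue measure lets a Borel function that agrees almost
  everywhere take its place.\<close>

lemma integral_lebesgue_cong_AE:
  fixes F K :: "'a::euclidean_space \<Rightarrow> real"
  assumes K: "K \<in> borel_measurable borel" and eq: "AE x in lborel. F x = K x"
  shows "(\<integral>x. F x \<partial>lebesgue) = (\<integral>x. K x \<partial>lborel)"
proof -
  have ae: "AE x in lebesgue. F x = K x" using eq by (rule AE_completion)
  have "F \<in> borel_measurable lebesgue"
  proof (rule measurableI)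
    fix B :: "real set" assume B: "B \<in> sets borel"
    have "K -` B \<inter> space lebesgue \<in> sets lebesgue"
      by (rule measurable_sets[OF _ B]) (use K in \<open>auto intro: measurable_completion\<close>)
    then show "F -` B \<inter> space lebesgue \<in> sets lebesgue"
      by (rule completion.in_sets_AE[rotated]) (use ae in \<open>auto elim: eventually_mono\<close>)
  qed auto
  then have "(\<integral>x. F x \<partial>lebesgue) = (\<integral>x. K x \<partial>lebesgue)"
    by (intro integral_cong_AE ae) (use K in \<open>auto intro: measurable_completion\<close>)
  also have "\<dots> = (\<integral>x. K x \<partial>lborel)" by (rule integral_completion) (use K in auto)
  finally show ?thesis .
qed

text \<open>Bridge from the integrals of the theorem over the half-space to Borel integrals over the
  strip on which the jet lives.\<close>

lemma half_space_integral:
  fixes F K :: "(real^'n::finite) \<times> real \<Rightarrow> real"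
  assumes K: "K \<in> borel_measurable borel" and eq: "AE X in lborel. X \<in> UNIV \<times> {0<..<T} \<longrightarrow> F X = K X"
    and z: "\<And>X. 0 < snd X \<Longrightarrow> T \<le> snd X \<Longrightarrow> F X = 0"
  shows "(LINT X:open_half_space|lebesgue. F X) = (LINT X:UNIV \<times> {0<..<T}|lborel. K X)"
  unfolding set_lebesgue_integral_def
proof (rule integral_lebesgue_cong_AE)
  have [measurable]: "UNIV \<times> {0<..<T} \<in> sets (borel :: ((real^'n) \<times> real) measure)" by (intro borel_Times) auto
  show "(\<lambda>X. indicator (UNIV \<times> {0<..<T}) X *\<^sub>R K X) \<in> borel_measurable borel" using K by measurable
  show "AE X in lborel. indicator open_half_space X *\<^sub>R F X = indicator (UNIV \<times> {0<..<T}) X *\<^sub>R K X"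
    using eq
  proof eventually_elim
    case (elim X)
    then show ?case using z[of X] by (cases X) (auto simp: open_half_space_def split: split_indicator)
  qed
qed

lemma quadratic_form_inner:
  fixes G :: "real^'n^'n"
  shows "(\<Sum>i\<in>UNIV. \<Sum>j\<in>UNIV. G $ i $ j * \<xi> $ i * \<xi> $ j) = \<xi> \<bullet> (G *v \<xi>)"
  by (simp add: inner_vec_def matrix_vector_mult_def sum_distrib_left mult_ac)

text \<open>Positivity of the form makes the matrix invertible, and the metric then cancels one of
  the two factors hidden in the g-gradient.\<close>

lemma norm_g_sq_grad_g:
  fixes G :: "(real^'n::finite) \<times> real \<Rightarrow> real^'n^'n"
  assumes pos: "\<And>\<xi>. lam * (norm \<xi>)\<^sup>2 \<le> (\<Sum>i\<in>UNIV. \<Sum>j\<in>UNIV. G X $ i $ j * \<xi> $ i * \<xi> $ j)" and lam: "0 < lam"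
  shows "norm_g_sq G X (grad_g G u X) = grad_x u X \<bullet> (G X *v grad_x u X)"
proof -
  have "\<xi> = 0" if "G X *v \<xi> = 0" for \<xi>
  proof -
    have "lam * (norm \<xi>)\<^sup>2 \<le> 0" using pos[of \<xi>] that by (simp add: quadratic_form_inner)
    then have "(norm \<xi>)\<^sup>2 \<le> 0" using lam by (simp add: mult_le_0_iff)
    then show ?thesis by simp
  qed
  then have "invertible (G X)" using matrix_left_invertible_ker[of "G X"] invertible_left_inverse by blast
  then have "matrix_inv (G X) ** G X = mat 1"
    unfolding invertible_def matrix_inv_def by (rule someI2_ex) simp
  then have "matrix_inv (G X) *v (G X *v \<xi>) = \<xi>" for \<xi>
    by (simp add: matrix_vector_mul_assoc)
  then show ?thesis
    unfolding norm_g_sq_def quadratic_form_inner grad_g_def by (simp add: inner_commute)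
qed

text \<open>An x-derivative multiplies w by a function linear in x, so regularity of order k for w
  gives regularity of order k + 1.\<close>

lemma x_smooth_gaussian:
  fixes c d :: "real \<Rightarrow> real"
  assumes c: "continuous_on UNIV c" and d: "continuous_on UNIV d"
  defines "w \<equiv> \<lambda>X::(real^'n::finite) \<times> real. exp (d (snd X) - (\<Sum>i\<in>UNIV. (fst X $ i)\<^sup>2) * c (snd X))"
  shows "x_smooth k w" "((\<lambda>r. w (X + r *\<^sub>R xdir i)) has_real_derivative - 2 * fst X $ i * c (snd X) * w X) (at 0)"
proof -
  have dw: "((\<lambda>r. w (X + r *\<^sub>R xdir i)) has_real_derivative - 2 * fst X $ i * c (snd X) * w X) (at 0)" for X i
  proof -
    have x: "((\<lambda>r. fst (X + r *\<^sub>R xdir i) $ j) has_real_derivative (if i = j then 1 else 0)) (at 0)" for j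
      by (auto simp: xdir_def axis_def intro!: derivative_eq_intros)
    have "((\<lambda>r. \<Sum>j\<in>UNIV. (fst (X + r *\<^sub>R xdir i) $ j)\<^sup>2) has_real_derivative (\<Sum>j\<in>UNIV. 2 * fst X $ j * (if i = j then 1 else 0))) (at 0)"
      by (intro DERIV_sum, rule DERIV_cong[OF DERIV_power[OF x, where n = 2]]) simp
    moreover have "(\<Sum>j\<in>UNIV. 2 * fst X $ j * (if i = j then 1 else 0)) = 2 * fst X $ i"
      by (simp add: if_distrib[of "\<lambda>z. _ * z"] cong: if_cong)
    ultimately have s: "((\<lambda>r. \<Sum>j\<in>UNIV. (fst (X + r *\<^sub>R xdir i) $ j)\<^sup>2) has_real_derivative 2 * fst X $ i) (at 0)" by simp
    have "((\<lambda>r. exp (d (snd X) - (\<Sum>j\<in>UNIV. (fst (X + r *\<^sub>R xdir i) $ j)\<^sup>2) * c (snd X))) has_real_derivative - 2 * fst X $ i * c (snd X) * w X) (at 0)"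
      by (rule derivative_eq_intros s refl | simp add: w_def)+
    moreover have sn: "snd (X + r *\<^sub>R xdir i) = snd X" for r by (simp add: xdir_def)
    ultimately show ?thesis unfolding w_def sn by (simp only:)
  qed
  then show "((\<lambda>r. w (X + r *\<^sub>R xdir i)) has_real_derivative - 2 * fst X $ i * c (snd X) * w X) (at 0)" .
  show "x_smooth k w"
  proof (induction k)
    case 0
    have "continuous_on UNIV (\<lambda>X::(real^'n) \<times> real. d (snd X))" "continuous_on UNIV (\<lambda>X::(real^'n) \<times> real. c (snd X))"
      by (auto intro!: continuous_on_compose2[OF c] continuous_on_compose2[OF d] continuous_intros)
    then show ?case unfolding w_def by (auto intro!: continuous_intros)
  next
    case (Suc k)
    show ?case
    proof (rule x_smooth_SucI(1)[OF _ dw])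
      show "continuous_on UNIV w" using Suc by (rule x_smooth_continuous)
      show "x_smooth k (\<lambda>X. - 2 * fst X $ i * c (snd X) * w X)" for i
        by (intro x_smooth_mult x_smooth_const x_smooth_coordinate x_smooth_time c Suc)
    qed
  qed
qed

text \<open>The radius gives n^2 Lam \<eta> <= 1/4. The bound on \<delta> makes \<epsilon> =
  \<open>10 * \<delta>\<close> satisfy \<epsilon> M^2 10^7 <= exp (-60) with M = 24 n^4 (1 + Lam)^2,
  where exp (-60) is the lower bound of the weight exponent.\<close>

locale carleman_setting =
  fixes G :: "(real^'n::finite) \<times> real \<Rightarrow> real^'n^'n" and u :: "(real^'n) \<times> real \<Rightarrow> real"
    and lam Lam \<alpha> \<delta> a0 :: real
  assumes lam: "0 < lam" "lam \<le> 1" and Lam: "0 < Lam" and adm: "admissible_coeff lam Lam G"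
    and \<alpha>: "2 \<le> \<alpha>" and \<delta>: "0 < \<delta>" "\<delta> \<le> exp (-60) / ((24 * real CARD('n)^4 * (1 + Lam)\<^sup>2)\<^sup>2 * 10^8)"
    and a0: "0 < a0" "a0 \<le> \<delta>\<^sup>2 / (4 * \<alpha>)"
    and u: "Cinf_compact_on closed_half_space u"
    and u_supp: "supp_on closed_half_space u \<subseteq> ball 0 (1 / (4 * (real CARD('n))\<^sup>2 * (Lam + 1))) \<times> {0..<\<delta>\<^sup>2 / (2 * \<alpha>)}"
begin

definition \<gamma> where "\<gamma> = \<alpha> / \<delta>\<^sup>2"
definition T where "T = \<delta>\<^sup>2 / (2 * \<alpha>)"
text \<open>The half makes the squared weight \<sigma>^(-2\<alpha>-1) times the Gaussian. A further
  factor t/\<sigma> turns t f^2 into the right-hand side of the theorem, with power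
  -2\<alpha>-2.\<close>

definition b where "b = \<alpha> + 1/2"
definition \<eta> where "\<eta> = 1 / (4 * (real CARD('n))\<^sup>2 * (Lam + 1))"
text \<open>Clamping before the shift keeps \<gamma> times this time between 0 and 3/4 for every
  real s, so all weights are defined and continuous on the whole space.\<close>

definition tm where "tm s = time_clamp T s + a0"
definition pw where "pw s = weight_exponent (\<gamma> * tm s)"
definition th where "th s = theta (\<gamma> * tm s)"
definition \<sigma> where "\<sigma> s = weight_sigma \<gamma> (tm s)"
definition \<omega> where "\<omega> X = exp (- b * ln (\<sigma> (snd X)) - (\<Sum>i\<in>UNIV. (fst X $ i)\<^sup>2) * (1 / (8 * tm (snd X))))" for X :: "(real^'n) \<times> real"
definition uh where "uh = clamp_ext T u"
definition ut where "ut = clamp_ext T (half_deriv (0, 1) u)"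
text \<open>Minus the logarithmic derivative of \<omega> in time.\<close>

definition \<phi>s where "\<phi>s X = b * pw (snd X) / tm (snd X) - (\<Sum>i\<in>UNIV. (fst X $ i)\<^sup>2) / (8 * (tm (snd X))\<^sup>2)" for X :: "(real^'n) \<times> real"
definition v where "v X = \<omega> X * uh X"
definition vt where "vt X = \<omega> X * (ut X - \<phi>s X * uh X)"
definition h where "h i j X = G (fst X, 0) $ i $ j" for X :: "(real^'n) \<times> real"
definition G' where "G' i j X = G X $ i $ j"

lemma parameter_bounds: "0 < \<gamma>" "0 < T" "1 \<le> b" "0 < \<eta>" "b \<le> 2 * \<alpha>" "b \<le> 5 / 4 * \<alpha>"
  using \<alpha> \<delta> Lam by (auto simp: \<gamma>_def T_def b_def \<eta>_def)

lemma tm: "0 < tm s" "a0 \<le> tm s" "\<gamma> * tm s \<le> 3 / 4" "0 < \<gamma> * tm s" "\<gamma> * tm s < 1"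
proof -
  have "0 \<le> time_clamp T s" "time_clamp T s \<le> T" using time_clamp_bounds[of T s] parameter_bounds by auto
  then show 1: "0 < tm s" "a0 \<le> tm s" using a0 by (auto simp: tm_def)
  have "tm s \<le> \<delta>\<^sup>2 / (2 * \<alpha>) + \<delta>\<^sup>2 / (4 * \<alpha>)" unfolding tm_def using \<open>time_clamp T s \<le> T\<close> a0 by (simp add: T_def)
  then have "\<gamma> * tm s \<le> \<gamma> * (\<delta>\<^sup>2 / (2 * \<alpha>) + \<delta>\<^sup>2 / (4 * \<alpha>))" using parameter_bounds by (intro mult_left_mono) auto
  also have "\<dots> = 3 / 4" using \<alpha> \<delta> by (simp add: \<gamma>_def field_simps)
  finally show "\<gamma> * tm s \<le> 3 / 4" .
  then show "\<gamma> * tm s < 1" by simp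
  show "0 < \<gamma> * tm s" using 1 parameter_bounds by simp
qed

lemma tm_eq: "0 \<le> s \<Longrightarrow> s \<le> T \<Longrightarrow> tm s = s + a0"
  by (simp add: tm_def time_clamp_eq)

lemma tm_deriv: assumes "0 < s" "s < T" shows "(tm has_real_derivative 1) (at s)"
proof -
  have "((\<lambda>s. s + a0) has_real_derivative 1) (at s)" by (rule derivative_eq_intros refl | simp)+
  moreover have "\<forall>\<^sub>F r in nhds s. tm r = r + a0"
    by (rule eventually_mono[OF eventually_nhds_in_open[of "{0<..<T}"]]) (use assms tm_eq in auto)
  ultimately show ?thesis by (subst DERIV_cong_ev[OF refl _ refl])
qed

lemma tm_cont: "continuous_on UNIV tm"
  unfolding tm_def[abs_def] by (intro continuous_intros continuous_time_clamp)

lemma sigma: "0 < \<sigma> s" "\<sigma> s \<le> tm s" "exp (-240) * tm s \<le> \<sigma> s"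
  using weight_sigma_properties[OF parameter_bounds(1) tm(1) tm(5)] unfolding \<sigma>_def by auto

lemma ln_sigma_deriv:
  assumes "0 < s" "s < T" shows "((\<lambda>s. ln (\<sigma> s)) has_real_derivative pw s / tm s) (at s)"
  using DERIV_chain2[OF weight_sigma_properties(1)[OF parameter_bounds(1) tm(1) tm(5)] tm_deriv[OF assms]]
  by (simp add: \<sigma>_def pw_def)

lemma ln_sigma_cont: "continuous_on UNIV (\<lambda>s. ln (\<sigma> s))"
proof -
  have "continuous_on {t. 0 < t \<and> \<gamma> * t < 1} (\<lambda>t. ln (weight_sigma \<gamma> t))"
    by (intro continuous_at_imp_continuous_on ballI DERIV_isCont[OF weight_sigma_properties(1)[OF parameter_bounds(1)]]) auto
  then show ?thesis unfolding \<sigma>_def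
    by (rule continuous_on_compose2[OF _ tm_cont]) (use tm in auto)
qed

lemma sigma_cont: "continuous_on UNIV \<sigma>"
proof -
  have "continuous_on UNIV (\<lambda>s. exp (ln (\<sigma> s)))" by (intro continuous_intros ln_sigma_cont)
  then show ?thesis using sigma(1) by simp
qed

lemma pw_deriv: assumes "0 < s" "s < T" shows "(pw has_real_derivative - pw s * th s / tm s) (at s)"
proof -
  have "((\<lambda>s. \<gamma> * tm s) has_real_derivative \<gamma> * 1) (at s)" by (rule DERIV_cmult[OF tm_deriv[OF assms]])
  from DERIV_chain2[where f = weight_exponent, OF weight_exponent(1)[OF tm(4) tm(5)] this] show ?thesis
    unfolding pw_def[abs_def] th_def using parameter_bounds(1) by (simp add: field_simps)
qed

lemma pw_cont: "continuous_on UNIV pw"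
proof -
  have "continuous_on {0<..<1} weight_exponent"
    by (intro continuous_at_imp_continuous_on ballI DERIV_isCont[OF weight_exponent(1)]) auto
  then show ?thesis unfolding pw_def
    by (rule continuous_on_compose2) (use tm in \<open>auto intro!: continuous_intros tm_cont\<close>)
qed

lemma th_cont: "continuous_on UNIV th"
  unfolding th_def by (rule continuous_on_compose2[OF continuous_on_theta]) (use tm in \<open>auto intro!: continuous_intros tm_cont\<close>)

text \<open>For the third bound, \<alpha> >= 2 gives b <= 5/4 \<alpha>, and \<alpha> t = \<delta>^2
  \<gamma> t by the choice of \<gamma>. Hence sqrt(b t) <= 5/4 \<delta> sqrt(\<gamma> t), and the
  lower bound sqrt(r)/8 for theta turns 5/4 into 10.\<close>

lemma th: "0 < th s" "th s \<le> 15" "sqrt (b * tm s) \<le> 10 * \<delta> * th s"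
proof -
  have ge: "sqrt (\<gamma> * tm s) / 8 \<le> th s" unfolding th_def by (rule theta_ge_sqrt[OF tm(4) tm(3)])
  moreover have "0 < sqrt (\<gamma> * tm s)" using tm(4) by simp
  ultimately show "0 < th s" by linarith
  show "th s \<le> 15" unfolding th_def using theta_bounds(2)[OF tm(4)] tm(5)[of s] by simp
  have "b * tm s \<le> 5/4 * \<alpha> * tm s" using parameter_bounds(6) tm(1)[of s] by (intro mult_right_mono) auto
  also have "\<dots> = 5/4 * (\<delta>\<^sup>2 * (\<gamma> * tm s))" using \<delta> by (simp add: \<gamma>_def)
  also have "\<dots> \<le> (10/8)\<^sup>2 * (\<delta>\<^sup>2 * (\<gamma> * tm s))" using tm(4)[of s] by (intro mult_right_mono) (auto simp: power2_eq_square)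
  also have "\<dots> = (10/8 * \<delta>)\<^sup>2 * (\<gamma> * tm s)" by (simp only: power_mult_distrib mult.assoc)
  finally have "sqrt (b * tm s) \<le> sqrt ((10/8 * \<delta>)\<^sup>2 * (\<gamma> * tm s))" by simp
  also have "\<dots> = 10 * \<delta> * (sqrt (\<gamma> * tm s) / 8)" using \<delta> by (simp add: real_sqrt_mult)
  also have "\<dots> \<le> 10 * \<delta> * th s" using ge \<delta> by (intro mult_left_mono) auto
  finally show "sqrt (b * tm s) \<le> 10 * \<delta> * th s" .
qed

lemma G_lip: "\<bar>G (x, s) $ i $ j - G (y, r) $ i $ j\<bar> \<le> Lam * sqrt ((norm (x - y))\<^sup>2 + \<bar>s - r\<bar>)"
proof -
  have "(G (x, s) $ i $ j - G (y, r) $ i $ j)\<^sup>2 \<le> (\<Sum>j\<in>UNIV. (G (x, s) $ i $ j - G (y, r) $ i $ j)\<^sup>2)"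
    by (rule member_le_sum) auto
  also have "\<dots> \<le> (\<Sum>i\<in>UNIV. \<Sum>j\<in>UNIV. (G (x, s) $ i $ j - G (y, r) $ i $ j)\<^sup>2)"
    by (rule member_le_sum) (auto intro: sum_nonneg)
  finally have "\<bar>G (x, s) $ i $ j - G (y, r) $ i $ j\<bar> \<le> sqrt (\<Sum>i\<in>UNIV. \<Sum>j\<in>UNIV. (G (x, s) $ i $ j - G (y, r) $ i $ j)\<^sup>2)"
    by (intro real_le_rsqrt) simp
  also have "\<dots> \<le> Lam * sqrt ((norm (x - y))\<^sup>2 + \<bar>s - r\<bar>)" using adm unfolding admissible_coeff_def by blast
  finally show ?thesis .
qed

lemma G'_cont: "continuous_on UNIV (G' i j)"
proof -
  have "((G' i j) \<longlongrightarrow> G' i j X) (at X)" for X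
  proof (rule Lim_null_comparison[THEN LIM_zero_cancel])
    show "\<forall>\<^sub>F Y in at X. norm (G' i j Y - G' i j X) \<le> Lam * sqrt ((norm (fst Y - fst X))\<^sup>2 + \<bar>snd Y - snd X\<bar>)"
    proof (intro always_eventually allI)
      fix Y show "norm (G' i j Y - G' i j X) \<le> Lam * sqrt ((norm (fst Y - fst X))\<^sup>2 + \<bar>snd Y - snd X\<bar>)"
        using G_lip[of "fst Y" "snd Y" i j "fst X" "snd X"] by (simp add: G'_def)
    qed
    have "((\<lambda>Y. Lam * sqrt ((norm (fst Y - fst X))\<^sup>2 + \<bar>snd Y - snd X\<bar>)) \<longlongrightarrow> Lam * sqrt ((norm (fst X - fst X))\<^sup>2 + \<bar>snd X - snd X\<bar>)) (at X)"
      by (intro tendsto_intros)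
    then show "((\<lambda>Y. Lam * sqrt ((norm (fst Y - fst X))\<^sup>2 + \<bar>snd Y - snd X\<bar>)) \<longlongrightarrow> 0) (at X)" by simp
  qed
  then show ?thesis by (simp add: continuous_on_def)
qed

lemma h_eq: "h i j X = G' i j (fst X, 0)" by (simp add: h_def G'_def)

lemma h_cont: "continuous_on UNIV (h i j)"
  unfolding h_eq[abs_def] by (rule continuous_on_compose2[OF G'_cont]) (auto intro!: continuous_intros)

section \<open>The clamped function u and its conjugate v\<close>

lemma uh_smooth: "half_smooth u" using u by (simp add: Cinf_compact_on_def half_smooth_def)

lemma uh_x: "x_smooth k uh" "x_smooth k ut"
  unfolding uh_def ut_def by (intro x_smooth_clamp_ext uh_smooth half_smooth_half_deriv)+

lemma uh_supp:
  assumes "norm (fst X) > \<eta>" shows "uh X = 0" "ut X = 0"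
proof -
  have "(fst X, time_clamp T (snd X)) \<notin> supp_on closed_half_space u"
    using u_supp assms by (auto simp: \<eta>_def)
  from supp_on_vanish[OF u clamp_in this] show "uh X = 0" "ut X = 0" by (auto simp: uh_def ut_def clamp_ext_def)
qed

lemma u_late:
  assumes "T \<le> snd X"
  shows "u X = 0" "half_deriv w u X = 0" "partial_x i u X = 0" "partial_s u X = 0"
proof -
  have X: "X \<in> closed_half_space" using assms parameter_bounds(2) by (auto simp: closed_half_space_def mem_Times_iff)
  have ns: "X \<notin> supp_on closed_half_space u" using u_supp assms by (auto simp: T_def mem_Times_iff)
  show "u X = 0" "half_deriv w u X = 0" for w using supp_on_vanish[OF u X ns] by auto
  then show "partial_x i u X = 0" by (simp add: partial_x_half[OF uh_smooth X])
  show "partial_s u X = 0" using assms parameter_bounds(2) supp_on_vanish[OF u X ns] by (simp add: partial_s_half[OF uh_smooth])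
qed

lemma omega: "x_smooth k \<omega>" "((\<lambda>r. \<omega> (X + r *\<^sub>R xdir i)) has_real_derivative - (fst X $ i / (4 * tm (snd X))) * \<omega> X) (at 0)"
proof -
  have c: "continuous_on UNIV (\<lambda>s. 1 / (8 * tm s))"
    by (intro continuous_intros tm_cont) (use tm(1) less_imp_neq[OF tm(1)] in \<open>auto dest: not_sym\<close>)
  have d: "continuous_on UNIV (\<lambda>s. - b * ln (\<sigma> s))" by (intro continuous_intros ln_sigma_cont)
  note A = x_smooth_gaussian[OF c d]
  show "x_smooth k \<omega>" using A(1) unfolding \<omega>_def[abs_def] .
  show "((\<lambda>r. \<omega> (X + r *\<^sub>R xdir i)) has_real_derivative - (fst X $ i / (4 * tm (snd X))) * \<omega> X) (at 0)"
    unfolding \<omega>_def by (rule DERIV_cong[OF A(2)]) simp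
qed

lemma inverse_tm_deriv:
  assumes "0 < s" "s < T"
  shows "((\<lambda>s. c / tm s) has_real_derivative - (c / (tm s)\<^sup>2)) (at s)"
proof -
  have tm_sigma_nonzero: "tm s \<noteq> 0" using tm(1)[of s] by simp
  have "((\<lambda>s. c * inverse (tm s)) has_real_derivative c * - (1 * inverse (tm s ^ Suc (Suc 0)))) (at s)"
    by (intro DERIV_cmult DERIV_inverse_fun tm_deriv assms tm_sigma_nonzero)
  then show ?thesis by (simp add: divide_inverse power2_eq_square)
qed

lemma omega_time:
  assumes "0 < s" "s < T"
  shows "((\<lambda>s. \<omega> (x, s)) has_real_derivative - \<phi>s (x, s) * \<omega> (x, s)) (at s)"
proof -
  define K where "K = (\<Sum>i\<in>UNIV. (x $ i)\<^sup>2) / 8"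
  have "((\<lambda>s. exp (- b * ln (\<sigma> s) - K / tm s)) has_real_derivative exp (- b * ln (\<sigma> s) - K / tm s) * (- b * (pw s / tm s) - - (K / (tm s)\<^sup>2))) (at s)"
    by (intro DERIV_fun_exp DERIV_diff DERIV_cmult ln_sigma_deriv inverse_tm_deriv assms)
  moreover have "\<omega> (x, s) = exp (- b * ln (\<sigma> s) - K / tm s)" for s by (simp add: \<omega>_def K_def)
  moreover have "\<phi>s (x, s) = b * (pw s / tm s) - K / (tm s)\<^sup>2" by (simp add: \<phi>s_def K_def)
  ultimately show ?thesis by (simp add: mult.commute)
qed

lemma phis_x: "x_smooth k \<phi>s" "((\<lambda>r. \<phi>s (X + r *\<^sub>R xdir i)) has_real_derivative - (fst X $ i / (4 * (tm (snd X))\<^sup>2))) (at 0)"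
proof -
  have tm_sigma_nonzero: "tm s \<noteq> 0" for s using tm(1)[of s] by simp
  have c: "continuous_on UNIV (\<lambda>s. 1 / (8 * (tm s)\<^sup>2))" "continuous_on UNIV (\<lambda>s. b * pw s / tm s)"
    by (auto intro!: continuous_intros tm_cont pw_cont simp: tm_sigma_nonzero)
  have sm: "x_smooth k (\<lambda>X::(real^'n) \<times> real. \<Sum>i\<in>I. fst X $ i * fst X $ i)" for k and I :: "'n set"
    by (induction I rule: infinite_finite_induct) (auto intro!: x_smooth_const x_smooth_add x_smooth_mult x_smooth_coordinate)
  have "x_smooth k (\<lambda>X::(real^'n) \<times> real. (\<lambda>s. b * pw s / tm s) (snd X) + (-1) * ((\<Sum>i\<in>UNIV. fst X $ i * fst X $ i) * (\<lambda>s. 1 / (8 * (tm s)\<^sup>2)) (snd X)))"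
    by (intro x_smooth_add x_smooth_mult x_smooth_const sm x_smooth_time c)
  then show "x_smooth k \<phi>s" unfolding \<phi>s_def[abs_def] by (simp add: power2_eq_square)
  have x: "((\<lambda>r. fst (X + r *\<^sub>R xdir i) $ j) has_real_derivative (if i = j then 1 else 0)) (at 0)" for j
    by (auto simp: xdir_def axis_def intro!: derivative_eq_intros)
  have "((\<lambda>r. \<Sum>j\<in>UNIV. (fst (X + r *\<^sub>R xdir i) $ j)\<^sup>2) has_real_derivative (\<Sum>j\<in>UNIV. 2 * fst X $ j * (if i = j then 1 else 0))) (at 0)"
    by (intro DERIV_sum, rule DERIV_cong[OF DERIV_power[OF x, where n = 2]]) simp
  moreover have "(\<Sum>j\<in>UNIV. 2 * fst X $ j * (if i = j then 1 else 0)) = 2 * fst X $ i"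
    by (simp add: if_distrib[of "\<lambda>z. _ * z"] cong: if_cong)
  ultimately have s: "((\<lambda>r. \<Sum>j\<in>UNIV. (fst (X + r *\<^sub>R xdir i) $ j)\<^sup>2) has_real_derivative 2 * fst X $ i) (at 0)" by simp
  have sn: "snd (X + r *\<^sub>R xdir i) = snd X" for r by (simp add: xdir_def)
  show "((\<lambda>r. \<phi>s (X + r *\<^sub>R xdir i)) has_real_derivative - (fst X $ i / (4 * (tm (snd X))\<^sup>2))) (at 0)"
    unfolding \<phi>s_def sn
    by (rule DERIV_cong[OF DERIV_diff[OF DERIV_const DERIV_cdivide[OF s]]]) simp
qed

lemma v_x: "x_smooth k v"
  unfolding v_def[abs_def] by (intro x_smooth_mult omega uh_x)

lemma vt_x: "x_smooth k vt"
proof -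
  have "x_smooth k (\<lambda>X. \<omega> X * (ut X + (-1) * (\<phi>s X * uh X)))"
    by (intro x_smooth_mult x_smooth_add x_smooth_const omega uh_x phis_x)
  then show ?thesis unfolding vt_def[abs_def] by simp
qed

lemma uh_line: "((\<lambda>r. uh (X + r *\<^sub>R xdir i)) has_real_derivative partial_x i uh X) (at 0)"
  "((\<lambda>r. ut (X + r *\<^sub>R xdir i)) has_real_derivative partial_x i ut X) (at 0)"
  "((\<lambda>r. partial_x j uh (X + r *\<^sub>R xdir i)) has_real_derivative partial_x i (partial_x j uh) X) (at 0)"
  using x_smooth_derivative[OF uh_x(1)[of "Suc 0"]] x_smooth_derivative[OF uh_x(2)[of "Suc 0"]] x_smooth_derivative[OF x_smooth_partial[OF uh_x(1)[of "Suc (Suc 0)"]]] by auto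

lemma v_partial: "partial_x i v X = \<omega> X * (partial_x i uh X - fst X $ i / (4 * tm (snd X)) * uh X)"
  unfolding v_def[abs_def]
  by (rule partial_x_unique, rule DERIV_cong[OF DERIV_mult[OF omega(2) uh_line(1)]]) (simp add: algebra_simps)

lemma v_partial2: "partial_x j (partial_x i v) X = \<omega> X * (partial_x j (partial_x i uh) X - fst X $ j / (4 * tm (snd X)) * partial_x i uh X
   - fst X $ i / (4 * tm (snd X)) * partial_x j uh X + (fst X $ i * fst X $ j / (16 * (tm (snd X))\<^sup>2) - (if i = j then 1 else 0) / (4 * tm (snd X))) * uh X)"
proof -
  have tm_sigma_nonzero: "tm (snd X) \<noteq> 0" using tm(1)[of "snd X"] by simp
  have sn: "snd (X + r *\<^sub>R xdir j) = snd X" for r by (simp add: xdir_def)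
  have x: "((\<lambda>r. fst (X + r *\<^sub>R xdir j) $ i / (4 * tm (snd X))) has_real_derivative (if i = j then 1 else 0) / (4 * tm (snd X))) (at 0)"
    by (rule DERIV_cdivide) (auto simp: xdir_def axis_def intro!: derivative_eq_intros)
  have e: "partial_x i v = (\<lambda>X. \<omega> X * (partial_x i uh X - fst X $ i / (4 * tm (snd X)) * uh X))" using v_partial by auto
  show ?thesis unfolding e
  proof (rule partial_x_unique, unfold sn, rule DERIV_cong)
    show "((\<lambda>r. \<omega> (X + r *\<^sub>R xdir j) * (partial_x i uh (X + r *\<^sub>R xdir j) - fst (X + r *\<^sub>R xdir j) $ i / (4 * tm (snd X)) * uh (X + r *\<^sub>R xdir j)))
      has_real_derivative - (fst X $ j / (4 * tm (snd X))) * \<omega> X * (partial_x i uh (X + 0 *\<^sub>R xdir j) - fst (X + 0 *\<^sub>R xdir j) $ i / (4 * tm (snd X)) * uh (X + 0 *\<^sub>R xdir j))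
       + (partial_x j (partial_x i uh) X - ((if i = j then 1 else 0) / (4 * tm (snd X)) * uh (X + 0 *\<^sub>R xdir j) + partial_x j uh X * (fst (X + 0 *\<^sub>R xdir j) $ i / (4 * tm (snd X))))) * \<omega> (X + 0 *\<^sub>R xdir j)) (at 0)"
      by (intro DERIV_mult DERIV_diff omega(2) uh_line x)
  qed (use tm_sigma_nonzero in \<open>simp add: algebra_simps power2_eq_square\<close>)
qed

lemma vt_partial: "partial_x i vt X = - (fst X $ i / (4 * tm (snd X))) * \<omega> X * (ut X - \<phi>s X * uh X)
   + \<omega> X * (partial_x i ut X - (\<phi>s X * partial_x i uh X - fst X $ i / (4 * (tm (snd X))\<^sup>2) * uh X))"
  unfolding vt_def[abs_def]
  by (rule partial_x_unique, rule DERIV_cong[OF DERIV_mult[OF omega(2) DERIV_diff[OF uh_line(2) DERIV_mult[OF phis_x(2) uh_line(1)]]]])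
     (simp add: algebra_simps)

lemma v_time:
  assumes s: "0 < s" "s < T"
  shows "((\<lambda>s. v (x, s)) has_real_derivative vt (x, s)) (at s)"
    "((\<lambda>s. partial_x i v (x, s)) has_real_derivative partial_x i vt (x, s)) (at s)"
proof -
  have ud: "((\<lambda>s. uh (x, s)) has_real_derivative ut (x, s)) (at s)"
    unfolding uh_def ut_def by (rule clamp_ext_time_derivative[OF uh_smooth s])
  have uid: "((\<lambda>s. partial_x i uh (x, s)) has_real_derivative partial_x i ut (x, s)) (at s)"
    unfolding uh_def ut_def by (rule clamp_ext_mixed_derivative[OF uh_smooth s])
  show "((\<lambda>s. v (x, s)) has_real_derivative vt (x, s)) (at s)"
    unfolding v_def vt_def by (rule DERIV_cong[OF DERIV_mult[OF omega_time[OF s] ud]]) (simp add: algebra_simps)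
  have xd: "((\<lambda>s. x $ i / (4 * tm s)) has_real_derivative - (x $ i / (4 * (tm s)\<^sup>2))) (at s)"
    using inverse_tm_deriv[OF s, of "x $ i / 4"] by simp
  show "((\<lambda>s. partial_x i v (x, s)) has_real_derivative partial_x i vt (x, s)) (at s)"
    unfolding v_partial vt_partial fst_conv snd_conv
    by (rule DERIV_cong[OF DERIV_mult[OF omega_time[OF s] DERIV_diff[OF uid DERIV_mult[OF xd ud]]]]) (simp add: algebra_simps)
qed

text \<open>Each entry is dominated by the Frobenius norm, so Lam bounds its Lipschitz constant in
  x, its distance from the identity and, up to the square root of the time, the cost of freezing at
  time 0.\<close>

sublocale J: conjugated_jet h G' v vt tm pw th b Lam T \<eta> "10 * \<delta>" "exp (-60)" "24 * real CARD('n)^4 * (1 + Lam)\<^sup>2"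
proof
  show "continuous_on UNIV (h i j)" for i j by (rule h_cont)
  show "continuous_on UNIV (G' i j)" for i j by (rule G'_cont)
  show gl: "\<bar>G' i j (X + r *\<^sub>R xdir k) - G' i j X\<bar> \<le> Lam * \<bar>r\<bar>" for i j k X r
    using G_lip[of "fst (X + r *\<^sub>R xdir k)" "snd (X + r *\<^sub>R xdir k)" i j "fst X" "snd X"]
    by (cases X) (simp add: G'_def xdir_def)
  show "\<bar>h i j (X + r *\<^sub>R xdir k) - h i j X\<bar> \<le> Lam * \<bar>r\<bar>" for i j k X r
    using gl[of i j "(fst X, 0)" r k] by (simp add: h_eq xdir_def)
  show "h i j (x, s) = h i j (x, s')" for i j x s s' by (simp add: h_def)
  show "h i j X = h j i X" for i j X
  proof -
    have "transpose (G (fst X, 0)) = G (fst X, 0)" using adm unfolding admissible_coeff_def by blast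
    then have "transpose (G (fst X, 0)) $ i $ j = G (fst X, 0) $ i $ j" by simp
    then show ?thesis by (simp add: h_def transpose_def)
  qed
  show "\<bar>h i j X - (if i = j then 1 else 0)\<bar> \<le> Lam * norm (fst X)" for i j X
  proof -
    have "G (0, 0) = mat 1" using adm unfolding admissible_coeff_def by blast
    then show ?thesis using G_lip[of "fst X" 0 i j 0 0] by (simp add: h_def mat_def)
  qed
  show "\<bar>G' i j X - h i j X\<bar> \<le> Lam * sqrt (tm (snd X))" if "0 < snd X" "snd X < T" for i j X
  proof -
    have "\<bar>G' i j X - h i j X\<bar> \<le> Lam * sqrt \<bar>snd X\<bar>"
      using G_lip[of "fst X" "snd X" i j "fst X" 0] by (simp add: G'_def h_def)
    also have "\<dots> \<le> Lam * sqrt (tm (snd X))" using that tm_eq[of "snd X"] a0 Lam by (intro mult_left_mono real_sqrt_le_mono) auto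
    finally show ?thesis .
  qed
  show "0 \<le> Lam" using Lam by simp
  show "(real CARD('n))\<^sup>2 * (Lam * \<eta>) \<le> 1 / 4"
  proof -
    have "(real CARD('n))\<^sup>2 * (Lam * \<eta>) = Lam / (Lam + 1) / 4" by (simp add: \<eta>_def)
    also have "\<dots> \<le> 1 / 4" using Lam by (intro divide_right_mono) auto
    finally show ?thesis .
  qed
  show "x_smooth (Suc (Suc (Suc 0))) v" by (rule v_x)
  show "x_smooth (Suc 0) vt" by (rule vt_x)
  show "0 < s \<Longrightarrow> s < T \<Longrightarrow> ((\<lambda>s. v (x, s)) has_real_derivative vt (x, s)) (at s)" for x s by (rule v_time)
  show "0 < s \<Longrightarrow> s < T \<Longrightarrow> ((\<lambda>s. partial_x i v (x, s)) has_real_derivative partial_x i vt (x, s)) (at s)" for i x s by (rule v_time)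
  show "norm (fst X) > \<eta> \<Longrightarrow> v X = 0" "norm (fst X) > \<eta> \<Longrightarrow> vt X = 0" for X by (simp_all add: v_def vt_def uh_supp)
  show "v (x, T) = 0" for x
    using parameter_bounds(2) u_late(1)[of "(x, T)"] by (simp add: v_def uh_def clamp_ext_def time_clamp_eq)
  show "0 < T" by (rule parameter_bounds)
  show "continuous_on UNIV tm" by (rule tm_cont)
  show "0 < tm s" for s by (rule tm)
  show "0 < s \<Longrightarrow> s < T \<Longrightarrow> (tm has_real_derivative 1) (at s)" for s by (rule tm_deriv)
  show "continuous_on UNIV pw" by (rule pw_cont)
  show "exp (-60) \<le> pw s" "pw s \<le> 1" for s unfolding pw_def by (rule weight_exponent tm)+
  show "0 < s \<Longrightarrow> s < T \<Longrightarrow> (pw has_real_derivative - pw s * th s / tm s) (at s)" for s by (rule pw_deriv)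
  show "continuous_on UNIV th" by (rule th_cont)
  show "0 < th s" "th s \<le> 15" "sqrt (b * tm s) \<le> 10 * \<delta> * th s" for s by (rule th)+
  show "1 \<le> b" by (rule parameter_bounds)
  show "0 < 10 * \<delta>" using \<delta> by simp
  show "10 * \<delta> * (24 * real CARD('n)^4 * (1 + Lam)\<^sup>2)\<^sup>2 * 10^7 \<le> exp (-60)"
  proof -
    have "0 < (24 * real CARD('n)^4 * (1 + Lam)\<^sup>2)\<^sup>2 * 10^8" using Lam by simp
    then show ?thesis using \<delta>(2) by (simp add: pos_le_divide_eq mult_ac)
  qed
qed auto

section \<open>From the conjugated function back to u\<close>

definition E where "E X = exp (- ((norm (fst X))\<^sup>2 / (4 * tm (snd X))))" for X :: "(real^'n) \<times> real"
text \<open>This is \<omega> \<nabla>u on the strip; the form through the jet makes it continuous on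
  the whole space.\<close>

definition W where "W X = (\<chi> j. J.U j X)"
definition Qf where "Qf X = norm_g_sq G X (grad_g G u X)"

lemma omega_sq: "(\<omega> X)\<^sup>2 = \<sigma> (snd X) powr (- 2 * \<alpha> - 1) * E X"
proof -
  have "(\<omega> X)\<^sup>2 = exp (2 * (- b * ln (\<sigma> (snd X)) - (\<Sum>i\<in>UNIV. (fst X $ i)\<^sup>2) * (1 / (8 * tm (snd X)))))"
    unfolding \<omega>_def by (simp only: exp_double)
  also have "2 * (- b * ln (\<sigma> (snd X)) - (\<Sum>i\<in>UNIV. (fst X $ i)\<^sup>2) * (1 / (8 * tm (snd X)))) = (- 2 * \<alpha> - 1) * ln (\<sigma> (snd X)) + - ((norm (fst X))\<^sup>2 / (4 * tm (snd X)))"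
    unfolding norm_sq_sum b_def by (simp add: algebra_simps)
  finally show ?thesis using sigma(1)[of "snd X"] unfolding exp_add by (simp add: powr_def E_def)
qed

lemma sigma_powr: "\<sigma> s powr (- 2 * \<alpha> - 2) = \<sigma> s powr (- 2 * \<alpha> - 1) / \<sigma> s" "\<sigma> s powr (- 2 * \<alpha>) = \<sigma> s powr (- 2 * \<alpha> - 1) * \<sigma> s"
proof -
  have "- 2 * \<alpha> - 2 = (- 2 * \<alpha> - 1) - 1" "- 2 * \<alpha> = (- 2 * \<alpha> - 1) + 1" by simp_all
  then have "\<sigma> s powr (- 2 * \<alpha> - 2) = \<sigma> s powr (- 2 * \<alpha> - 1) / \<sigma> s powr 1" "\<sigma> s powr (- 2 * \<alpha>) = \<sigma> s powr (- 2 * \<alpha> - 1) * \<sigma> s powr 1"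
    by (metis powr_diff, metis powr_add)
  then show "\<sigma> s powr (- 2 * \<alpha> - 2) = \<sigma> s powr (- 2 * \<alpha> - 1) / \<sigma> s" "\<sigma> s powr (- 2 * \<alpha>) = \<sigma> s powr (- 2 * \<alpha> - 1) * \<sigma> s"
    using sigma(1)[of s] by simp_all
qed

lemma U_eq: "J.U j X = \<omega> X * partial_x j uh X"
  unfolding J.U_def J.g_def v_partial J.t_def by (simp add: v_def algebra_simps)

lemma U2_eq: "J.U2 i j X = \<omega> X * partial_x j (partial_x i uh) X"
  unfolding J.U2_def J.A_def J.g_def v_partial v_partial2 J.t_def
  using tm(1)[of "snd X"] by (simp add: v_def field_simps power2_eq_square)

lemma Ut_eq: "J.Ut X = \<omega> X * ut X"
  unfolding J.Ut_def J.t_def by (simp add: vt_def v_def \<phi>s_def algebra_simps)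

lemma on_strip:
  assumes "0 \<le> snd X" "snd X \<le> T"
  shows "uh X = u X" "partial_x i uh X = partial_x i u X"
proof -
  have X: "X \<in> closed_half_space" using assms by (auto simp: closed_half_space_def mem_Times_iff)
  have c: "(fst X, time_clamp T (snd X)) = X" using assms by (simp add: time_clamp_eq)
  show "uh X = u X" by (simp add: uh_def clamp_ext_def c)
  show "partial_x i uh X = partial_x i u X"
    unfolding uh_def x_smooth_clamp_ext(2)[OF uh_smooth] partial_x_half[OF uh_smooth X] by (simp add: clamp_ext_def c)
qed

lemma W_eq:
  assumes "0 \<le> snd X" "snd X \<le> T" shows "W X = \<omega> X *\<^sub>R grad_x u X"
  unfolding W_def U_eq grad_x_def on_strip(2)[OF assms] by (simp add: vec_eq_iff)

lemma ellipticity: "lam * (norm \<xi>)\<^sup>2 \<le> \<xi> \<bullet> (G X *v \<xi>)" "lam * (\<xi> \<bullet> (G X *v \<xi>)) \<le> (norm \<xi>)\<^sup>2"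
proof -
  have 1: "lam * (norm \<xi>)\<^sup>2 \<le> (\<Sum>i\<in>UNIV. \<Sum>j\<in>UNIV. G X $ i $ j * \<xi> $ i * \<xi> $ j)"
    "(\<Sum>i\<in>UNIV. \<Sum>j\<in>UNIV. G X $ i $ j * \<xi> $ i * \<xi> $ j) \<le> inverse lam * (norm \<xi>)\<^sup>2"
    using adm unfolding admissible_coeff_def by blast+
  then show "lam * (norm \<xi>)\<^sup>2 \<le> \<xi> \<bullet> (G X *v \<xi>)" by (simp add: quadratic_form_inner)
  have "lam * (\<xi> \<bullet> (G X *v \<xi>)) \<le> lam * (inverse lam * (norm \<xi>)\<^sup>2)"
    using 1(2) lam unfolding quadratic_form_inner by (intro mult_left_mono) auto
  also have "\<dots> = (norm \<xi>)\<^sup>2" using lam by simp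
  finally show "lam * (\<xi> \<bullet> (G X *v \<xi>)) \<le> (norm \<xi>)\<^sup>2" .
qed

lemma Qf_eq: "Qf X = grad_x u X \<bullet> (G X *v grad_x u X)"
  unfolding Qf_def by (rule norm_g_sq_grad_g[OF _ lam(1)]) (simp add: quadratic_form_inner ellipticity(1))

lemma Qf_nonneg: "0 \<le> Qf X"
proof -
  have "0 \<le> lam * (norm (grad_x u X))\<^sup>2" using lam by simp
  then show ?thesis unfolding Qf_eq using ellipticity(1) order_trans by blast
qed

lemma W_form:
  assumes "0 \<le> snd X" "snd X \<le> T"
  shows "W X \<bullet> (G X *v W X) = (\<omega> X)\<^sup>2 * Qf X"
  unfolding W_eq[OF assms] Qf_eq by (simp add: matrix_vector_mult_scaleR power2_eq_square)

lemma W_norm: "(norm (W X))\<^sup>2 \<le> 2 * (norm (\<chi> i. J.g i X))\<^sup>2 + (norm (fst X))\<^sup>2 / (8 * (tm (snd X))\<^sup>2) * (v X)\<^sup>2"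
proof -
  define y where "y = (v X / (4 * tm (snd X))) *\<^sub>R fst X"
  have "W X = (\<chi> i. J.g i X) + y" unfolding W_def y_def J.U_def J.t_def by (simp add: vec_eq_iff)
  then have "norm (W X) \<le> norm (\<chi> i. J.g i X) + norm y" using norm_triangle_ineq by metis
  then have "(norm (W X))\<^sup>2 \<le> (norm (\<chi> i. J.g i X) + norm y)\<^sup>2" by (intro power_mono) auto
  also have "\<dots> \<le> 2 * (norm (\<chi> i. J.g i X))\<^sup>2 + 2 * (norm y)\<^sup>2"
    using sum_squares_bound[of "norm (\<chi> i. J.g i X)" "norm y"] by (simp add: power2_sum)
  also have "2 * (norm y)\<^sup>2 = (norm (fst X))\<^sup>2 / (8 * (tm (snd X))\<^sup>2) * (v X)\<^sup>2"
    unfolding y_def by (simp add: power_mult_distrib power_divide)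
  finally show ?thesis .
qed

text \<open>At almost every point each coefficient has a derivative along the direction in which the
  operator differentiates it. There the product rule turns the classical partial derivatives in P u
  into the expression of the jet.\<close>

lemma parabolic_op_AE: "AE X in lborel. X \<in> J.S \<longrightarrow> J.f X = \<omega> X * parabolic_op G u X"
proof -
  have "AE X in lborel. \<forall>i j. ((\<lambda>r. G' i j (X + r *\<^sub>R xdir i)) has_real_derivative J.dG i j X) (at 0)"
    unfolding AE_all_countable using J.lip_diff_G by (auto simp: lip_diff_def)
  then show ?thesis
  proof eventually_elim
    case (elim X)
    show ?case
    proof
      assume "X \<in> J.S"
      then have s: "0 < snd X" "snd X < T" by (auto simp: J.S_def)
      have "partial_x i (\<lambda>Y. \<Sum>j\<in>UNIV. G Y $ i $ j * partial_x j u Y) X = (\<Sum>j\<in>UNIV. J.dG i j X * partial_x j uh X + G' i j X * partial_x j (partial_x i uh) X)" for i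
      proof -
        have "partial_x i (\<lambda>Y. \<Sum>j\<in>UNIV. G Y $ i $ j * partial_x j u Y) X = partial_x i (\<lambda>Y. \<Sum>j\<in>UNIV. G' i j Y * partial_x j uh Y) X"
        proof (rule partial_x_cong)
          fix r
          have "0 \<le> snd (X + r *\<^sub>R xdir i)" "snd (X + r *\<^sub>R xdir i) \<le> T" using s by (auto simp: xdir_def)
          note A = on_strip(2)[OF this]
          show "(\<Sum>j\<in>UNIV. G (X + r *\<^sub>R xdir i) $ i $ j * partial_x j u (X + r *\<^sub>R xdir i)) = (\<Sum>j\<in>UNIV. G' i j (X + r *\<^sub>R xdir i) * partial_x j uh (X + r *\<^sub>R xdir i))"
            unfolding A G'_def ..
        qed
        also have "\<dots> = (\<Sum>j\<in>UNIV. J.dG i j X * partial_x j uh X + partial_x i (partial_x j uh) X * G' i j X)"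
        proof (rule partial_x_unique, rule DERIV_sum)
          fix j
          have "((\<lambda>r. G' i j (X + r *\<^sub>R xdir i) * partial_x j uh (X + r *\<^sub>R xdir i)) has_real_derivative
            J.dG i j X * partial_x j uh (X + 0 *\<^sub>R xdir i) + partial_x i (partial_x j uh) X * G' i j (X + 0 *\<^sub>R xdir i)) (at 0)"
            by (rule DERIV_mult[OF _ uh_line(3)]) (use elim in auto)
          then show "((\<lambda>r. G' i j (X + r *\<^sub>R xdir i) * partial_x j uh (X + r *\<^sub>R xdir i)) has_real_derivative
            J.dG i j X * partial_x j uh X + partial_x i (partial_x j uh) X * G' i j X) (at 0)" by simp
        qed
        finally show ?thesis
          using partial_x_commute[OF uh_x(1)[of "Suc (Suc 0)"]] by (simp add: mult.commute)
      qed
      moreover have "partial_s u X = ut X"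
        using s by (simp add: ut_def clamp_ext_def time_clamp_eq partial_s_half[OF uh_smooth])
      ultimately have "\<omega> X * parabolic_op G u X = \<omega> X * ((\<Sum>i\<in>UNIV. \<Sum>j\<in>UNIV. J.dG i j X * partial_x j uh X + G' i j X * partial_x j (partial_x i uh) X) + ut X)"
        unfolding parabolic_op_def by simp
      also have "\<dots> = J.f X" unfolding J.f_def U_eq U2_eq Ut_eq
        by (simp add: distrib_left sum_distrib_left mult_ac)
      finally show "J.f X = \<omega> X * parabolic_op G u X" by simp
    qed
  qed
qed

text \<open>\<open>K1\<close>, \<open>K2\<close> and \<open>K3\<close> are Borel versions, on the
  strip, of the three weighted integrands of the theorem. The factor 1/\<sigma> lowers the power
  -2\<alpha>-1 carried by the squared weight to -2\<alpha>-2.\<close>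

definition K1 where "K1 X = th (snd X) / \<sigma> (snd X) * (v X)\<^sup>2"
definition K2 where "K2 X = tm (snd X) / \<sigma> (snd X) * th (snd X) * (W X \<bullet> (\<chi> i. \<Sum>j\<in>UNIV. G' i j X * J.U j X))"
definition K3 where "K3 X = tm (snd X) / \<sigma> (snd X) * (J.t X * (J.f X)\<^sup>2)"

lemma tm_sigma_nonzero: "tm s \<noteq> 0" "\<sigma> s \<noteq> 0" using tm(1)[of s] sigma(1)[of s] by auto

lemma tm_sigma_ratio: "1 \<le> tm s / \<sigma> s" "tm s / \<sigma> s \<le> exp 240"
proof -
  show "1 \<le> tm s / \<sigma> s" using sigma[of s] by simp
  have "exp 240 * (exp (-240) * tm s) \<le> exp 240 * \<sigma> s" using sigma[of s] by (intro mult_left_mono) auto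
  then have "tm s \<le> exp 240 * \<sigma> s" by (simp add: mult.assoc[symmetric] exp_add[symmetric])
  then show "tm s / \<sigma> s \<le> exp 240" using sigma(1)[of s] by (simp add: divide_le_eq)
qed

lemma cont_snd: "continuous_on UNIV (\<lambda>X::(real^'n) \<times> real. tm (snd X))" "continuous_on UNIV (\<lambda>X::(real^'n) \<times> real. th (snd X))"
  "continuous_on UNIV (\<lambda>X::(real^'n) \<times> real. \<sigma> (snd X))"
  by (auto intro!: continuous_on_compose2[OF tm_cont] continuous_on_compose2[OF th_cont] continuous_on_compose2[OF sigma_cont] continuous_intros)

lemma K_cont: "continuous_on UNIV K1" "continuous_on UNIV K2"
proof -
  show "continuous_on UNIV K1" unfolding K1_def[abs_def] by (intro continuous_intros cont_snd J.jet_continuous) (auto simp: tm_sigma_nonzero)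
  show "continuous_on UNIV K2" unfolding K2_def[abs_def] inner_vec_def W_def
    by (simp, intro continuous_intros cont_snd J.U_continuous G'_cont) (auto simp: tm_sigma_nonzero)
qed

lemma K_supp: "norm (fst X) > \<eta> \<Longrightarrow> K1 X = 0" "norm (fst X) > \<eta> \<Longrightarrow> K2 X = 0"
  unfolding K1_def K2_def W_def J.U_def inner_vec_def using J.jet_supp[of X] by simp_all

lemma K_integrable: "set_integrable lborel J.S K1" "set_integrable lborel J.S K2" "set_integrable lborel J.S K3"
proof -
  show "set_integrable lborel J.S K1" "set_integrable lborel J.S K2" unfolding J.S_def
    by (rule set_integrable_strip[OF K_cont(1) K_supp(1)] set_integrable_strip[OF K_cont(2) K_supp(2)]; simp)+
  have i: "set_integrable lborel J.S (\<lambda>X. exp 240 * (J.t X * (J.f X)\<^sup>2))" by (rule set_integrable_mult_right) (rule J.f_integrable)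
  have 1: "(\<lambda>X. indicator J.S X *\<^sub>R (J.t X * (J.f X)\<^sup>2)) \<in> borel_measurable lborel"
    using J.f_integrable by (auto simp: set_integrable_def)
  have "continuous_on UNIV (\<lambda>X::(real^'n) \<times> real. tm (snd X) / \<sigma> (snd X))" by (intro continuous_intros cont_snd) (auto simp: tm_sigma_nonzero)
  then have 2: "(\<lambda>X::(real^'n) \<times> real. tm (snd X) / \<sigma> (snd X)) \<in> borel_measurable lborel" by (auto intro: borel_measurable_continuous_onI)
  show "set_integrable lborel J.S K3"
  proof (rule set_integrable_bound[OF i])
    show "set_borel_measurable lborel J.S K3" unfolding set_borel_measurable_def K3_def
      using borel_measurable_times[OF 2 1] by (simp add: mult_ac)
    show "AE X in lborel. X \<in> J.S \<longrightarrow> norm (K3 X) \<le> norm (exp 240 * (J.t X * (J.f X)\<^sup>2))"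
    proof (intro AE_I2 impI)
      fix X
      have "K3 X \<le> exp 240 * (J.t X * (J.f X)\<^sup>2)" unfolding K3_def using tm_sigma_ratio[of "snd X"] J.t_pos[of X] by (intro mult_right_mono) auto
      moreover have "0 \<le> K3 X" unfolding K3_def using tm_sigma_ratio(1)[of "snd X"] J.t_pos[of X] by (intro mult_nonneg_nonneg) (auto intro: order_trans[OF zero_le_one])
      ultimately show "norm (K3 X) \<le> norm (exp 240 * (J.t X * (J.f X)\<^sup>2))" by simp
    qed
  qed
qed

lemma f_measurable: "J.f \<in> borel_measurable borel"
proof -
  have "J.dG i j \<in> borel_measurable borel" for i j using J.lip_diff_G unfolding lip_diff_def by auto
  note [measurable] = this J.U_continuous[THEN borel_measurable_continuous_onI] G'_cont[THEN borel_measurable_continuous_onI]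
  show ?thesis unfolding J.f_def[abs_def] by measurable
qed

lemma function_integral: "(LINT (x, s):open_half_space|lebesgue. weight_sigma_shift \<gamma> a0 s powr (- 2 * \<alpha> - 2) * theta (\<gamma> * (s + a0)) * (u (x, s))\<^sup>2
     * exp (- ((norm x)\<^sup>2 / (4 * (s + a0))))) = (LINT X:J.S|lborel. K1 X)"
  (is "set_lebesgue_integral _ _ ?F = _")
  unfolding J.S_def
proof (rule half_space_integral)
  show "K1 \<in> borel_measurable borel" using K_cont by (auto intro: borel_measurable_continuous_onI)
  show "AE X in lborel. X \<in> UNIV \<times> {0<..<T} \<longrightarrow> ?F X = K1 X"
  proof (intro AE_I2 impI)
    fix X :: "(real^'n) \<times> real" assume X: "X \<in> UNIV \<times> {0<..<T}"
    have t: "tm (snd X) = snd X + a0" using X by (auto simp: tm_eq)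
    have w: "weight_sigma_shift \<gamma> a0 (snd X) = \<sigma> (snd X)" unfolding weight_sigma_shift_def \<sigma>_def t ..
    have uu: "uh X = u X" using X on_strip(1)[of X] by auto
    have "K1 X = th (snd X) / \<sigma> (snd X) * ((\<sigma> (snd X) powr (- 2 * \<alpha> - 1) * E X) * (u X)\<^sup>2)"
      unfolding K1_def v_def uu power_mult_distrib omega_sq ..
    also have "\<dots> = \<sigma> (snd X) powr (- 2 * \<alpha> - 2) * th (snd X) * (u X)\<^sup>2 * E X" unfolding sigma_powr by simp
    finally show "?F X = K1 X"
      using w t by (cases X) (simp add: E_def th_def)
  qed
  show "?F X = 0" if "T \<le> snd X" for X
    using u_late(1)[OF that] by (cases X) simp
qed

lemma Qf_late: assumes "T \<le> snd X" shows "Qf X = 0"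
proof -
  have "grad_x u X = 0" unfolding grad_x_def using u_late(3)[OF assms] by (simp add: vec_eq_iff)
  then show ?thesis unfolding Qf_eq by simp
qed

lemma K2_eq:
  assumes "0 \<le> snd X" "snd X \<le> T" shows "K2 X = tm (snd X) / \<sigma> (snd X) * th (snd X) * ((\<omega> X)\<^sup>2 * Qf X)"
proof -
  have "(\<chi> i. \<Sum>j\<in>UNIV. G' i j X * J.U j X) = G X *v W X" by (simp add: matrix_vector_mult_def W_def G'_def)
  then show ?thesis unfolding K2_def W_form[OF assms, symmetric] by simp
qed

lemma gradient_integral: "(LINT (x, s):open_half_space|lebesgue. (s + a0) * weight_sigma_shift \<gamma> a0 s powr (- 2 * \<alpha> - 2) * theta (\<gamma> * (s + a0))
     * norm_g_sq G (x, s) (grad_g G u (x, s)) * exp (- ((norm x)\<^sup>2 / (4 * (s + a0))))) = (LINT X:J.S|lborel. K2 X)"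
  (is "set_lebesgue_integral _ _ ?F = _")
  unfolding J.S_def
proof (rule half_space_integral)
  show "K2 \<in> borel_measurable borel" using K_cont by (auto intro: borel_measurable_continuous_onI)
  show "AE X in lborel. X \<in> UNIV \<times> {0<..<T} \<longrightarrow> ?F X = K2 X"
  proof (intro AE_I2 impI)
    fix X :: "(real^'n) \<times> real" assume X: "X \<in> UNIV \<times> {0<..<T}"
    have t: "tm (snd X) = snd X + a0" using X by (auto simp: tm_eq)
    have w: "weight_sigma_shift \<gamma> a0 (snd X) = \<sigma> (snd X)" unfolding weight_sigma_shift_def \<sigma>_def t ..
    have "K2 X = tm (snd X) / \<sigma> (snd X) * th (snd X) * ((\<sigma> (snd X) powr (- 2 * \<alpha> - 1) * E X) * Qf X)"
      using X by (subst K2_eq) (auto simp: omega_sq)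
    also have "\<dots> = tm (snd X) * \<sigma> (snd X) powr (- 2 * \<alpha> - 2) * th (snd X) * Qf X * E X" unfolding sigma_powr by simp
    finally show "?F X = K2 X"
      using w t by (cases X) (simp add: E_def th_def Qf_def)
  qed
  show "?F X = 0" if "T \<le> snd X" for X
    using Qf_late[OF that] by (cases X) (simp add: Qf_def)
qed

lemma parabolic_late: assumes "T \<le> snd X" shows "parabolic_op G u X = 0"
proof -
  have "partial_x i (\<lambda>Y. \<Sum>j\<in>UNIV. G Y $ i $ j * partial_x j u Y) X = partial_x i (\<lambda>Y. 0) X" for i
  proof (rule partial_x_cong)
    fix r
    have "T \<le> snd (X + r *\<^sub>R xdir i)" using assms by (simp add: xdir_def)
    from u_late(3)[OF this] show "(\<Sum>j\<in>UNIV. G (X + r *\<^sub>R xdir i) $ i $ j * partial_x j u (X + r *\<^sub>R xdir i)) = 0" by simp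
  qed
  moreover have "partial_x i (\<lambda>Y. 0) X = 0" for i by (rule partial_x_unique) simp
  ultimately show ?thesis unfolding parabolic_op_def using u_late(4)[OF assms] by simp
qed

lemma operator_integral: "(LINT (x, s):open_half_space|lebesgue. (s + a0)\<^sup>2 * weight_sigma_shift \<gamma> a0 s powr (- 2 * \<alpha> - 2) * \<bar>parabolic_op G u (x, s)\<bar>\<^sup>2
     * exp (- ((norm x)\<^sup>2 / (4 * (s + a0))))) = (LINT X:J.S|lborel. K3 X)"
  (is "set_lebesgue_integral _ _ ?F = _")
  unfolding J.S_def
proof (rule half_space_integral)
  have "(\<lambda>X::(real^'n) \<times> real. tm (snd X)) \<in> borel_measurable borel" "(\<lambda>X::(real^'n) \<times> real. \<sigma> (snd X)) \<in> borel_measurable borel"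
    using cont_snd by (auto intro: borel_measurable_continuous_onI)
  note [measurable] = this f_measurable
  show "K3 \<in> borel_measurable borel" unfolding K3_def[abs_def] J.t_def by measurable
  show "AE X in lborel. X \<in> UNIV \<times> {0<..<T} \<longrightarrow> ?F X = K3 X"
    using parabolic_op_AE
  proof eventually_elim
    case (elim X)
    show ?case
    proof
      assume X: "X \<in> UNIV \<times> {0<..<T}"
      have t: "tm (snd X) = snd X + a0" using X by (auto simp: tm_eq)
      have w: "weight_sigma_shift \<gamma> a0 (snd X) = \<sigma> (snd X)" unfolding weight_sigma_shift_def \<sigma>_def t ..
      have f: "J.f X = \<omega> X * parabolic_op G u X" using elim X by (simp add: J.S_def)
      have "K3 X = tm (snd X) / \<sigma> (snd X) * (tm (snd X) * ((\<sigma> (snd X) powr (- 2 * \<alpha> - 1) * E X) * (parabolic_op G u X)\<^sup>2))"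
        unfolding K3_def f power_mult_distrib omega_sq J.t_def ..
      also have "\<dots> = (tm (snd X))\<^sup>2 * \<sigma> (snd X) powr (- 2 * \<alpha> - 2) * \<bar>parabolic_op G u X\<bar>\<^sup>2 * E X"
        unfolding sigma_powr by (simp add: power2_eq_square)
      finally show "?F X = K3 X"
        using w t by (cases X) (simp add: E_def)
    qed
  qed
  show "?F X = 0" if "T \<le> snd X" for X
    using parabolic_late[OF that] by (cases X) simp
qed

text \<open>Returning from v to u costs the comparison t/\<sigma> <= exp 240 and one factor 1/lam of
  ellipticity; \<alpha> <= b handles the first term.\<close>

lemma lower_bound:
  assumes X: "X \<in> J.S"
  shows "\<alpha> * K1 X + K2 X \<le> 2 * exp 240 / lam * J.lower X"
proof -
  have s: "0 \<le> snd X" "snd X \<le> T" using X by (auto simp: J.S_def)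
  define r where "r = tm (snd X) / \<sigma> (snd X)"
  define P where "P = b * th (snd X) / tm (snd X) * (v X)\<^sup>2"
  define R1 where "R1 = th (snd X) * (norm (\<chi> i. J.g i X))\<^sup>2"
  define R2 where "R2 = th (snd X) * (norm (fst X))\<^sup>2 / (tm (snd X))\<^sup>2 * (v X)\<^sup>2"
  have nn: "0 \<le> P" "0 \<le> R1" "0 \<le> R2" using th(1)[of "snd X"] tm(1)[of "snd X"] parameter_bounds(3) by (auto simp: P_def R1_def R2_def)
  have r: "1 \<le> r" "r \<le> exp 240" using tm_sigma_ratio unfolding r_def by auto
  have e: "1 \<le> 1 / lam" using lam by simp
  have le: "exp 240 \<le> exp 240 / lam" using mult_left_mono[OF e, of "exp 240"] by simp
  have "\<alpha> * K1 X = r * (\<alpha> * th (snd X) / tm (snd X) * (v X)\<^sup>2)" unfolding K1_def r_def using tm_sigma_nonzero by simp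
  also have "\<dots> \<le> r * P" unfolding P_def using r th(1)[of "snd X"] tm(1)[of "snd X"]
    by (intro mult_left_mono mult_right_mono divide_right_mono) (auto simp: b_def)
  also have "\<dots> \<le> exp 240 / lam * P" using r le nn by (intro mult_right_mono) auto
  finally have 1: "\<alpha> * K1 X \<le> exp 240 / lam * P" .
  have "lam * ((\<omega> X)\<^sup>2 * Qf X) \<le> (norm (W X))\<^sup>2" unfolding W_form[OF s, symmetric] by (rule ellipticity)
  also note W_norm
  finally have "(\<omega> X)\<^sup>2 * Qf X \<le> (2 * (norm (\<chi> i. J.g i X))\<^sup>2 + (norm (fst X))\<^sup>2 / (8 * (tm (snd X))\<^sup>2) * (v X)\<^sup>2) / lam"
    using lam by (simp add: pos_le_divide_eq mult.commute)
  then have "K2 X \<le> r * th (snd X) * ((2 * (norm (\<chi> i. J.g i X))\<^sup>2 + (norm (fst X))\<^sup>2 / (8 * (tm (snd X))\<^sup>2) * (v X)\<^sup>2) / lam)"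
    unfolding K2_eq[OF s] r_def[symmetric] using r th(1)[of "snd X"] by (intro mult_left_mono) auto
  also have "\<dots> = r / lam * (2 * R1 + R2 / 8)" unfolding R1_def R2_def by (simp add: field_simps)
  also have "\<dots> \<le> exp 240 / lam * (2 * R1 + R2 / 8)" using r lam nn by (intro mult_right_mono divide_right_mono) auto
  also have "\<dots> \<le> exp 240 / lam * (2 * R1 + 2 * R2)" using lam nn by (intro mult_left_mono) auto
  finally have 2: "K2 X \<le> exp 240 / lam * (2 * R1 + 2 * R2)" .
  have "exp 240 / lam * P \<le> exp 240 / lam * (2 * P)" using lam nn by (intro mult_left_mono) auto
  then have "\<alpha> * K1 X + K2 X \<le> exp 240 / lam * (2 * P) + exp 240 / lam * (2 * R1 + 2 * R2)" using 1 2 by linarith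
  also have "\<dots> = 2 * exp 240 / lam * (P + R1 + R2)" by (simp add: algebra_simps add_divide_distrib)
  also have "P + R1 + R2 = J.lower X" unfolding P_def R1_def R2_def J.lower_def J.t_def ..
  finally show ?thesis .
qed

section \<open>The boundary terms at time zero\<close>

lemma integrable_compact_support:
  fixes F :: "real^'n \<Rightarrow> real"
  assumes "continuous_on UNIV F" "\<And>x. norm x > R \<Longrightarrow> F x = 0"
  shows "integrable lborel F"
proof -
  have "integrable lborel (\<lambda>x. indicator (cball 0 R) x *\<^sub>R F x)"
    by (rule borel_integrable_compact) (use assms in \<open>auto intro: continuous_on_subset\<close>)
  moreover have "(\<lambda>x. indicator (cball 0 R) x *\<^sub>R F x) = F" using assms(2) by (force simp: fun_eq_iff split: split_indicator)
  ultimately show ?thesis by simp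
qed

lemma tm0: "tm 0 = a0" using tm_eq[of 0] parameter_bounds(2) by simp

text \<open>The |x|^2 part of q has just the size needed to pass from \<nabla>v to \<omega>
  \<nabla>u: a quarter of the bound 2 |\<nabla>v|^2 + |x|^2 v^2 / (8 t^2) for |W|^2 is
  |\<nabla>v|^2/2 + |x|^2 v^2 / (32 t^2), and these are exactly the coefficients provided by the
  ellipticity of h and by q.\<close>

lemma boundary_pointwise:
  "- (J.t (x, 0) * J.Q (x, 0)) \<le> b * (v (x, 0))\<^sup>2 - a0 / 4 * (norm (W (x, 0)))\<^sup>2"
proof (cases "norm x \<le> \<eta>")
  case False
  then show ?thesis using J.jet_supp[of "(x, 0)"] by (simp add: J.Q_def W_def J.U_def zero_vec_def[symmetric])
next
  case True
  let ?X = "(x, 0 :: real)"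
  define \<gamma>0 where "\<gamma>0 = norm (\<chi> i. J.g i ?X)"
  define c where "c = real CARD('n) / 4"
  have x: "\<And>i. \<bar>x $ i\<bar> \<le> norm x" "(\<Sum>i\<in>UNIV. (x $ i)\<^sup>2) = (norm x)\<^sup>2"
    using component_le_norm_cart by (auto simp: norm_sq_sum)
  have gg: "\<And>i. \<bar>J.g i ?X\<bar> \<le> \<gamma>0" "(\<Sum>i\<in>UNIV. (J.g i ?X)\<^sup>2) = \<gamma>0\<^sup>2"
    unfolding \<gamma>0_def norm_sq_sum using component_le_norm_cart[of "\<chi> i. J.g i ?X"] by auto
  have sm: "(real CARD('n))\<^sup>2 * (Lam * norm x) \<le> 1 / 4"
  proof -
    have "(real CARD('n))\<^sup>2 * (Lam * norm x) \<le> (real CARD('n))\<^sup>2 * (Lam * \<eta>)" using True Lam by (intro mult_left_mono) auto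
    then show ?thesis using J.small by linarith
  qed
  have hn: "\<bar>h i j ?X - (if i = j then 1 else 0)\<bar> \<le> Lam * norm x" for i j using J.h_near[of i j ?X] by simp
  \<comment> \<open>The slice s = 0 is a null set, so almost everywhere statements about derivatives
    of the coefficients say nothing there. The two bounds used involve h itself but not its
    derivatives, which are therefore set to 0.\<close>
  note mb = metric_bounds[where h = "\<lambda>i j. h i j ?X" and x = "\<lambda>i. x $ i" and g = "\<lambda>i. J.g i ?X" and dh = "\<lambda>k i j. 0" and N = "\<lambda>i. J.N i ?X"
      and B = "\<lambda>i. J.B i ?X" and dB = "\<lambda>k i. (\<Sum>j\<in>UNIV. 0 * x $ j) / 2 + h i k ?X / 2" and c = c, OF x gg _ hn _ sm _ _ refl c_def]
  have S1: "\<gamma>0\<^sup>2 / 2 \<le> (\<Sum>i\<in>UNIV. J.N i ?X * J.g i ?X)" and kap: "J.kap ?X \<le> - (norm x)\<^sup>2 / 32"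
    using mb(1) mb(6) Lam by (simp_all add: J.N_def J.B_def J.kap_def)
  have a: "0 < a0" by (rule a0)
  have pwb: "pw 0 \<le> 1" by (rule J.pw)
  have q: "a0 * J.q ?X \<le> b - (norm x)\<^sup>2 / 32 / a0"
  proof -
    have "a0 * J.q ?X = b * pw 0 + J.kap ?X / a0" unfolding J.q_def J.t_def using a tm0 by (simp add: field_simps power2_eq_square)
    also have "\<dots> \<le> b * 1 + (- (norm x)\<^sup>2 / 32) / a0" using kap pwb parameter_bounds(3) a by (intro add_mono mult_left_mono divide_right_mono) auto
    finally show ?thesis by simp
  qed
  have "- (J.t ?X * J.Q ?X) = - a0 * (\<Sum>i\<in>UNIV. J.N i ?X * J.g i ?X) + (a0 * J.q ?X) * (v ?X)\<^sup>2"
    unfolding J.Q_def J.t_def using tm0 by (simp add: algebra_simps)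
  also have "\<dots> \<le> - a0 * (\<gamma>0\<^sup>2 / 2) + (b - (norm x)\<^sup>2 / 32 / a0) * (v ?X)\<^sup>2"
    using S1 q a by (intro add_mono mult_right_mono mult_left_mono_neg) auto
  also have "\<dots> = b * (v ?X)\<^sup>2 - a0 / 4 * (2 * \<gamma>0\<^sup>2 + (norm x)\<^sup>2 / (8 * a0\<^sup>2) * (v ?X)\<^sup>2)"
    using a by (simp add: field_simps power2_eq_square)
  also have "\<dots> \<le> b * (v ?X)\<^sup>2 - a0 / 4 * (norm (W ?X))\<^sup>2"
    using W_norm[of ?X] a tm0 unfolding \<gamma>0_def by (intro diff_left_mono mult_left_mono) auto
  finally show ?thesis .
qed

definition B1 where "B1 = (LINT x|lebesgue. (u (x, 0))\<^sup>2 * exp (- ((norm x)\<^sup>2 / (4 * a0))))"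
definition B2 where "B2 = (LINT x|lebesgue. norm_g_sq G (x, 0) (grad_g G u (x, 0)) * exp (- ((norm x)\<^sup>2 / (4 * a0))))"

lemma boundary:
  "- (\<integral>x. J.t (x, 0) * J.Q (x, 0) \<partial>lborel) \<le> 2 * \<alpha> * weight_sigma \<gamma> a0 powr (- 2 * \<alpha> - 1) * B1 - lam / 4 * weight_sigma \<gamma> a0 powr (- 2 * \<alpha>) * B2"
proof -
  have s0: "weight_sigma \<gamma> a0 = \<sigma> 0" by (simp add: \<sigma>_def tm0)
  define F1 where "F1 x = (uh (x, 0))\<^sup>2 * exp (- ((norm x)\<^sup>2 / (4 * a0)))" for x :: "real^'n"
  define F2 where "F2 x = (\<Sum>i\<in>UNIV. partial_x i uh (x, 0) * (\<Sum>j\<in>UNIV. G' i j (x, 0) * partial_x j uh (x, 0))) * exp (- ((norm x)\<^sup>2 / (4 * a0)))" for x :: "real^'n"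
  have at0: "continuous_on UNIV (\<lambda>x::real^'n. F (x, 0))" if "continuous_on UNIV F" for F :: "(real^'n) \<times> real \<Rightarrow> real"
    by (rule continuous_on_compose2[OF that]) (auto intro!: continuous_intros)
  have c1: "continuous_on UNIV F1" unfolding F1_def by (intro continuous_intros at0 x_smooth_continuous[OF uh_x(1)]) (use a0 in auto)
  have c2: "continuous_on UNIV F2" unfolding F2_def
    by (intro continuous_intros at0 x_smooth_continuous[OF x_smooth_partial[OF uh_x(1)]] G'_cont) (use a0 in auto)
  have pz: "partial_x i uh (x, 0) = 0" if "norm x > \<eta>" for i x
    by (rule partial_x_vanish[OF uh_x(1) uh_supp(1)]) (use that in auto)
  have i1: "integrable lborel F1" by (rule integrable_compact_support[OF c1, of \<eta>]) (simp add: F1_def uh_supp)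
  have i2: "integrable lborel F2" by (rule integrable_compact_support[OF c2, of \<eta>]) (simp add: F2_def pz)
  have st: "(0::real) \<le> 0" "0 \<le> T" using parameter_bounds by auto
  have F2: "F2 x = Qf (x, 0) * exp (- ((norm x)\<^sup>2 / (4 * a0)))" for x
  proof -
    have "(\<Sum>i\<in>UNIV. partial_x i uh (x, 0) * (\<Sum>j\<in>UNIV. G' i j (x, 0) * partial_x j uh (x, 0))) = Qf (x, 0)"
      unfolding Qf_eq grad_x_def inner_vec_def matrix_vector_mult_def G'_def using on_strip(2)[of "(x, 0)"] st by simp
    then show ?thesis by (simp add: F2_def)
  qed
  have F1: "F1 x = (u (x, 0))\<^sup>2 * exp (- ((norm x)\<^sup>2 / (4 * a0)))" for x
    using on_strip(1)[of "(x, 0)"] st by (simp add: F1_def)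
  have B: "B1 = integral\<^sup>L lborel F1" "B2 = integral\<^sup>L lborel F2"
    unfolding B1_def B2_def using c1 c2 F1 F2
    by (auto intro!: integral_lebesgue_cong_AE borel_measurable_continuous_onI simp: Qf_def)
  have i3: "integrable lborel (\<lambda>x. J.t (x, 0) * J.Q (x, 0))"
  proof (rule integrable_compact_support[where R = \<eta>])
    show "continuous_on UNIV (\<lambda>x. J.t (x, 0) * J.Q (x, 0))" by (intro continuous_intros at0 J.jet_continuous)
    show "J.t (x, 0) * J.Q (x, 0) = 0" if "norm x > \<eta>" for x using J.jet_supp[of "(x, 0)"] that by (simp add: J.Q_def)
  qed
  have pt: "- (J.t (x, 0) * J.Q (x, 0)) \<le> 2 * \<alpha> * \<sigma> 0 powr (- 2 * \<alpha> - 1) * F1 x - lam / 4 * \<sigma> 0 powr (- 2 * \<alpha>) * F2 x" for x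
  proof -
    let ?X = "(x, 0 :: real)"
    have E0: "E ?X = exp (- ((norm x)\<^sup>2 / (4 * a0)))" by (simp add: E_def tm0)
    have o: "(\<omega> ?X)\<^sup>2 = \<sigma> 0 powr (- 2 * \<alpha> - 1) * E ?X" using omega_sq[of ?X] by simp
    have v2: "(v ?X)\<^sup>2 = \<sigma> 0 powr (- 2 * \<alpha> - 1) * F1 x" unfolding v_def power_mult_distrib o F1_def E0 by simp
    have n0: "0 \<le> \<sigma> 0 powr (- 2 * \<alpha> - 1) * F1 x" unfolding F1_def by simp
    have "lam * ((\<omega> ?X)\<^sup>2 * Qf ?X) \<le> (norm (W ?X))\<^sup>2" using ellipticity(2)[of "W ?X" ?X] W_form[of ?X] st by simp
    then have "lam * (\<sigma> 0 powr (- 2 * \<alpha> - 1) * F2 x) \<le> (norm (W ?X))\<^sup>2" unfolding o F2 E0 by (simp add: mult_ac)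
    then have "a0 / 4 * (lam * (\<sigma> 0 powr (- 2 * \<alpha> - 1) * F2 x)) \<le> a0 / 4 * (norm (W ?X))\<^sup>2" using a0 by (intro mult_left_mono) auto
    \<comment> \<open>The factor a0 meets the power -2\<alpha>-1 of \<sigma>; since \<sigma> is at
      most a0 at this time, the product dominates the power -2\<alpha> of the theorem.\<close>
    moreover have "\<sigma> 0 * (lam / 4 * (\<sigma> 0 powr (- 2 * \<alpha> - 1) * F2 x)) \<le> a0 * (lam / 4 * (\<sigma> 0 powr (- 2 * \<alpha> - 1) * F2 x))"
      using sigma(2)[of 0] tm0 lam Qf_nonneg[of ?X] by (intro mult_right_mono) (auto simp: F2)
    ultimately have 1: "lam / 4 * \<sigma> 0 powr (- 2 * \<alpha>) * F2 x \<le> a0 / 4 * (norm (W ?X))\<^sup>2" unfolding sigma_powr(2) by (simp add: mult_ac)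
    have "b * (v ?X)\<^sup>2 \<le> 2 * \<alpha> * (\<sigma> 0 powr (- 2 * \<alpha> - 1) * F1 x)" unfolding v2 using parameter_bounds(5) n0 by (rule mult_right_mono)
    then show ?thesis using 1 boundary_pointwise[of x] by (simp add: mult.assoc)
  qed
  have "- (\<integral>x. J.t (x, 0) * J.Q (x, 0) \<partial>lborel) = (\<integral>x. - (J.t (x, 0) * J.Q (x, 0)) \<partial>lborel)" by simp
  also have "\<dots> \<le> (\<integral>x. 2 * \<alpha> * \<sigma> 0 powr (- 2 * \<alpha> - 1) * F1 x - lam / 4 * \<sigma> 0 powr (- 2 * \<alpha>) * F2 x \<partial>lborel)"
    by (intro integral_mono Bochner_Integration.integrable_diff integrable_mult_right i1 i2 pt Bochner_Integration.integrable_minus i3)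
  also have "\<dots> = 2 * \<alpha> * \<sigma> 0 powr (- 2 * \<alpha> - 1) * B1 - lam / 4 * \<sigma> 0 powr (- 2 * \<alpha>) * B2"
    unfolding B by (subst Bochner_Integration.integral_diff) (auto intro!: i1 i2)
  finally show ?thesis unfolding s0 .
qed

lemma B_nonneg: "0 \<le> B1" "0 \<le> B2"
  unfolding B1_def B2_def using Qf_nonneg by (auto intro!: integral_nonneg_AE simp: Qf_def)

text \<open>8192 exp 300 is the product of 2 exp 240 from \<open>lower_bound\<close> and 4096 exp
  60, the inverse of the coefficient p0 / 4096 of the integrated inequality.\<close>

lemma carleman_estimate:
  "\<alpha> * (LINT X:J.S|lborel. K1 X) + (LINT X:J.S|lborel. K2 X) \<le> 8192 * exp 300 / lam *
     (3 * (LINT X:J.S|lborel. K3 X) + 2 * \<alpha> * weight_sigma \<gamma> a0 powr (- 2 * \<alpha> - 1) * B1 - lam / 4 * weight_sigma \<gamma> a0 powr (- 2 * \<alpha>) * B2)"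
proof -
  have i1: "set_integrable lborel J.S (\<lambda>X. \<alpha> * K1 X)" by (rule set_integrable_mult_right) (rule K_integrable)
  have "\<alpha> * (LINT X:J.S|lborel. K1 X) + (LINT X:J.S|lborel. K2 X) = (LINT X:J.S|lborel. \<alpha> * K1 X + K2 X)"
    using set_integral_add(2)[OF i1 K_integrable(2)] by simp
  also have "\<dots> \<le> (LINT X:J.S|lborel. 2 * exp 240 / lam * J.lower X)"
    by (rule set_integral_mono[OF set_integral_add(1)[OF i1 K_integrable(2)]])
       (use lower_bound J.lower_integrable in \<open>auto intro!: set_integrable_mult_right\<close>)
  also have "\<dots> = 2 * exp 240 / lam * (LINT X:J.S|lborel. J.lower X)" by (rule set_integral_mult_right)
  also have "\<dots> \<le> 2 * exp 240 / lam * (4096 * exp 60 * (3 * (LINT X:J.S|lborel. K3 X) + 2 * \<alpha> * weight_sigma \<gamma> a0 powr (- 2 * \<alpha> - 1) * B1 - lam / 4 * weight_sigma \<gamma> a0 powr (- 2 * \<alpha>) * B2))"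
  proof (rule mult_left_mono)
    have "(LINT X:J.S|lborel. J.t X * (J.f X)\<^sup>2) \<le> (LINT X:J.S|lborel. K3 X)"
    proof (rule set_integral_mono[OF J.f_integrable K_integrable(3)])
      fix X
      have "1 * (J.t X * (J.f X)\<^sup>2) \<le> K3 X" unfolding K3_def using tm_sigma_ratio(1) J.t_pos[of X] by (intro mult_right_mono) auto
      then show "J.t X * (J.f X)\<^sup>2 \<le> K3 X" by simp
    qed
    then have "exp (-60) / 4096 * (LINT X:J.S|lborel. J.lower X) \<le> 3 * (LINT X:J.S|lborel. K3 X) + 2 * \<alpha> * weight_sigma \<gamma> a0 powr (- 2 * \<alpha> - 1) * B1 - lam / 4 * weight_sigma \<gamma> a0 powr (- 2 * \<alpha>) * B2" (is "_ \<le> ?R")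
      using J.carleman_integrated boundary by linarith
    then have "4096 * exp 60 * (exp (-60) / 4096 * (LINT X:J.S|lborel. J.lower X)) \<le> 4096 * exp 60 * ?R" by (intro mult_left_mono) auto
    moreover have "4096 * exp 60 * (exp (-60) / 4096 * z) = z" for z :: real by (simp add: exp_minus)
    ultimately have "(LINT X:J.S|lborel. J.lower X) \<le> 4096 * exp 60 * ?R" by (simp only:)
    then show "(LINT X:J.S|lborel. J.lower X) \<le> 4096 * exp 60 * ?R" .
  qed (use lam in auto)
  also have "\<dots> = 2 * 4096 * (exp 240 * exp 60) / lam * (3 * (LINT X:J.S|lborel. K3 X) + 2 * \<alpha> * weight_sigma \<gamma> a0 powr (- 2 * \<alpha> - 1) * B1 - lam / 4 * weight_sigma \<gamma> a0 powr (- 2 * \<alpha>) * B2)"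
    by simp
  also have "exp 240 * exp 60 = exp (300::real)" by (simp add: exp_add[symmetric])
  finally show ?thesis by simp
qed

lemma final_estimate:
  fixes C :: real
  defines "C \<equiv> 3 * (8192 * exp 300 / lam)"
  shows "\<alpha> * (LINT (x, s):open_half_space|lebesgue.
                   weight_sigma_shift \<gamma> a0 s powr (- 2 * \<alpha> - 2) * theta (\<gamma> * (s + a0)) * (u (x, s))\<^sup>2
                   * exp (- ((norm x)\<^sup>2 / (4 * (s + a0)))))
            + (LINT (x, s):open_half_space|lebesgue.
                   (s + a0) * weight_sigma_shift \<gamma> a0 s powr (- 2 * \<alpha> - 2) * theta (\<gamma> * (s + a0))
                   * norm_g_sq G (x, s) (grad_g G u (x, s))
                   * exp (- ((norm x)\<^sup>2 / (4 * (s + a0)))))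
            \<le> C * (LINT (x, s):open_half_space|lebesgue.
                   (s + a0)\<^sup>2 * weight_sigma_shift \<gamma> a0 s powr (- 2 * \<alpha> - 2)
                   * \<bar>parabolic_op G u (x, s)\<bar>\<^sup>2
                   * exp (- ((norm x)\<^sup>2 / (4 * (s + a0)))))
              + C powr \<alpha> * \<alpha> powr \<alpha> * (LINT (x, s):open_half_space|lebesgue.
                   (u (x, s))\<^sup>2 + (s + a0) * norm_g_sq G (x, s) (grad_g G u (x, s)))
              + C * \<alpha> * weight_sigma \<gamma> a0 powr (- 2 * \<alpha> - 1)
                  * (LINT x|lebesgue. (u (x, 0))\<^sup>2 * exp (- ((norm x)\<^sup>2 / (4 * a0))))
              - weight_sigma \<gamma> a0 powr (- 2 * \<alpha>) / C
                  * (LINT x|lebesgue. norm_g_sq G (x, 0) (grad_g G u (x, 0))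
                       * exp (- ((norm x)\<^sup>2 / (4 * a0))))"
proof -
  define K where "K = 8192 * exp 300 / lam"
  \<comment> \<open>One constant must bound the good terms from above and, through its inverse, the
    gradient trace from below. The factor 1/lam in K cancels the lam of the trace, leaving 2048 exp
    300, which is at least 1 and hence at least 1/C.\<close>
  have K: "1 \<le> K * lam / 4" "1 \<le> K"
  proof -
    have "(1::real) \<le> exp 300" by simp
    moreover have "K * lam / 4 = 2048 * exp 300" unfolding K_def using lam by simp
    ultimately show 1: "1 \<le> K * lam / 4" by linarith
    have "K * lam \<le> K * 1" using lam by (intro mult_left_mono) (auto simp: K_def)
    then show "1 \<le> K" using 1 by linarith
  qed
  have C: "C = 3 * K" "1 \<le> C" using K unfolding C_def K_def by auto
  define I4 where "I4 = (LINT (x, s):open_half_space|lebesgue. (u (x, s))\<^sup>2 + (s + a0) * norm_g_sq G (x, s) (grad_g G u (x, s)))"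
  have "0 \<le> I4" unfolding I4_def set_lebesgue_integral_def
  proof (intro integral_nonneg_AE AE_I2)
    fix X show "0 \<le> indicator open_half_space X *\<^sub>R (case X of (x, s) \<Rightarrow> (u (x, s))\<^sup>2 + (s + a0) * norm_g_sq G (x, s) (grad_g G u (x, s)))"
      using Qf_nonneg[of X] a0 by (cases X) (auto simp: open_half_space_def Qf_def split: split_indicator)
  qed
  \<comment> \<open>This term of the theorem is nonnegative, so it can be added to the right-hand
    side of the estimate already obtained.\<close>
  then have I4: "0 \<le> C powr \<alpha> * \<alpha> powr \<alpha> * I4" by simp
  define P where "P = weight_sigma \<gamma> a0 powr (- 2 * \<alpha> - 1) * B1"
  define R where "R = weight_sigma \<gamma> a0 powr (- 2 * \<alpha>) * B2"
  have PR: "0 \<le> P" "0 \<le> R" using B_nonneg by (auto simp: P_def R_def)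
  define L where "L = (LINT X:J.S|lborel. K3 X)"
  have "\<alpha> * (LINT X:J.S|lborel. K1 X) + (LINT X:J.S|lborel. K2 X) \<le> K * (3 * L + 2 * \<alpha> * P - lam / 4 * R)"
    using carleman_estimate unfolding K_def L_def P_def R_def by (simp only: mult.assoc)
  also have "\<dots> = C * L + 2 * K * (\<alpha> * P) - K * lam / 4 * R" unfolding C by (simp add: algebra_simps)
  also have "\<dots> \<le> C * L + C * (\<alpha> * P) - R / C"
  proof -
    have "2 * K * (\<alpha> * P) \<le> C * (\<alpha> * P)" using C K PR \<alpha> by (intro mult_right_mono) auto
    moreover have "R / C \<le> R" using C PR by (simp add: divide_le_eq mult_le_cancel_left1)
    moreover have "1 * R \<le> K * lam / 4 * R" using K PR by (intro mult_right_mono) auto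
    ultimately show ?thesis by linarith
  qed
  finally have "\<alpha> * (LINT X:J.S|lborel. K1 X) + (LINT X:J.S|lborel. K2 X) \<le> C * L + C powr \<alpha> * \<alpha> powr \<alpha> * I4 + C * (\<alpha> * P) - R / C"
    using I4 by linarith
  then show ?thesis unfolding function_integral gradient_integral operator_integral I4_def L_def P_def R_def B1_def B2_def by (simp add: mult.assoc)
qed

end

theorem theorem3p2p3:
  fixes lam Lam :: real
  assumes "0 < lam" "lam \<le> 1" "0 < Lam"
  shows "\<exists>C \<eta>\<^sub>0 \<delta>\<^sub>1 :: real. C \<ge> 1 \<and> 0 < \<eta>\<^sub>0 \<and> \<eta>\<^sub>0 < 1 \<and> 0 < \<delta>\<^sub>1 \<and> \<delta>\<^sub>1 < 1 \<and>
    (\<forall>G :: (real^'n::finite) \<times> real \<Rightarrow> real^'n^'n. admissible_coeff lam Lam G \<longrightarrow>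
      (\<forall>\<alpha> \<delta> a :: real. \<forall>u :: (real^'n) \<times> real \<Rightarrow> real.
         \<alpha> \<ge> 2 \<longrightarrow> 0 < \<delta> \<longrightarrow> \<delta> \<le> \<delta>\<^sub>1 \<longrightarrow> 0 < a \<longrightarrow> a \<le> \<delta>\<^sup>2 / (4 * \<alpha>) \<longrightarrow>
         Cinf_compact_on closed_half_space u \<longrightarrow>
         supp_on closed_half_space u \<subseteq> ball 0 \<eta>\<^sub>0 \<times> {0..<\<delta>\<^sup>2 / (2 * \<alpha>)} \<longrightarrow>
         (let \<gamma> = \<alpha> / \<delta>\<^sup>2 in
            \<alpha> * (LINT (x, s):open_half_space|lebesgue.
                   weight_sigma_shift \<gamma> a s powr (- 2 * \<alpha> - 2) * theta (\<gamma> * (s + a)) * (u (x, s))\<^sup>2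
                   * exp (- ((norm x)\<^sup>2 / (4 * (s + a)))))
            + (LINT (x, s):open_half_space|lebesgue.
                   (s + a) * weight_sigma_shift \<gamma> a s powr (- 2 * \<alpha> - 2) * theta (\<gamma> * (s + a))
                   * norm_g_sq G (x, s) (grad_g G u (x, s))
                   * exp (- ((norm x)\<^sup>2 / (4 * (s + a)))))
            \<le> C * (LINT (x, s):open_half_space|lebesgue.
                   (s + a)\<^sup>2 * weight_sigma_shift \<gamma> a s powr (- 2 * \<alpha> - 2)
                   * \<bar>parabolic_op G u (x, s)\<bar>\<^sup>2
                   * exp (- ((norm x)\<^sup>2 / (4 * (s + a)))))
              + C powr \<alpha> * \<alpha> powr \<alpha> * (LINT (x, s):open_half_space|lebesgue.
                   (u (x, s))\<^sup>2 + (s + a) * norm_g_sq G (x, s) (grad_g G u (x, s)))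
              + C * \<alpha> * weight_sigma \<gamma> a powr (- 2 * \<alpha> - 1)
                  * (LINT x|lebesgue. (u (x, 0))\<^sup>2 * exp (- ((norm x)\<^sup>2 / (4 * a))))
              - weight_sigma \<gamma> a powr (- 2 * \<alpha>) / C
                  * (LINT x|lebesgue. norm_g_sq G (x, 0) (grad_g G u (x, 0))
                       * exp (- ((norm x)\<^sup>2 / (4 * a)))))))"
proof -
  have n1: "1 \<le> real CARD('n)" by (simp add: Suc_leI)
  \<comment> \<open>The three constants are explicit in n, lam and Lam, the last two being the
    bounds built into \<open>carleman_setting\<close>; what remains before interpreting the locale
    is that they lie in the required ranges.\<close>
  let ?C = "3 * (8192 * exp 300 / lam)"
  let ?e = "1 / (4 * (real CARD('n))\<^sup>2 * (Lam + 1))"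
  let ?d = "exp (-60) / ((24 * real CARD('n)^4 * (1 + Lam)\<^sup>2)\<^sup>2 * 10^8)"
  have C: "1 \<le> ?C"
  proof -
    have "(1::real) \<le> exp 300" by simp
    then have "1 \<le> 3 * 8192 * exp (300::real)" by linarith
    then have "1 * 1 \<le> (3 * 8192 * exp 300) * (1 / lam)" using assms by (intro mult_mono) auto
    then show ?thesis by simp
  qed
  have e0: "0 < ?e" using assms by simp
  have "4 * 1 * 1 \<le> 4 * (real CARD('n))\<^sup>2 * (Lam + 1)" using assms n1 by (intro mult_mono) auto
  then have "1 < 4 * (real CARD('n))\<^sup>2 * (Lam + 1)" by linarith
  then have e1: "?e < 1" by (subst divide_less_eq_1_pos) linarith+
  have d: "1 * 10^8 \<le> (24 * real CARD('n)^4 * (1 + Lam)\<^sup>2)\<^sup>2 * 10^8"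
  proof (intro mult_right_mono)
    have "24 * 1 * 1 \<le> 24 * real CARD('n)^4 * (1 + Lam)\<^sup>2" using assms n1 by (intro mult_mono) auto
    then show "1 \<le> (24 * real CARD('n)^4 * (1 + Lam)\<^sup>2)\<^sup>2" by (simp add: one_le_power)
  qed simp
  then have d0: "0 < ?d" by (intro divide_pos_pos) auto
  have d1: "?d < 1"
      proof (subst divide_less_eq_1_pos)
    have "(1::real) \<le> 1 * 10^8" by simp
    from order.trans[OF this d] have D: "1 \<le> (24 * real CARD('n)^4 * (1 + Lam)\<^sup>2)\<^sup>2 * 10^8" .
    show "0 < (24 * real CARD('n)^4 * (1 + Lam)\<^sup>2)\<^sup>2 * 10^8" by (rule less_le_trans[OF zero_less_one D])
    show "exp (-60) < (24 * real CARD('n)^4 * (1 + Lam)\<^sup>2)\<^sup>2 * 10^8" by (rule less_le_trans[OF _ D]) simp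
  qed
  show ?thesis
    apply (rule exI[of _ ?C], rule exI[of _ ?e], rule exI[of _ ?d], intro conjI allI impI C e0 e1 d0 d1)
    subgoal premises * for G \<alpha> \<delta> a u
    proof -
      interpret carleman_setting G u lam Lam \<alpha> \<delta> a
        by unfold_locales (use assms * in auto)
      show ?thesis using final_estimate unfolding \<gamma>_def Let_def .
    qed
    done
qed

end
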